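(* Let $n\in\{2,3,4\}$ and $0<\alpha<2$. Let $\theta\in\dot{H}^{\frac{\alpha}{2}}(\mathbb{R}^n)$ be a solution of the equation $$(-\Delta)^{\frac{\alpha}{2}}\theta+\mathbb{A}_{[\theta]}\cdot\vec{\nabla}\theta=0,\qquad x\in\mathbb{R}^n$$ (the stationary fractional quasi-geostrophic equation with zero external force). Assume that $\theta$ is smooth and that $\theta\in L^{\frac{2n-\epsilon}{n-\alpha}}(\mathbb{R}^n)$ for some sufficiently small $\epsilon>0$ ($0<\epsilon\ll 1$, with the smallness depending only on $n$ and $\alpha$). Assume moreover that: 1) if $0<\alpha<\frac{n}{3}<2$ (for $n=2,3,4$), then in addition $\theta\in L^{\frac{2n+\nu}{n-\alpha}}(\mathbb{R}^n)$ for some real parameter $\nu$ such that $(n-3\alpha)<\nu<1+(n-3\alpha)$; 2) if $\frac{n+2}{3}\leq\alpha<2$ (for $n=2,3$), then in addition $\theta\in L^{\frac{3n}{n-1}}(\mathbb{R}^n)$. (For the remaining values of $\alpha$ no additional condition is imposed.) Then $\theta\equiv 0$.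
   Context: Functions are real valued on $\mathbb{R}^n$. The operator $(-\Delta)^{\frac{s}{2}}$ is the Fourier multiplier with symbol $|\xi|^{s}$, and $\|g\|_{\dot H^{s}(\mathbb{R}^n)}=\|(-\Delta)^{\frac{s}{2}}g\|_{L^2(\mathbb{R}^n)}$. Elements of $\dot H^{\frac{\alpha}{2}}(\mathbb{R}^n)$ are identified with functions via the Sobolev embedding $\dot H^{\frac{\alpha}{2}}(\mathbb{R}^n)\subset L^{\frac{2n}{n-\alpha}}(\mathbb{R}^n)$. The vector $\mathbb{A}_{[\theta]}=[A_1(\theta),\dots,A_n(\theta)]$ is given by fixed operators $A_1,\dots,A_n$, assumed to be singular integral operators (in particular linear) such that, for all $1<p<+\infty$ and all $\theta\in L^p(\mathbb{R}^n)$, $\|\mathbb{A}_{[\theta]}\|_{L^p}\leq C_{\mathbb{A}}\|\theta\|_{L^p}$; moreover $\mathbb{A}_{[\theta]}$ is assumed to be divergence free: $\mathrm{div}(\mathbb{A}_{[\theta]})=0$. Solutions are understood in the weak sense: since $\mathbb{A}_{[\theta]}\cdot\vec\nabla\theta=\mathrm{div}(\mathbb{A}_{[\theta]}\theta)$, the equation $(-\Delta)^{\frac{\alpha}{2}}\theta+\mathrm{div}(\mathbb{A}_{[\theta]}\theta)=0$ holds when tested against every function in $\mathcal{C}^\infty_0(\mathbb{R}^n)$. *)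

theory Defs
  imports "HOL-Analysis.Analysis"
begin

section \<open>Lebesgue spaces\<close>

definition Lp :: "real \<Rightarrow> (real^'n \<Rightarrow> 'b::real_normed_vector) \<Rightarrow> bool" where
  "Lp p f \<longleftrightarrow> f \<in> borel_measurable lborel \<and> integrable lborel (\<lambda>x. norm (f x) powr p)"

definition Lp_norm :: "real \<Rightarrow> (real^'n \<Rightarrow> 'b::real_normed_vector) \<Rightarrow> real" where
  "Lp_norm p f = (\<integral>x. norm (f x) powr p \<partial>lborel) powr (1 / p)"


section \<open>Smooth functions, test functions, Schwartz functions\<close>

definition partial_deriv :: "'n::finite \<Rightarrow> (real^'n \<Rightarrow> 'b::real_normed_vector) \<Rightarrow> real^'n \<Rightarrow> 'b" where
  "partial_deriv i f x = frechet_derivative f (at x) (axis i 1)"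

definition grad :: "(real^'n \<Rightarrow> real) \<Rightarrow> real^'n \<Rightarrow> real^'n" where
  "grad f x = (\<chi> i. partial_deriv i f x)"

text \<open>The list \<open>is\<close> plays the role of a multi-index. Differentiability of all iterated partial
  derivatives makes them all continuous, so this is exactly the class \<open>C\<^sup>\<infinity>\<close>.\<close>

definition smooth :: "(real^'n \<Rightarrow> 'b::real_normed_vector) \<Rightarrow> bool" where
  "smooth f \<longleftrightarrow> (\<forall>is x. foldr partial_deriv is f differentiable (at x))"

definition fun_support :: "(real^'n \<Rightarrow> 'b::real_normed_vector) \<Rightarrow> (real^'n) set" where
  "fun_support f = closure {x. f x \<noteq> 0}"

definition test_function :: "(real^'n \<Rightarrow> real) \<Rightarrow> bool" where
  "test_function \<phi> \<longleftrightarrow> smooth \<phi> \<and> compact (fun_support \<phi>)"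

definition schwartz :: "(real^'n \<Rightarrow> complex) \<Rightarrow> bool" where
  "schwartz \<phi> \<longleftrightarrow> smooth \<phi> \<and>
     (\<forall>k is. bounded (range (\<lambda>x. norm x ^ k *\<^sub>R foldr partial_deriv is \<phi> x)))"


section \<open>Fourier transform and fractional Laplacian\<close>

definition fourier :: "(real^'n \<Rightarrow> complex) \<Rightarrow> real^'n \<Rightarrow> complex" where
  "fourier \<phi> \<xi> = (\<integral>x. cis (- (x \<bullet> \<xi>)) * \<phi> x \<partial>lborel)"

definition inv_fourier :: "(real^'n \<Rightarrow> complex) \<Rightarrow> real^'n \<Rightarrow> complex" where
  "inv_fourier \<phi> x = (\<integral>\<xi>. cis (x \<bullet> \<xi>) * \<phi> \<xi> \<partial>lborel) / of_real ((2 * pi) ^ CARD('n))"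

text \<open>Functions that are absolutely integrable against every Schwartz function, that is, functions
  that define tempered distributions by integration. The Fourier transform of such a
  distribution is given by duality; below it is only considered when it is again a function,
  which is then unique up to null sets.\<close>

definition tempered :: "(real^'n \<Rightarrow> complex) \<Rightarrow> bool" where
  "tempered f \<longleftrightarrow> f \<in> borel_measurable lborel \<and>
     (\<forall>\<phi>. schwartz \<phi> \<longrightarrow> integrable lborel (\<lambda>x. f x * \<phi> x))"

definition has_fourier :: "(real^'n \<Rightarrow> complex) \<Rightarrow> (real^'n \<Rightarrow> complex) \<Rightarrow> bool" where
  "has_fourier f g \<longleftrightarrow> tempered f \<and> tempered g \<and>
     (\<forall>\<phi>. schwartz \<phi> \<longrightarrow>
        (\<integral>x. f x * fourier \<phi> x \<partial>lborel) = (\<integral>\<xi>. g \<xi> * \<phi> \<xi> \<partial>lborel))"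

definition fourier_of :: "(real^'n \<Rightarrow> real) \<Rightarrow> real^'n \<Rightarrow> complex" where
  "fourier_of f = (SOME g. has_fourier (\<lambda>x. complex_of_real (f x)) g)"

text \<open>\<open>h\<close> is the function \<open>(-\<Delta>)\<^bsup>s/2\<^esup> f\<close>.\<close>

definition is_frac_laplacian :: "real \<Rightarrow> (real^'n \<Rightarrow> real) \<Rightarrow> (real^'n \<Rightarrow> real) \<Rightarrow> bool" where
  "is_frac_laplacian s f h \<longleftrightarrow>
     (\<exists>g. has_fourier (\<lambda>x. complex_of_real (f x)) g \<and>
          has_fourier (\<lambda>x. complex_of_real (h x)) (\<lambda>\<xi>. of_real (norm \<xi> powr s) * g \<xi>))"

text \<open>The homogeneous Sobolev space of order \<open>s\<close>, for \<open>0 < s < n/2\<close>; its elements are the functions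
  provided by the Sobolev embedding.\<close>

definition Hdot :: "real \<Rightarrow> (real^'n \<Rightarrow> real) \<Rightarrow> bool" where
  "Hdot s f \<longleftrightarrow> Lp (2 * real CARD('n) / (real CARD('n) - 2 * s)) f \<and>
     (\<exists>h. is_frac_laplacian s f h \<and> Lp 2 h)"

text \<open>The value at \<open>\<phi>\<close> of the distribution \<open>(-\<Delta>)\<^bsup>s/2\<^esup> f\<close>, namely of the tempered distribution with
  Fourier transform \<open>|\<xi>|\<^sup>s\<close> times that of \<open>f\<close>; it need not be a function.\<close>

definition frac_laplacian_distr :: "real \<Rightarrow> (real^'n \<Rightarrow> real) \<Rightarrow> (real^'n \<Rightarrow> real) \<Rightarrow> complex" where
  "frac_laplacian_distr s f \<phi> =
     (\<integral>\<xi>. of_real (norm \<xi> powr s) * fourier_of f \<xi> *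
           inv_fourier (\<lambda>x. complex_of_real (\<phi> x)) \<xi> \<partial>lborel)"

text \<open>The value at \<open>\<phi>\<close> of the distribution \<open>div F\<close>.\<close>

definition div_distr :: "(real^'n \<Rightarrow> real^'n) \<Rightarrow> (real^'n \<Rightarrow> real) \<Rightarrow> real" where
  "div_distr F \<phi> = - (\<integral>x. F x \<bullet> grad \<phi> x \<partial>lborel)"


section \<open>Singular integral operators\<close>

text \<open>Standard Calderon-Zygmund kernels; the values on the diagonal are irrelevant.\<close>

definition standard_kernel :: "(real^'n \<Rightarrow> real^'n \<Rightarrow> real) \<Rightarrow> bool" where
  "standard_kernel K \<longleftrightarrow> (\<exists>C \<delta>. 0 < \<delta> \<and> \<delta> \<le> 1 \<and>
     (\<forall>x y. x \<noteq> y \<longrightarrow> \<bar>K x y\<bar> \<le> C / dist x y ^ CARD('n)) \<and>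
     (\<forall>x x' y. x \<noteq> y \<and> 2 * dist x x' \<le> dist x y \<longrightarrow>
        \<bar>K x y - K x' y\<bar> \<le> C * dist x x' powr \<delta> / dist x y powr (real CARD('n) + \<delta>)) \<and>
     (\<forall>x y y'. x \<noteq> y \<and> 2 * dist y y' \<le> dist x y \<longrightarrow>
        \<bar>K x y - K x y'\<bar> \<le> C * dist y y' powr \<delta> / dist x y powr (real CARD('n) + \<delta>)))"

text \<open>Operators act on representatives of elements of \<open>L\<^sup>p\<close>, \<open>1 < p < \<infinity>\<close>; hence all
  identities between images hold almost everywhere.\<close>

definition singular_integral_operator :: "((real^'n \<Rightarrow> real) \<Rightarrow> real^'n \<Rightarrow> real) \<Rightarrow> bool" where
  "singular_integral_operator T \<longleftrightarrow>
     (\<forall>p f g a b. 1 < p \<and> Lp p f \<and> Lp p g \<longrightarrow>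
        (AE x in lborel. T (\<lambda>y. a * f y + b * g y) x = a * T f x + b * T g x)) \<and>
     (\<exists>K. standard_kernel K \<and>
        (\<forall>\<phi>. test_function \<phi> \<longrightarrow>
           (AE x in lborel. x \<notin> fun_support \<phi> \<longrightarrow> T \<phi> x = (\<integral>y. K x y * \<phi> y \<partial>lborel))))"

definition field_of ::
  "('n \<Rightarrow> (real^'n \<Rightarrow> real) \<Rightarrow> real^'n \<Rightarrow> real) \<Rightarrow> (real^'n \<Rightarrow> real) \<Rightarrow> real^'n \<Rightarrow> real^'n" where
  "field_of A \<theta> x = (\<chi> i. A i \<theta> x)"

definition admissible :: "('n \<Rightarrow> (real^'n \<Rightarrow> real) \<Rightarrow> real^'n \<Rightarrow> real) \<Rightarrow> bool" where
  "admissible A \<longleftrightarrow>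
     (\<forall>i. singular_integral_operator (A i)) \<and>
     (\<forall>p>1. \<exists>C. \<forall>\<theta>. Lp p \<theta> \<longrightarrow>
        Lp p (field_of A \<theta>) \<and> Lp_norm p (field_of A \<theta>) \<le> C * Lp_norm p \<theta>) \<and>
     (\<forall>p \<theta> \<phi>. 1 < p \<and> Lp p \<theta> \<and> test_function \<phi> \<longrightarrow> div_distr (field_of A \<theta>) \<phi> = 0)"

definition weak_solution ::
  "real \<Rightarrow> ('n \<Rightarrow> (real^'n \<Rightarrow> real) \<Rightarrow> real^'n \<Rightarrow> real) \<Rightarrow> (real^'n \<Rightarrow> real) \<Rightarrow> bool" where
  "weak_solution \<alpha> A \<theta> \<longleftrightarrow>
     (\<forall>\<phi>. test_function \<phi> \<longrightarrow>
        frac_laplacian_distr \<alpha> \<theta> \<phi> +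
          of_real (div_distr (\<lambda>x. \<theta> x *\<^sub>R field_of A \<theta> x) \<phi>) = 0)"

end

theory Submission
  imports Defs "HOL-Probability.Characteristic_Functions" "HOL-Computational_Algebra.Polynomial"
begin

text \<open>The equation is tested with \<open>\<theta> \<phi>\<close>, where \<open>\<phi>(x) = \<phi>\<^sub>1(x/R)\<close> is a smooth cutoff equal to \<open>1\<close> on the ball
of radius \<open>R\<close>, and \<open>R\<close> is sent to infinity.

In the transport term, \<open>div A = 0\<close> makes every derivative of \<open>\<theta>\<close> disappear, and what remains is
\<open>(1/2) \<integral> \<theta>\<^sup>2 A \<bullet> \<nabla>\<phi>\<close> (lemma \<open>weak_solution_tested\<close>). The gradient has size \<open>1/R\<close> and lives on the
shell \<open>R \<le> |x| \<le> 2R\<close>, so this term is at most a multiple of \<open>1/R\<close> times the integral of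
\<open>|\<theta>|\<^sup>3 + |A|\<^sup>3\<close> over the shell. It tends to \<open>0\<close> as soon as \<open>\<theta>\<close>, and therefore \<open>A\<close>, lies in \<open>L\<^sup>p\<close> for
some \<open>p\<close> between \<open>3\<close> and \<open>3n/(n-1)\<close> (lemma \<open>flux_tendsto\<close>). The critical exponent \<open>2n/(n-\<alpha>)\<close> of the
Sobolev embedding lies in this window exactly when \<open>n/3 \<le> \<alpha> \<le> (n+2)/3\<close>. For other \<open>\<alpha>\<close> an exponent
of the window comes from the additional conditions of the theorem: \<open>3\<close> for small \<open>\<alpha>\<close>, by interpolation
with the critical exponent, and \<open>3n/(n-1)\<close> for large \<open>\<alpha>\<close>.

In the diffusion term, \<open>|\<xi>|\<^sup>\<alpha>\<close> is, up to a constant, the integral of \<open>1 - cos(\<xi> \<bullet> y)\<close> against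
\<open>|y|\<close> to the power \<open>-(n+\<alpha>)\<close>. Multiplication by \<open>1 - cos(\<xi> \<bullet> y)\<close> on the Fourier side is the second
difference \<open>\<psi>(x) - (\<psi>(x+y) + \<psi>(x-y))/2\<close> on the other, so Fourier inversion for test functions and
Fubini turn the fractional Laplacian into a singular integral of second differences
(lemma \<open>frac_laplacian_singular_integral\<close>). For \<open>\<psi> = \<theta>\<phi>\<close>, an algebraic identity
(lemma \<open>localised_energy_identity\<close>) splits this integral into the localised energy, with integrand
\<open>(\<phi>(x) + \<phi>(x+y)) (\<theta>(x) - \<theta>(x+y))\<^sup>2 \<ge> 0\<close>, and an error in which \<open>\<theta>\<^sup>2\<close> is paired with second differences
of \<open>\<phi>\<close>. Integrated over \<open>y\<close> against the kernel, these second differences are of size \<open>R\<close> to the power \<open>-\<alpha>\<close> pointwise and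
\<open>n-\<alpha>\<close> in \<open>L\<^sup>1\<close>. At the critical
exponent these sizes balance; with the gain \<open>\<epsilon>\<close> in integrability of \<open>\<theta>\<close> the error tends to \<open>0\<close> (lemma \<open>cutoff_error_tendsto\<close>).

The localised energies therefore tend to \<open>0\<close>. They dominate the energy over a fixed ball, which must
vanish, so that \<open>\<theta>\<close> is constant; being in \<open>L\<^sup>p\<close>, it is \<open>0\<close>.\<close>


section \<open>Calculus of smooth functions\<close>

lemma partial_deriv_eq:
  assumes "(f has_derivative D) (at x)"
  shows "partial_deriv i f x = D (axis i 1)"
  using frechet_derivative_at[OF assms] by (simp add: partial_deriv_def)

text \<open>Splitting off the innermost derivative of each list gives a recursive description of smoothness; the
coinduction rule below is what closure properties are proved with.\<close>

lemma smooth_unfold: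
  "smooth f \<longleftrightarrow> (\<forall>x. f differentiable (at x)) \<and> (\<forall>i. smooth (partial_deriv i f))"
proof
  assume s: "smooth f"
  have "foldr partial_deriv is (partial_deriv i f) differentiable (at x)" for "is" i x
    using s[unfolded smooth_def, rule_format, of "is @ [i]" x] by simp
  moreover have "f differentiable (at x)" for x
    using s[unfolded smooth_def, rule_format, of "[]" x] by simp
  ultimately show "(\<forall>x. f differentiable (at x)) \<and> (\<forall>i. smooth (partial_deriv i f))"
    by (auto simp: smooth_def)
next
  assume r: "(\<forall>x. f differentiable (at x)) \<and> (\<forall>i. smooth (partial_deriv i f))"
  have "foldr partial_deriv is f differentiable (at x)" for "is" x
    using r by (cases "is" rule: rev_cases) (auto simp: smooth_def)
  then show "smooth f" by (auto simp: smooth_def)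
qed

lemma smooth_differentiable: "smooth f \<Longrightarrow> f differentiable (at x)"
  and smooth_partial_deriv: "smooth f \<Longrightarrow> smooth (partial_deriv i f)"
  using smooth_unfold by blast+

lemma smooth_has_derivative:
  "smooth f \<Longrightarrow> (f has_derivative frechet_derivative f (at x)) (at x)"
  using smooth_differentiable frechet_derivative_works by blast

lemma smooth_continuous_on: "smooth f \<Longrightarrow> continuous_on S f"
  by (meson continuous_at_imp_continuous_on differentiable_imp_continuous_within
      smooth_differentiable)

lemma smooth_measurable [measurable (raw)]: "smooth f \<Longrightarrow> f \<in> borel_measurable borel"
  by (intro borel_measurable_continuous_onI smooth_continuous_on)

text \<open>Smoothness follows from membership in any class of differentiable functions that is stable under
partial derivatives. The proofs below choose the class so that it absorbs the terms produced by the
relevant differentiation rule.\<close>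

lemma smooth_coinduct:
  assumes "P f"
    and diff: "\<And>g x. P g \<Longrightarrow> g differentiable (at x)"
    and step: "\<And>g i. P g \<Longrightarrow> P (partial_deriv i g)"
  shows "smooth f"
proof -
  have "P (foldr partial_deriv is f)" for "is"
    by (induction "is") (auto intro: assms)
  then show ?thesis using diff by (auto simp: smooth_def)
qed

lemma partial_deriv_const: "partial_deriv i (\<lambda>x. c) = (\<lambda>x. 0)"
  by (rule ext, subst partial_deriv_eq[OF has_derivative_const]) simp

lemma smooth_const: "smooth (\<lambda>x. c)"
  by (rule smooth_coinduct[where P = "\<lambda>f. \<exists>c. f = (\<lambda>x. c)"]) (auto simp: partial_deriv_const)

lemma partial_deriv_add:
  assumes "smooth f" "smooth g"
  shows "partial_deriv i (\<lambda>x. f x + g x) = (\<lambda>x. partial_deriv i f x + partial_deriv i g x)"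
  by (rule ext, subst partial_deriv_eq[OF has_derivative_add[OF assms[THEN smooth_has_derivative]]])
    (simp add: partial_deriv_def)

lemma smooth_add:
  assumes "smooth f" "smooth g"
  shows "smooth (\<lambda>x. f x + g x)"
proof (rule smooth_coinduct[where P = "\<lambda>h. \<exists>f g. smooth f \<and> smooth g \<and> h = (\<lambda>x. f x + g x)"])
  show "\<exists>f' g'. smooth f' \<and> smooth g' \<and> (\<lambda>x. f x + g x) = (\<lambda>x. f' x + g' x)"
    using assms by blast
next
  fix h :: "real^'a \<Rightarrow> 'b" and x
  assume "\<exists>f g. smooth f \<and> smooth g \<and> h = (\<lambda>x. f x + g x)"
  then show "h differentiable (at x)" by (elim exE conjE) (simp add: differentiable_add smooth_differentiable)
next
  fix h :: "real^'a \<Rightarrow> 'b" and i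
  assume "\<exists>f g. smooth f \<and> smooth g \<and> h = (\<lambda>x. f x + g x)"
  then obtain f g where *: "smooth f" "smooth g" "h = (\<lambda>x. f x + g x)" by blast
  then have "partial_deriv i h = (\<lambda>x. partial_deriv i f x + partial_deriv i g x)"
    by (simp add: partial_deriv_add)
  then show "\<exists>f g. smooth f \<and> smooth g \<and> partial_deriv i h = (\<lambda>x. f x + g x)"
    using * smooth_partial_deriv by blast
qed

lemma partial_deriv_linear:
  assumes "bounded_linear L" "smooth f"
  shows "partial_deriv i (\<lambda>x. L (f x)) = (\<lambda>x. L (partial_deriv i f x))"
  by (rule ext, subst partial_deriv_eq[OF bounded_linear.has_derivative[OF assms(1)
        smooth_has_derivative[OF assms(2)]]]) (simp add: partial_deriv_def)

lemma smooth_linear: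
  assumes "bounded_linear L" "smooth f"
  shows "smooth (\<lambda>x. L (f x))"
proof (rule smooth_coinduct[where P = "\<lambda>h. \<exists>f. smooth f \<and> h = (\<lambda>x. L (f x))"])
  fix h and x
  assume "\<exists>f. smooth f \<and> h = (\<lambda>x. L (f x))"
  then show "h differentiable (at x)"
    using bounded_linear.has_derivative[OF assms(1) smooth_has_derivative]
    by (auto simp: differentiable_def)
next
  fix h and i
  assume "\<exists>f. smooth f \<and> h = (\<lambda>x. L (f x))"
  then show "\<exists>f. smooth f \<and> partial_deriv i h = (\<lambda>x. L (f x))"
    using partial_deriv_linear[OF assms(1)] smooth_partial_deriv by blast
qed (use assms in blast)

lemma partial_deriv_affine:
  assumes "smooth f"
  shows "partial_deriv i (\<lambda>x. f (r *\<^sub>R x + a)) = (\<lambda>x. r *\<^sub>R partial_deriv i f (r *\<^sub>R x + a))"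
proof (rule ext)
  fix x
  have "((\<lambda>x. f (r *\<^sub>R x + a)) has_derivative
      (\<lambda>v. frechet_derivative f (at (r *\<^sub>R x + a)) (r *\<^sub>R v))) (at x)"
    by (rule has_derivative_compose[where f = "\<lambda>x. r *\<^sub>R x + a" and g = f, OF _ smooth_has_derivative[OF assms]])
      (auto intro!: derivative_eq_intros)
  from partial_deriv_eq[OF this]
  show "partial_deriv i (\<lambda>x. f (r *\<^sub>R x + a)) x = r *\<^sub>R partial_deriv i f (r *\<^sub>R x + a)"
    by (simp add: partial_deriv_def linear_scale[OF linear_frechet_derivative]
        smooth_differentiable[OF assms])
qed

lemma smooth_affine:
  assumes "smooth f"
  shows "smooth (\<lambda>x. f (r *\<^sub>R x + a))"
proof (rule smooth_coinduct[where P = "\<lambda>h. \<exists>f. smooth f \<and> h = (\<lambda>x. f (r *\<^sub>R x + a))"])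
  fix h :: "real^'a \<Rightarrow> 'b" and x
  assume "\<exists>f. smooth f \<and> h = (\<lambda>x. f (r *\<^sub>R x + a))"
  then obtain f where f: "smooth f" "h = (\<lambda>x. f (r *\<^sub>R x + a))" by blast
  show "h differentiable (at x)" unfolding f
    by (rule differentiable_compose[of f "\<lambda>x. r *\<^sub>R x + a", OF smooth_differentiable[OF f(1)]])
      simp
next
  fix h :: "real^'a \<Rightarrow> 'b" and i
  assume "\<exists>f. smooth f \<and> h = (\<lambda>x. f (r *\<^sub>R x + a))"
  then obtain f where f: "smooth f" "h = (\<lambda>x. f (r *\<^sub>R x + a))" by blast
  have "smooth (\<lambda>x. r *\<^sub>R partial_deriv i f x)"
    by (intro smooth_linear[OF bounded_linear_scaleR_right] smooth_partial_deriv f)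
  then show "\<exists>g. smooth g \<and> partial_deriv i h = (\<lambda>x. g (r *\<^sub>R x + a))"
    unfolding f partial_deriv_affine[OF f(1)] by blast
qed (use assms in blast)

lemma partial_deriv_mult:
  fixes f g :: "real^'n \<Rightarrow> 'b::real_normed_algebra"
  assumes "smooth f" "smooth g"
  shows "partial_deriv i (\<lambda>x. f x * g x) =
    (\<lambda>x. f x * partial_deriv i g x + partial_deriv i f x * g x)"
  by (rule ext, subst partial_deriv_eq[OF has_derivative_mult[OF assms[THEN smooth_has_derivative]]])
    (simp add: partial_deriv_def)

text \<open>Finite sums of products of smooth functions: the smallest class that contains the products and is
stable under the Leibniz rule.\<close>

inductive leibniz :: "(real^'n \<Rightarrow> 'b::real_normed_algebra) \<Rightarrow> bool" where
  prod: "smooth f \<Longrightarrow> smooth g \<Longrightarrow> leibniz (\<lambda>x. f x * g x)"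
| add: "leibniz f \<Longrightarrow> leibniz g \<Longrightarrow> leibniz (\<lambda>x. f x + g x)"

lemma smooth_mult:
  fixes f g :: "real^'n \<Rightarrow> 'b::real_normed_algebra"
  assumes "smooth f" "smooth g"
  shows "smooth (\<lambda>x. f x * g x)"
proof -
  have diff: "h differentiable (at x)" if "leibniz h" for h :: "real^'n \<Rightarrow> 'b" and x
    using that by induction (simp_all add: differentiable_mult differentiable_add smooth_differentiable)
  have "leibniz (partial_deriv i h)" if "leibniz h" for h :: "real^'n \<Rightarrow> 'b" and i
    using that
  proof induction
    case (prod f g)
    then show ?case
      by (auto simp: partial_deriv_mult intro!: leibniz.intros smooth_partial_deriv)
  next
    case (add f g)
    have "partial_deriv i (\<lambda>x. f x + g x) = (\<lambda>x. partial_deriv i f x + partial_deriv i g x)"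
      using has_derivative_add[of f _ _ g] diff[OF add.hyps(1)] diff[OF add.hyps(2)]
      by (intro ext, subst partial_deriv_eq[OF has_derivative_add])
        (auto simp: partial_deriv_def frechet_derivative_works)
    then show ?case using add by (auto intro: leibniz.add)
  qed
  then show ?thesis
    using leibniz.prod[OF assms] diff by (intro smooth_coinduct[of leibniz]) auto
qed

text \<open>The same device for the chain rule, with inner function \<open>g\<close>: differentiating \<open>f(g(x)) h(x)\<close> gives
\<open>f'(g(x))\<close> times a smooth factor plus \<open>f(g(x))\<close> times another one.\<close>

inductive chain :: "(real \<Rightarrow> real) set \<Rightarrow> (real^'n \<Rightarrow> real) \<Rightarrow> (real^'n \<Rightarrow> real) \<Rightarrow> bool" for F g where
  base: "f \<in> F \<Longrightarrow> smooth h \<Longrightarrow> chain F g (\<lambda>x. f (g x) * h x)"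
| add: "chain F g h \<Longrightarrow> chain F g k \<Longrightarrow> chain F g (\<lambda>x. h x + k x)"

text \<open>Here \<open>F\<close> is a family of functions of one variable that is stable under differentiation, which is how
smoothness of the outer function is supplied.\<close>

lemma smooth_compose:
  fixes g :: "real^'n \<Rightarrow> real"
  assumes F: "\<And>f. f \<in> F \<Longrightarrow> \<exists>f'\<in>F. \<forall>t. (f has_real_derivative f' t) (at t)"
    and f: "f \<in> F" and g: "smooth g"
  shows "smooth (\<lambda>x. f (g x))"
proof -
  have fg: "((\<lambda>x. f (g x)) has_derivative (\<lambda>v. f' (g x) * frechet_derivative g (at x) v)) (at x)"
    if "\<forall>t. (f has_real_derivative f' t) (at t)" for f f' x
    using has_derivative_compose[OF smooth_has_derivative[OF g], of f "(*) (f' (g x))" x] that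
    by (simp add: has_field_derivative_def)
  have diff: "h differentiable (at x)" if "chain F g h" for h x
    using that
  proof induction
    case (base f h)
    then obtain f' where "\<forall>t. (f has_real_derivative f' t) (at t)" using F by blast
    from fg[OF this, of x] have "(\<lambda>x. f (g x)) differentiable (at x)"
      by (auto simp: differentiable_def)
    then show ?case using base by (simp add: differentiable_mult smooth_differentiable)
  qed (auto intro: differentiable_add)
  have step: "chain F g (partial_deriv i h)" if "chain F g h" for h i
    using that
  proof induction
    case (base f h)
    then obtain f' where f': "f' \<in> F" "\<forall>t. (f has_real_derivative f' t) (at t)" using F by blast
    have "partial_deriv i (\<lambda>x. f (g x) * h x) =
        (\<lambda>x. f (g x) * partial_deriv i h x + f' (g x) * (partial_deriv i g x * h x))"
      by (rule ext, subst partial_deriv_eq[OF has_derivative_mult[OF fg[OF f'(2)]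
              smooth_has_derivative[OF base(2)]]]) (simp add: partial_deriv_def)
    then show ?case using base f' g
      by (auto intro!: chain.intros smooth_partial_deriv smooth_mult)
  next
    case (add h k)
    have "partial_deriv i (\<lambda>x. h x + k x) = (\<lambda>x. partial_deriv i h x + partial_deriv i k x)"
      using diff[OF add.hyps(1)] diff[OF add.hyps(2)]
      by (intro ext, subst partial_deriv_eq[OF has_derivative_add])
        (auto simp: partial_deriv_def frechet_derivative_works)
    then show ?case using add by (auto intro: chain.add)
  qed
  have "smooth (\<lambda>x. f (g x) * 1)"
    by (rule smooth_coinduct[of "chain F g", OF chain.base[OF f smooth_const] diff step])
  then show ?thesis by simp
qed

lemma smooth_coord: "smooth (\<lambda>x::real^'n. x $ i)"
proof -
  have "partial_deriv j (\<lambda>x::real^'n. x $ i) = (\<lambda>x. axis j 1 $ i)" for j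
    by (rule ext, subst partial_deriv_eq[OF bounded_linear_imp_has_derivative[OF bounded_linear_vec_nth]])
      simp
  then show ?thesis
    by (subst smooth_unfold)
      (auto simp: smooth_const bounded_linear_imp_differentiable bounded_linear_vec_nth)
qed

lemma smooth_sum:
  "finite I \<Longrightarrow> (\<And>i. i \<in> I \<Longrightarrow> smooth (f i)) \<Longrightarrow> smooth (\<lambda>x. \<Sum>i\<in>I. f i x)"
  by (induction I rule: finite_induct) (auto intro: smooth_const smooth_add)

lemma smooth_norm_square: "smooth (\<lambda>x::real^'n. norm x ^ 2)"
proof -
  have "smooth (\<lambda>x::real^'n. \<Sum>i\<in>UNIV. x $ i * x $ i)"
    by (intro smooth_sum smooth_mult smooth_coord) auto
  then show ?thesis
    by (simp add: power2_norm_eq_inner inner_vec_def)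
qed

lemma frechet_derivative_partial:
  fixes f :: "real^'n \<Rightarrow> 'b::real_normed_vector"
  assumes "f differentiable (at x)"
  shows "frechet_derivative f (at x) v = (\<Sum>i\<in>UNIV. v $ i *\<^sub>R partial_deriv i f x)"
proof -
  have lin: "linear (frechet_derivative f (at x))"
    using assms by (rule linear_frechet_derivative)
  have "v = (\<Sum>i\<in>UNIV. v $ i *\<^sub>R axis i 1)"
    by (simp add: basis_expansion scalar_mult_eq_scaleR[symmetric])
  then have "frechet_derivative f (at x) v = frechet_derivative f (at x) (\<Sum>i\<in>UNIV. v $ i *\<^sub>R axis i 1)"
    by simp
  also have "\<dots> = (\<Sum>i\<in>UNIV. v $ i *\<^sub>R partial_deriv i f x)"
    by (simp add: linear_sum[OF lin] linear_scale[OF lin] partial_deriv_def)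
  finally show ?thesis .
qed


section \<open>Compactly supported smooth functions\<close>

text \<open>The space \<open>C\<^sub>c\<^sup>\<infinity>\<close>, with values in any normed space: the Fourier side needs complex-valued test functions.\<close>

definition cinf_c :: "(real^'n \<Rightarrow> 'b::real_normed_vector) \<Rightarrow> bool" where
  "cinf_c f \<longleftrightarrow> smooth f \<and> (\<exists>r. \<forall>x. r < norm x \<longrightarrow> f x = 0)"

lemma cinf_c_smooth: "cinf_c f \<Longrightarrow> smooth f"
  by (simp add: cinf_c_def)

lemma test_function_iff: "test_function f \<longleftrightarrow> cinf_c f"
proof -
  have "(\<exists>r. \<forall>x. r < norm x \<longrightarrow> f x = 0)" if supp: "compact (fun_support f)"
  proof -
    obtain r where "\<forall>x\<in>fun_support f. norm x \<le> r"
      using compact_imp_bounded[OF supp] by (auto simp: bounded_iff)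
    moreover have "x \<in> fun_support f" if "f x \<noteq> 0" for x
      using that closure_subset[of "{x. f x \<noteq> 0}"] by (auto simp: fun_support_def)
    ultimately show ?thesis by (meson linorder_not_less)
  qed
  moreover have "compact (fun_support f)" if "\<forall>x. r < norm x \<longrightarrow> f x = 0" for r
  proof -
    have "{x. f x \<noteq> 0} \<subseteq> cball 0 r"
      using that by (force simp: not_less)
    then have "fun_support f \<subseteq> cball 0 r"
      unfolding fun_support_def by (rule closure_minimal) simp
    then show ?thesis
      using bounded_subset[OF bounded_cball] by (auto simp: compact_eq_bounded_closed fun_support_def)
  qed
  ultimately show ?thesis by (auto simp: test_function_def cinf_c_def)
qed

lemma cinf_c_add: "cinf_c f \<Longrightarrow> cinf_c g \<Longrightarrow> cinf_c (\<lambda>x. f x + g x)"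
  unfolding cinf_c_def
proof (elim conjE exE, intro conjI)
  fix r s assume "\<forall>x. r < norm x \<longrightarrow> f x = 0" "\<forall>x. s < norm x \<longrightarrow> g x = 0"
  then show "\<exists>r. \<forall>x. r < norm x \<longrightarrow> f x + g x = 0"
    by (intro exI[of _ "max r s"]) auto
qed (rule smooth_add)

lemma cinf_c_linear:
  assumes "bounded_linear L" "cinf_c f"
  shows "cinf_c (\<lambda>x. L (f x))"
proof -
  obtain r where "\<And>x. r < norm x \<Longrightarrow> f x = 0" using assms by (auto simp: cinf_c_def)
  then have "\<forall>x. r < norm x \<longrightarrow> L (f x) = 0"
    by (simp add: linear_0[OF bounded_linear.linear[OF assms(1)]])
  then show ?thesis
    using smooth_linear[OF assms(1) cinf_c_smooth[OF assms(2)]] unfolding cinf_c_def by blast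
qed

lemma cinf_c_affine:
  assumes "cinf_c f" "r \<noteq> 0"
  shows "cinf_c (\<lambda>x. f (r *\<^sub>R x + a))"
proof -
  obtain s where s: "\<And>x. s < norm x \<Longrightarrow> f x = 0" using assms by (auto simp: cinf_c_def)
  have "f (r *\<^sub>R x + a) = 0" if "(s + norm a) / \<bar>r\<bar> < norm x" for x
  proof (rule s)
    have "s + norm a < norm (r *\<^sub>R x)"
      using that assms(2) by (simp add: field_simps)
    also have "norm (r *\<^sub>R x) \<le> norm (r *\<^sub>R x + a) + norm a"
      using norm_triangle_ineq4[of "r *\<^sub>R x + a" a] by simp
    finally show "s < norm (r *\<^sub>R x + a)" by simp
  qed
  then show ?thesis
    using assms smooth_affine by (auto simp: cinf_c_def)
qed

lemma cinf_c_mult: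
  fixes f g :: "real^'n \<Rightarrow> 'b::real_normed_algebra"
  assumes "smooth f" "cinf_c g"
  shows "cinf_c (\<lambda>x. f x * g x)"
proof -
  obtain r where "\<And>x. r < norm x \<Longrightarrow> g x = 0" using assms by (auto simp: cinf_c_def)
  then have "\<forall>x. r < norm x \<longrightarrow> f x * g x = 0" by simp
  then show ?thesis
    using smooth_mult[OF assms(1) cinf_c_smooth[OF assms(2)]] unfolding cinf_c_def by blast
qed

lemma cinf_c_partial_deriv:
  assumes "cinf_c f"
  shows "cinf_c (partial_deriv i f)"
proof -
  obtain r where r: "\<And>x. r < norm x \<Longrightarrow> f x = 0" using assms by (auto simp: cinf_c_def)
  have "partial_deriv i f x = 0" if "r < norm x" for x
  proof -
    have "(f has_derivative (\<lambda>v. 0)) (at x)"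
    proof (rule has_derivative_transform_within_open[of "\<lambda>x. 0" _ x UNIV "{x. r < norm x}"])
      show "open {x::real^'a. r < norm x}"
        by (intro open_Collect_less continuous_intros)
    qed (use r that in auto)
    from partial_deriv_eq[OF this] show ?thesis .
  qed
  then show ?thesis
    using assms smooth_partial_deriv by (auto simp: cinf_c_def)
qed

lemma compact_support_integrable:
  fixes f :: "real^'n \<Rightarrow> 'b::{banach, second_countable_topology}"
  assumes "continuous_on UNIV f" "\<And>x. r < norm x \<Longrightarrow> f x = 0"
  shows "integrable lborel f"
proof -
  have "integrable lborel (\<lambda>x. indicator (cball 0 r) x *\<^sub>R f x)"
    by (rule borel_integrable_compact) (use continuous_on_subset[OF assms(1)] in simp_all)
  moreover have "(\<lambda>x. indicator (cball 0 r) x *\<^sub>R f x) = f"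
    using assms(2) by (force simp: indicator_def not_le)
  ultimately show ?thesis by simp
qed

lemma cinf_c_integrable:
  fixes f :: "real^'n \<Rightarrow> 'b::{banach, second_countable_topology}"
  assumes "cinf_c f"
  shows "integrable lborel f"
  using assms compact_support_integrable smooth_continuous_on unfolding cinf_c_def by blast

lemma cinf_c_bounded:
  fixes f :: "real^'n \<Rightarrow> 'b::real_normed_vector"
  assumes "cinf_c f"
  obtains B where "0 \<le> B" "\<And>x. norm (f x) \<le> B"
proof -
  obtain r where r: "\<And>x. r < norm x \<Longrightarrow> f x = 0" using assms by (auto simp: cinf_c_def)
  have "compact (f ` cball 0 r)"
    by (intro compact_continuous_image smooth_continuous_on cinf_c_smooth assms) simp
  then obtain B where B: "0 < B" "\<And>y. y \<in> f ` cball 0 r \<Longrightarrow> norm y \<le> B"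
    using compact_imp_bounded[of "f ` cball 0 r"] unfolding bounded_pos by auto
  have "norm (f x) \<le> B" for x
  proof (cases "r < norm x")
    case True
    then show ?thesis using B(1) r[OF True] by simp
  next
    case False
    then show ?thesis by (intro B(2) imageI) simp
  qed
  with B(1) show thesis by (intro that[of B]) auto
qed

text \<open>The derivative is bounded because the partial derivatives are again compactly supported.\<close>

lemma cinf_c_lipschitz:
  fixes f :: "real^'n \<Rightarrow> 'b::real_normed_vector"
  assumes "cinf_c f"
  obtains L where "0 \<le> L" "\<And>x y. norm (f x - f y) \<le> L * norm (x - y)"
proof -
  have "\<exists>B\<ge>0. \<forall>x. norm (partial_deriv i f x) \<le> B" for i
    using cinf_c_bounded[OF cinf_c_partial_deriv[OF assms]] by metis
  then obtain B where B: "\<And>i. 0 \<le> B i" "\<And>i x. norm (partial_deriv i f x) \<le> B i" by metis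
  have d: "f differentiable (at x)" for x
    using assms cinf_c_smooth smooth_differentiable by blast
  have on: "onorm (frechet_derivative f (at x)) \<le> (\<Sum>i\<in>UNIV. B i)" for x
  proof (rule onorm_le)
    fix v :: "real^'n"
    have "norm (frechet_derivative f (at x) v) \<le> (\<Sum>i\<in>UNIV. norm (v $ i *\<^sub>R partial_deriv i f x))"
      unfolding frechet_derivative_partial[OF d] by (rule norm_sum)
    also have "\<dots> \<le> (\<Sum>i\<in>UNIV. norm v * B i)"
      by (intro sum_mono) (auto intro!: mult_mono B component_le_norm_cart)
    finally show "norm (frechet_derivative f (at x) v) \<le> (\<Sum>i\<in>UNIV. B i) * norm v"
      by (simp add: sum_distrib_left mult.commute)
  qed
  have "norm (f x - f y) \<le> (\<Sum>i\<in>UNIV. B i) * norm (x - y)" for x y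
    by (rule differentiable_bound[of UNIV])
      (use on smooth_has_derivative[OF cinf_c_smooth[OF assms]] in auto)
  moreover have "0 \<le> (\<Sum>i\<in>UNIV. B i)" by (intro sum_nonneg B)
  ultimately show thesis using that by blast
qed

text \<open>The function \<open>t \<mapsto> f(x+ty) + f(x-ty)\<close> has derivative \<open>\<nabla>f(x+ty) \<bullet> y - \<nabla>f(x-ty) \<bullet> y\<close>, where the two terms
nearly cancel since the gradient is Lipschitz. The mean value theorem on \<open>[0,1]\<close> gives the bound.\<close>

lemma cinf_c_second_difference:
  fixes f :: "real^'n \<Rightarrow> real"
  assumes "cinf_c f"
  obtains C where "0 \<le> C" "\<And>x y. \<bar>f x - (f (x + y) + f (x - y)) / 2\<bar> \<le> C * norm y ^ 2"
proof -
  have "\<exists>L\<ge>0. \<forall>x y. norm (partial_deriv i f x - partial_deriv i f y) \<le> L * norm (x - y)" for i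
    using cinf_c_lipschitz[OF cinf_c_partial_deriv[OF assms]] by metis
  then obtain L where L: "\<And>i. 0 \<le> L i"
    "\<And>i x y. norm (partial_deriv i f x - partial_deriv i f y) \<le> L i * norm (x - y)" by metis
  define C where "C = (\<Sum>i\<in>UNIV. L i)"
  have C: "0 \<le> C" unfolding C_def by (intro sum_nonneg L)
  have d: "f differentiable (at x)" for x
    using assms cinf_c_smooth smooth_differentiable by blast
  have lip: "\<bar>frechet_derivative f (at x) v - frechet_derivative f (at y) v\<bar>
      \<le> C * norm (x - y) * norm v" for x y v
  proof -
    have "\<bar>frechet_derivative f (at x) v - frechet_derivative f (at y) v\<bar>
        = \<bar>\<Sum>i\<in>UNIV. v $ i * (partial_deriv i f x - partial_deriv i f y)\<bar>"
      by (simp add: frechet_derivative_partial[OF d] sum_subtractf right_diff_distrib)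
    also have "\<dots> \<le> (\<Sum>i\<in>UNIV. \<bar>v $ i * (partial_deriv i f x - partial_deriv i f y)\<bar>)"
      by (rule sum_abs)
    also have "\<dots> \<le> (\<Sum>i\<in>UNIV. norm v * (L i * norm (x - y)))"
      unfolding abs_mult using L(2)
      by (intro sum_mono mult_mono) (auto intro!: component_le_norm_cart)
    finally show ?thesis by (simp add: C_def sum_distrib_right sum_distrib_left mult_ac)
  qed
  have "\<bar>f x - (f (x + y) + f (x - y)) / 2\<bar> \<le> C * norm y ^ 2" for x y
  proof -
    define g where "g t = f (x + t *\<^sub>R y) + f (x - t *\<^sub>R y)" for t
    define g' where "g' t = frechet_derivative f (at (x + t *\<^sub>R y)) y
        - frechet_derivative f (at (x - t *\<^sub>R y)) y" for t
    have "(g has_real_derivative g' t) (at t)" for t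
    proof -
      note D = smooth_has_derivative[OF cinf_c_smooth[OF assms]]
      have "((\<lambda>t. f (x + t *\<^sub>R y)) has_derivative (\<lambda>h. frechet_derivative f (at (x + t *\<^sub>R y)) (h *\<^sub>R y))) (at t)"
        by (rule has_derivative_compose[OF _ D]) (auto intro!: derivative_eq_intros)
      moreover have "((\<lambda>t. f (x - t *\<^sub>R y)) has_derivative (\<lambda>h. frechet_derivative f (at (x - t *\<^sub>R y)) (- (h *\<^sub>R y)))) (at t)"
        by (rule has_derivative_compose[OF _ D]) (auto intro!: derivative_eq_intros)
      ultimately have "(g has_derivative (\<lambda>h. frechet_derivative f (at (x + t *\<^sub>R y)) (h *\<^sub>R y)
          + frechet_derivative f (at (x - t *\<^sub>R y)) (- (h *\<^sub>R y)))) (at t)"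
        unfolding g_def by (rule has_derivative_add)
      moreover have "(\<lambda>h. frechet_derivative f (at (x + t *\<^sub>R y)) (h *\<^sub>R y)
          + frechet_derivative f (at (x - t *\<^sub>R y)) (- (h *\<^sub>R y))) = (*) (g' t)"
        by (auto simp: g'_def linear_scale[OF linear_frechet_derivative[OF d]]
            linear_neg[OF linear_frechet_derivative[OF d]] algebra_simps)
      ultimately show ?thesis by (simp add: has_field_derivative_def)
    qed
    then obtain t where t: "0 < t" "t < 1" "g 1 - g 0 = (1 - 0) * g' t"
      using MVT2[of 0 1 g g'] by auto
    have "\<bar>g' t\<bar> \<le> C * norm ((x + t *\<^sub>R y) - (x - t *\<^sub>R y)) * norm y"
      unfolding g'_def by (rule lip)
    also have "(x + t *\<^sub>R y) - (x - t *\<^sub>R y) = (2 * t) *\<^sub>R y"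
      by (simp add: scaleR_2[symmetric])
    also have "C * norm ((2 * t) *\<^sub>R y) * norm y = t * (2 * C * norm y ^ 2)"
      using t by (simp add: power2_eq_square)
    also have "\<dots> \<le> 1 * (2 * C * norm y ^ 2)"
      using t C by (intro mult_right_mono) auto
    finally have "\<bar>g 1 - g 0\<bar> \<le> 2 * (C * norm y ^ 2)" using t by simp
    then show ?thesis by (simp add: g_def field_simps)
  qed
  with C that show thesis by blast
qed


section \<open>A smooth cutoff\<close>

text \<open>The functions \<open>p(1/t) exp(-1/t)\<close> for \<open>t > 0\<close>, extended by \<open>0\<close>. With all polynomials \<open>p\<close> allowed, the
family is stable under differentiation; \<open>p = 1\<close> is the standard flat function.\<close>

definition exp_flat :: "real poly \<Rightarrow> real \<Rightarrow> real" where
  "exp_flat p t = (if 0 < t then poly p (1 / t) * exp (- (1 / t)) else 0)"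

lemma poly_exp_tendsto_0: "((\<lambda>u. poly p u * exp (- u)) \<longlongrightarrow> 0) (at_top :: real filter)"
proof -
  have "((\<lambda>u. \<Sum>i\<le>degree p. coeff p i * (u ^ i / exp u)) \<longlongrightarrow> (\<Sum>i\<le>degree p. coeff p i * 0)) (at_top :: real filter)"
    by (intro tendsto_intros tendsto_power_div_exp_0)
  then show ?thesis
    by (simp add: poly_altdef sum_distrib_right exp_minus divide_inverse mult.assoc)
qed

lemma exp_flat_deriv:
  "(exp_flat p has_real_derivative exp_flat ([:0, 0, 1:] * (p - pderiv p)) t) (at t)"
proof -
  consider "0 < t" | "t < 0" | "t = 0" by linarith
  then show ?thesis
  proof cases
    case 1
    have "((\<lambda>t. poly p (1 / t) * exp (- (1 / t))) has_real_derivative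
        exp_flat ([:0, 0, 1:] * (p - pderiv p)) t) (at t)"
      using 1 by (auto intro!: derivative_eq_intros DERIV_chain2[OF poly_DERIV]
          simp: exp_flat_def field_simps power2_eq_square)
    then show ?thesis
      by (rule has_field_derivative_transform_within_open[of _ _ _ "{0<..}"])
        (use 1 in \<open>auto simp: exp_flat_def\<close>)
  next
    case 2
    have "((\<lambda>t. 0) has_real_derivative 0) (at t)" by simp
    then have "(exp_flat p has_real_derivative 0) (at t)"
      by (rule has_field_derivative_transform_within_open[of _ _ _ "{..<0}"])
        (use 2 in \<open>auto simp: exp_flat_def\<close>)
    then show ?thesis using 2 by (simp add: exp_flat_def)
  next
    case 3
    have "((\<lambda>h. poly (pCons 0 p) (inverse h) * exp (- inverse h)) \<longlongrightarrow> 0) (at_right (0::real))"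
      using filterlim_compose[OF poly_exp_tendsto_0[of "pCons 0 p"] filterlim_inverse_at_top_right] .
    then have "((\<lambda>h. exp_flat p h / h) \<longlongrightarrow> 0) (at_right 0)"
      by (rule Lim_transform_eventually)
        (auto simp: exp_flat_def divide_inverse mult_ac eventually_at_filter)
    moreover have "((\<lambda>h. exp_flat p h / h) \<longlongrightarrow> 0) (at_left 0)"
      by (rule Lim_transform_eventually[OF tendsto_const])
        (auto simp: exp_flat_def eventually_at_filter)
    ultimately have "((\<lambda>h. exp_flat p h / h) \<longlongrightarrow> 0) (at 0)"
      by (simp add: filterlim_split_at)
    then show ?thesis using 3 by (simp add: DERIV_def exp_flat_def)
  qed
qed

lemma exp_flat_1_mono: "s \<le> t \<Longrightarrow> exp_flat 1 s \<le> exp_flat 1 t"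
  by (auto simp: exp_flat_def frac_le)

text \<open>With \<open>e(t) = exp(-1/t)\<close> and \<open>c = e(1)\<close>, the function \<open>e(c - e(|x|\<^sup>2 - 1))\<close> is constant for \<open>|x| \<le> 1\<close>,
where the inner \<open>e\<close> vanishes, and it is \<open>0\<close> once \<open>|x|\<^sup>2 \<ge> 2\<close>, where the inner \<open>e\<close> exceeds \<open>c\<close>.\<close>

lemma smooth_cutoff:
  obtains \<phi> :: "real^'n \<Rightarrow> real" where "smooth \<phi>" "\<And>x. 0 \<le> \<phi> x"
    "\<And>x. norm x \<le> 1 \<Longrightarrow> \<phi> x = 1" "\<And>x. 2 < norm x \<Longrightarrow> \<phi> x = 0"
proof -
  let ?e = "exp_flat 1"
  define c where "c = ?e 1"
  define \<phi> where "\<phi> x = ?e (c - ?e (norm x ^ 2 - 1)) * (1 / ?e c)" for x :: "real^'n"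
  have c: "0 < c" "0 < ?e c" by (auto simp: c_def exp_flat_def)
  have comp: "smooth (\<lambda>x. ?e (g x))" if "smooth g" for g :: "real^'n \<Rightarrow> real"
  proof (rule smooth_compose[of "range exp_flat", OF _ _ that])
    fix f assume "f \<in> range exp_flat"
    then obtain p where "f = exp_flat p" by blast
    then show "\<exists>f'\<in>range exp_flat. \<forall>t. (f has_real_derivative f' t) (at t)"
      using exp_flat_deriv by blast
  qed simp
  have "smooth (\<lambda>x::real^'n. c + (- 1) * ?e (norm x ^ 2 + - 1))"
    by (intro smooth_add smooth_mult smooth_const comp smooth_norm_square)
  then have "smooth (\<lambda>x::real^'n. ?e (c + (- 1) * ?e (norm x ^ 2 + - 1)) * (1 / ?e c))"
    by (intro smooth_mult smooth_const comp)
  then have "smooth \<phi>" by (simp add: \<phi>_def[abs_def])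
  moreover have "0 \<le> \<phi> x" for x
    using c by (auto simp: \<phi>_def exp_flat_def)
  moreover have "\<phi> x = 1" if "norm x \<le> 1" for x
  proof -
    have "norm x ^ 2 \<le> 1" using that by (simp add: power_le_one)
    then show ?thesis using c by (simp add: \<phi>_def exp_flat_def[of _ "_ - 1"])
  qed
  moreover have "\<phi> x = 0" if "2 < norm x" for x
  proof -
    have "2 ^ 2 \<le> norm x ^ 2" using that by (intro power_mono) auto
    then have "c \<le> ?e (norm x ^ 2 - 1)" unfolding c_def by (intro exp_flat_1_mono) simp
    then show ?thesis by (simp add: \<phi>_def exp_flat_def[of _ "_ - exp_flat _ _"])
  qed
  ultimately show thesis using that by blast
qed


section \<open>Changes of variables\<close>

lemma nn_integral_lborel_affine:
  fixes f :: "real^'n \<Rightarrow> ennreal"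
  assumes [measurable]: "f \<in> borel_measurable borel" and "c \<noteq> 0"
  shows "(\<integral>\<^sup>+x. f x \<partial>lborel) = ennreal (\<bar>c\<bar> ^ CARD('n)) * (\<integral>\<^sup>+x. f (t + c *\<^sub>R x) \<partial>lborel)"
  by (subst lborel_affine[OF assms(2), of t])
    (simp add: nn_integral_density nn_integral_distr nn_integral_cmult ennreal_power)

lemma integral_lborel_affine:
  fixes f :: "real^'n \<Rightarrow> 'b::{banach, second_countable_topology}"
  assumes [measurable]: "f \<in> borel_measurable borel" and "c \<noteq> 0"
  shows "(\<integral>x. f x \<partial>lborel) = \<bar>c\<bar> ^ CARD('n) *\<^sub>R (\<integral>x. f (t + c *\<^sub>R x) \<partial>lborel)"
  by (subst lborel_affine[OF assms(2), of t])
    (simp add: integral_density integral_distr)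

lemma integrable_lborel_affine:
  fixes f :: "real^'n \<Rightarrow> 'b::{banach, second_countable_topology}"
  assumes "integrable lborel f" "c \<noteq> 0"
  shows "integrable lborel (\<lambda>x. f (t + c *\<^sub>R x))"
proof -
  have [measurable]: "f \<in> borel_measurable borel"
    using borel_measurable_integrable[OF assms(1)] by simp
  have "integrable (density (distr lborel borel (\<lambda>x. t + c *\<^sub>R x)) (\<lambda>_. ennreal (\<bar>c\<bar> ^ CARD('n)))) f"
    using assms(1) by (subst (asm) lborel_affine[OF assms(2), of t]) (simp add: ennreal_power)
  then have "integrable lborel (\<lambda>x. \<bar>c\<bar> ^ CARD('n) *\<^sub>R f (t + c *\<^sub>R x))"
    by (simp add: integrable_density integrable_distr_eq)
  from integrable_scaleR_right[OF this, of "1 / \<bar>c\<bar> ^ CARD('n)"] assms(2)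
  show ?thesis by simp
qed

lemma integral_lborel_shift:
  fixes f :: "real^'n \<Rightarrow> 'b::{banach, second_countable_topology}"
  assumes "f \<in> borel_measurable borel"
  shows "(\<integral>x. f (x + a) \<partial>lborel) = (\<integral>x. f x \<partial>lborel)"
  using integral_lborel_affine[OF assms, of 1 a] by (simp add: add.commute)

lemma integrable_lborel_shift:
  fixes f :: "real^'n \<Rightarrow> 'b::{banach, second_countable_topology}"
  assumes "integrable lborel f"
  shows "integrable lborel (\<lambda>x. f (x + a))"
  using integrable_lborel_affine[OF assms, of 1 a] by (simp add: add.commute)

text \<open>Averaging \<open>g(f(y) + x)\<close> over \<open>x\<close> in the unit ball does not change the integral in \<open>y\<close>, because
\<open>f(y) + x = f(y + f\<^sup>-\<^sup>1 x)\<close>. Exchanging the integrations and substituting \<open>z = f(y) + x\<close> leaves, for each \<open>z\<close>, the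
measure of the set of all \<open>y\<close> with \<open>|z - f(y)| < 1\<close>, which is a translate of the unit ball because
\<open>f\<close> preserves the norm.\<close>

lemma nn_integral_lborel_orthogonal:
  fixes f :: "real^'n \<Rightarrow> real^'n" and g :: "real^'n \<Rightarrow> ennreal"
  assumes f: "orthogonal_transformation f" and [measurable]: "g \<in> borel_measurable borel"
  shows "(\<integral>\<^sup>+y. g (f y) \<partial>lborel) = (\<integral>\<^sup>+y. g y \<partial>lborel)"
proof -
  let ?A = "ball (0::real^'n) 1"
  have lin: "linear f" using f orthogonal_transformation_linear by blast
  then have [measurable]: "f \<in> borel_measurable borel"
    by (intro borel_measurable_continuous_onI linear_continuous_on) (simp add: linear_conv_bounded_linear)
  obtain h where h: "\<And>x. f (h x) = x"
    using orthogonal_transformation_surj[OF f] by (metis surj_def)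
  have nf: "norm (f x) = norm x" for x
    using f by (simp add: orthogonal_transformation)
  have shift: "(\<integral>\<^sup>+y. g (f y + x) \<partial>lborel) = (\<integral>\<^sup>+y. g (f y) \<partial>lborel)" for x
    using nn_integral_lborel_affine[of "\<lambda>y. g (f y)" 1 "h x"]
    by (simp add: linear_add[OF lin] h add.commute)
  define a :: "real^'n \<Rightarrow> ennreal" where "a = indicator ?A"
  have [measurable]: "a \<in> borel_measurable borel"
    unfolding a_def by (rule borel_measurable_indicator) simp
  have A: "(\<integral>\<^sup>+x. a x \<partial>lborel) = emeasure lborel ?A" by (simp add: a_def)
  have "emeasure lborel ?A * (\<integral>\<^sup>+y. g (f y) \<partial>lborel)
      = (\<integral>\<^sup>+x. (\<integral>\<^sup>+y. a x * g (f y + x) \<partial>lborel) \<partial>lborel)"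
    by (simp add: nn_integral_cmult nn_integral_multc shift A)
  also have "\<dots> = (\<integral>\<^sup>+y. (\<integral>\<^sup>+x. a x * g (f y + x) \<partial>lborel) \<partial>lborel)"
    by (rule lborel_pair.Fubini') simp
  also have "\<dots> = (\<integral>\<^sup>+y. (\<integral>\<^sup>+z. a (z - f y) * g z \<partial>lborel) \<partial>lborel)"
  proof (rule nn_integral_cong)
    fix y
    show "(\<integral>\<^sup>+x. a x * g (f y + x) \<partial>lborel) = (\<integral>\<^sup>+z. a (z - f y) * g z \<partial>lborel)"
      using nn_integral_lborel_affine[of "\<lambda>z. a (z - f y) * g z" 1 "f y"] by simp
  qed
  also have "\<dots> = (\<integral>\<^sup>+z. (\<integral>\<^sup>+y. a (z - f y) * g z \<partial>lborel) \<partial>lborel)"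
    by (rule lborel_pair.Fubini') simp
  also have "\<dots> = (\<integral>\<^sup>+z. emeasure lborel ?A * g z \<partial>lborel)"
  proof (rule nn_integral_cong)
    fix z
    have "(\<integral>\<^sup>+y. a (z - f y) \<partial>lborel) = (\<integral>\<^sup>+y. a (z - f (h z + y)) \<partial>lborel)"
      using nn_integral_lborel_affine[of "\<lambda>y. a (z - f y)" 1 "h z"] by simp
    also have "\<dots> = (\<integral>\<^sup>+y. a y \<partial>lborel)"
      by (intro nn_integral_cong) (simp add: linear_add[OF lin] h a_def indicator_def nf)
    finally show "(\<integral>\<^sup>+y. a (z - f y) * g z \<partial>lborel) = emeasure lborel ?A * g z"
      by (simp add: nn_integral_multc A)
  qed
  also have "\<dots> = emeasure lborel ?A * (\<integral>\<^sup>+z. g z \<partial>lborel)"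
    by (simp add: nn_integral_cmult)
  finally show ?thesis
    using content_ball_pos[of 1 "0::real^'n"] emeasure_lborel_ball_finite[of "0::real^'n" 1]
    by (auto simp: ennreal_mult_cancel_left measure_def)
qed


section \<open>Fourier integrals of test functions\<close>

text \<open>The inverse Fourier transform without its normalising factor.\<close>

definition osc :: "(real^'n \<Rightarrow> complex) \<Rightarrow> real^'n \<Rightarrow> complex" where
  "osc f x = (\<integral>\<xi>. cis (x \<bullet> \<xi>) * f \<xi> \<partial>lborel)"

lemma inv_fourier_osc:
  "inv_fourier f = (\<lambda>x. osc f x / of_real ((2 * pi) ^ CARD('n)))" for f :: "real^'n \<Rightarrow> complex"
  by (rule ext) (simp add: inv_fourier_def osc_def)

lemma cis_measurable [measurable]: "cis \<in> borel_measurable borel"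
  by (intro borel_measurable_continuous_onI continuous_on_cis continuous_on_id)

lemma integrable_cis_mult [intro]:
  assumes "integrable lborel f"
  shows "integrable lborel (\<lambda>\<xi>::real^'n. cis (x \<bullet> \<xi>) * f \<xi>)"
proof (rule Bochner_Integration.integrable_bound[OF assms])
  show "(\<lambda>\<xi>. cis (x \<bullet> \<xi>) * f \<xi>) \<in> borel_measurable lborel"
    using borel_measurable_integrable[OF assms] by simp
qed (simp add: norm_mult)

text \<open>All difference quotients of \<open>f\<close> have integral \<open>0\<close> by translation invariance, and they converge to the
partial derivative with a common compactly supported bound.\<close>

lemma integral_partial_deriv:
  fixes f :: "real^'n \<Rightarrow> 'b::{banach, second_countable_topology}"
  assumes f: "cinf_c f"
  shows "(\<integral>x. partial_deriv i f x \<partial>lborel) = 0"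
proof -
  \<comment> \<open>steps tending to \<open>0\<close> in direction \<open>i\<close> and the difference quotients along them\<close>
  define h where "h m = (1 / real (Suc m)) *\<^sub>R axis i (1::real)" for m
  define s where "s m x = real (Suc m) *\<^sub>R (f (x + h m) - f x)" for m x
  obtain r where r: "\<And>x. r < norm x \<Longrightarrow> f x = 0" using f by (auto simp: cinf_c_def)
  obtain L where L: "0 \<le> L" "\<And>x y. norm (f x - f y) \<le> L * norm (x - y)"
    using cinf_c_lipschitz[OF f] by blast
  have nh: "norm (h m) = 1 / real (Suc m)" for m by (simp add: h_def norm_axis_1)
  have h1: "norm (h m) \<le> 1" for m by (simp add: nh)
  have h0: "h m \<noteq> 0" for m by (simp add: h_def axis_eq_0_iff)
  have hlim: "h \<longlonglongrightarrow> 0"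
    unfolding h_def using tendsto_scaleR[OF LIMSEQ_Suc[OF lim_1_over_n] tendsto_const] by simp
  have int: "integrable lborel f" by (rule cinf_c_integrable[OF f])
  have "(\<lambda>m. \<integral>x. s m x \<partial>lborel) \<longlonglongrightarrow> (\<integral>x. partial_deriv i f x \<partial>lborel)"
  proof (rule integral_dominated_convergence)
    show "partial_deriv i f \<in> borel_measurable lborel" "\<And>m. s m \<in> borel_measurable lborel"
      using smooth_measurable[OF cinf_c_smooth[OF f]]
        smooth_measurable[OF cinf_c_smooth[OF cinf_c_partial_deriv[OF f]]]
      unfolding s_def by simp_all
    show "integrable lborel (\<lambda>x. L * indicator (cball 0 (r + 1)) x :: real)"
      by (intro integrable_mult_right integrable_real_indicator) (simp_all add: emeasure_lborel_cball_finite[simplified])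
    show "AE x in lborel. (\<lambda>m. s m x) \<longlonglongrightarrow> partial_deriv i f x"
    proof (rule AE_I2)
      fix x
      let ?D = "frechet_derivative f (at x)"
      have D: "(f has_derivative ?D) (at x)" by (rule smooth_has_derivative[OF cinf_c_smooth[OF f]])
      have "filterlim h (at 0) sequentially"
        using hlim h0 by (simp add: filterlim_at)
      then have "(\<lambda>m. norm (f (x + h m) - f x - ?D (h m)) / norm (h m)) \<longlonglongrightarrow> 0"
        using D filterlim_compose unfolding has_derivative_at by blast
      moreover have "norm (f (x + h m) - f x - ?D (h m)) / norm (h m) = norm (s m x - partial_deriv i f x)" for m
      proof -
        have "s m x - partial_deriv i f x = real (Suc m) *\<^sub>R (f (x + h m) - f x - ?D (h m))"
          using linear_scale[OF has_derivative_linear[OF D]]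
          by (simp add: s_def h_def partial_deriv_def scaleR_diff_right del: of_nat_Suc)
        then show ?thesis by (simp add: nh)
      qed
      ultimately have "(\<lambda>m. norm (s m x - partial_deriv i f x)) \<longlonglongrightarrow> 0" by simp
      then show "(\<lambda>m. s m x) \<longlonglongrightarrow> partial_deriv i f x"
        by (simp add: tendsto_norm_zero_iff LIM_zero_iff)
    qed
    show "AE x in lborel. norm (s m x) \<le> L * indicator (cball 0 (r + 1)) x" for m
    proof (rule AE_I2)
      fix x
      show "norm (s m x) \<le> L * indicator (cball 0 (r + 1)) x"
      proof (cases "norm x \<le> r + 1")
        case True
        have "norm (s m x) \<le> real (Suc m) * (L * norm (h m))"
          using L(2)[of "x + h m" x] by (simp add: s_def mult_left_mono del: of_nat_Suc)
        then show ?thesis using True by (simp add: nh del: of_nat_Suc)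
      next
        case False
        have "norm x - norm (h m) \<le> norm (x + h m)"
          using norm_triangle_ineq4[of "x + h m" "h m"] by simp
        then have "f (x + h m) = 0" "f x = 0" using False h1[of m] by (auto intro!: r)
        then show ?thesis using L(1) by (simp add: s_def)
      qed
    qed
  qed
  moreover have "(\<integral>x. s m x \<partial>lborel) = 0" for m
    using int integrable_lborel_shift[OF int, of "h m"]
    by (simp add: s_def integral_lborel_shift smooth_measurable[OF cinf_c_smooth[OF f]])
  ultimately show ?thesis by (simp add: LIMSEQ_const_iff)
qed

lemma cis_inner_derivative:
  fixes \<xi> :: "real^'n"
  shows "((\<lambda>x. c * cis (\<xi> \<bullet> x)) has_derivative (\<lambda>v. c * (\<i> * of_real (\<xi> \<bullet> v) * cis (\<xi> \<bullet> x)))) (at x)"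
  by (auto intro!: derivative_eq_intros simp: scaleR_conv_of_real mult_ac)

lemma partial_deriv_cis:
  "partial_deriv i (\<lambda>x. c * cis (\<xi> \<bullet> x)) = (\<lambda>x. (c * \<i> * of_real (\<xi> $ i)) * cis (\<xi> \<bullet> x))"
  by (rule ext, subst partial_deriv_eq[OF cis_inner_derivative]) (simp add: inner_axis mult_ac)

lemma smooth_cis: "smooth (\<lambda>x. cis (\<xi> \<bullet> x))"
proof -
  have "smooth (\<lambda>x. 1 * cis (\<xi> \<bullet> x))"
  proof (rule smooth_coinduct[where P = "\<lambda>h. \<exists>c. h = (\<lambda>x. c * cis (\<xi> \<bullet> x))"])
    fix h :: "real^'a \<Rightarrow> complex" and x
    assume "\<exists>c. h = (\<lambda>x. c * cis (\<xi> \<bullet> x))"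
    then show "h differentiable (at x)"
      using cis_inner_derivative differentiable_def by blast
  next
    fix h :: "real^'a \<Rightarrow> complex" and i
    assume "\<exists>c. h = (\<lambda>x. c * cis (\<xi> \<bullet> x))"
    then show "\<exists>c. partial_deriv i h = (\<lambda>x. c * cis (\<xi> \<bullet> x))"
      using partial_deriv_cis by blast
  qed blast
  then show ?thesis by simp
qed

text \<open>Integration by parts, in the form that the partial derivative of \<open>cis(x \<bullet> \<xi>) f(\<xi>)\<close> has integral \<open>0\<close>.\<close>

lemma osc_partial_deriv:
  assumes "cinf_c f"
  shows "osc (partial_deriv i f) x = - \<i> * of_real (x $ i) * osc f x"
proof -
  let ?e = "\<lambda>\<xi>. cis (x \<bullet> \<xi>)"
  have 1: "partial_deriv i ?e = (\<lambda>\<xi>. \<i> * of_real (x $ i) * ?e \<xi>)"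
    using partial_deriv_cis[of i 1 x] by simp
  have i1: "integrable lborel (\<lambda>\<xi>. ?e \<xi> * partial_deriv i f \<xi>)"
    by (intro integrable_cis_mult cinf_c_integrable cinf_c_partial_deriv assms)
  have i2: "integrable lborel (\<lambda>\<xi>. ?e \<xi> * f \<xi>)"
    by (intro integrable_cis_mult cinf_c_integrable assms)
  have "0 = (\<integral>\<xi>. partial_deriv i (\<lambda>\<xi>. ?e \<xi> * f \<xi>) \<xi> \<partial>lborel)"
    by (rule integral_partial_deriv[symmetric]) (intro cinf_c_mult smooth_cis assms)
  also have "\<dots> = (\<integral>\<xi>. ?e \<xi> * partial_deriv i f \<xi> + \<i> * of_real (x $ i) * (?e \<xi> * f \<xi>) \<partial>lborel)"
    unfolding partial_deriv_mult[OF smooth_cis cinf_c_smooth[OF assms]] 1 by (simp only: mult_ac)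
  also have "\<dots> = osc (partial_deriv i f) x + \<i> * of_real (x $ i) * osc f x"
    using i1 i2 by (simp add: osc_def)
  finally show ?thesis by (simp add: eq_neg_iff_add_eq_0)
qed

lemma cinf_c_coord_mult:
  assumes "cinf_c f"
  shows "cinf_c (\<lambda>\<xi>. \<i> * of_real (\<xi> $ i) * f \<xi>)"
  by (intro cinf_c_mult smooth_mult smooth_const smooth_linear[OF bounded_linear_of_real]
      smooth_coord assms)

lemma cis_remainder: "norm (cis (b + a) - cis b - \<i> * of_real a * cis b) \<le> a ^ 2 / 2"
proof -
  have "cis (b + a) - cis b - \<i> * of_real a * cis b = cis b * (cis a - 1 - \<i> * of_real a)"
    by (simp add: cis_mult[symmetric] algebra_simps)
  moreover have "norm (cis a - 1 - \<i> * of_real a) \<le> a ^ 2 / 2"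
    using iexp_approx1[of a 1] by (simp add: cis_conv_exp power2_eq_square algebra_simps)
  ultimately show ?thesis by (simp add: norm_mult)
qed

text \<open>Differentiation under the integral sign. The second-order remainder of \<open>cis\<close> is bounded by
\<open>|v|\<^sup>2 |\<xi>|\<^sup>2 / 2\<close>, uniformly in \<open>x\<close>, and \<open>|\<xi>|\<^sup>2 |f(\<xi>)|\<close> is integrable.\<close>

lemma osc_has_derivative:
  assumes f: "cinf_c f"
  shows "(osc f has_derivative (\<lambda>v. \<integral>\<xi>. \<i> * of_real (v \<bullet> \<xi>) * cis (x \<bullet> \<xi>) * f \<xi> \<partial>lborel)) (at x)"
    (is "(_ has_derivative ?D) _")
proof -
  have [measurable]: "f \<in> borel_measurable borel"
    by (rule smooth_measurable[OF cinf_c_smooth[OF f]])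
  obtain r where r: "\<And>x. r < norm x \<Longrightarrow> f x = 0" using f by (auto simp: cinf_c_def)
  have cont: "continuous_on UNIV f" by (rule smooth_continuous_on[OF cinf_c_smooth[OF f]])
  have I: "integrable lborel (\<lambda>\<xi>. h \<xi> * f \<xi>)" if "continuous_on UNIV h" for h
    by (rule compact_support_integrable[of _ r]) (auto intro!: continuous_intros that cont r)
  have I1: "integrable lborel (\<lambda>\<xi>. \<i> * of_real (v \<bullet> \<xi>) * cis (x \<bullet> \<xi>) * f \<xi>)" for v
    by (intro I continuous_intros)
  define K where "K = (\<integral>\<xi>. norm \<xi> ^ 2 / 2 * norm (f \<xi>) \<partial>lborel)"
  have IK: "integrable lborel (\<lambda>\<xi>. norm \<xi> ^ 2 / 2 * norm (f \<xi>))"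
    by (rule compact_support_integrable[of _ r]) (auto intro!: continuous_intros cont r)
  note IKv = integrable_mult_right[OF IK]
  have lin: "linear ?D"
  proof (rule linearI)
    fix v w
    show "?D (v + w) = ?D v + ?D w"
      using I1[of v] I1[of w] by (subst Bochner_Integration.integral_add[symmetric])
        (auto simp: algebra_simps)
  next
    fix c v
    show "?D (c *\<^sub>R v) = c *\<^sub>R ?D v"
      by (subst integral_scaleR_right[symmetric]) (simp add: scaleR_conv_of_real[where 'a = complex] mult_ac)
  qed
  have bound: "norm (osc f (x + v) - osc f x - ?D v) \<le> K * norm v ^ 2" for v
  proof -
    have "osc f (x + v) - osc f x - ?D v =
        (\<integral>\<xi>. (cis ((x + v) \<bullet> \<xi>) - cis (x \<bullet> \<xi>) - \<i> * of_real (v \<bullet> \<xi>) * cis (x \<bullet> \<xi>)) * f \<xi> \<partial>lborel)"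
      unfolding osc_def left_diff_distrib using cinf_c_integrable[OF f] I1
      by (simp add: integrable_cis_mult)
    also have "norm \<dots> \<le> (\<integral>\<xi>. norm v ^ 2 * (norm \<xi> ^ 2 / 2 * norm (f \<xi>)) \<partial>lborel)"
    proof (rule Bochner_Integration.integral_norm_bound_integral)
      fix \<xi>
      have "norm ((cis ((x + v) \<bullet> \<xi>) - cis (x \<bullet> \<xi>) - \<i> * of_real (v \<bullet> \<xi>) * cis (x \<bullet> \<xi>)) * f \<xi>)
          \<le> (v \<bullet> \<xi>) ^ 2 / 2 * norm (f \<xi>)"
        unfolding norm_mult[of _ "f \<xi>"] inner_add_left by (intro mult_right_mono cis_remainder) simp
      also have "\<dots> \<le> (norm v * norm \<xi>) ^ 2 / 2 * norm (f \<xi>)"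
        by (intro mult_right_mono divide_right_mono abs_le_square_iff[THEN iffD1])
          (auto simp: Cauchy_Schwarz_ineq2)
      finally show "norm ((cis ((x + v) \<bullet> \<xi>) - cis (x \<bullet> \<xi>) - \<i> * of_real (v \<bullet> \<xi>) * cis (x \<bullet> \<xi>)) * f \<xi>)
          \<le> norm v ^ 2 * (norm \<xi> ^ 2 / 2 * norm (f \<xi>))"
        by (simp add: power_mult_distrib mult_ac)
    qed (intro I IKv continuous_intros)+
    finally show ?thesis by (simp add: K_def mult.commute)
  qed
  show ?thesis
  proof (rule has_derivativeI_sandwich[where e = 1 and H = "\<lambda>y. K * norm (y - x)"])
    show "bounded_linear ?D" using lin by (simp add: linear_conv_bounded_linear)
    fix y assume "y \<noteq> x"
    then show "norm (osc f y - osc f x - ?D (y - x)) / norm (y - x) \<le> K * norm (y - x)"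
      using bound[of "y - x"] by (simp add: divide_simps power2_eq_square mult_ac)
  next
    show "((\<lambda>y. K * norm (y - x)) \<longlongrightarrow> 0) (at x)"
      by (auto intro!: tendsto_eq_intros)
  qed simp
qed

lemma partial_deriv_osc:
  assumes "cinf_c f"
  shows "partial_deriv i (osc f) = osc (\<lambda>\<xi>. \<i> * of_real (\<xi> $ i) * f \<xi>)"
  by (rule ext, subst partial_deriv_eq[OF osc_has_derivative[OF assms]])
    (simp add: osc_def inner_axis' mult_ac)

lemma iterated_partial_deriv_osc:
  assumes "cinf_c f"
  shows "\<exists>g. cinf_c g \<and> foldr partial_deriv is (osc f) = osc g"
proof (induction "is")
  case Nil
  then show ?case using assms by auto
next
  case (Cons i "is")
  then obtain g where "cinf_c g" "foldr partial_deriv is (osc f) = osc g" by blast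
  then show ?case
    using partial_deriv_osc[of g i] cinf_c_coord_mult[of g i] by auto
qed

lemma smooth_osc: "cinf_c f \<Longrightarrow> smooth (osc f)"
proof (rule smooth_coinduct[where P = "\<lambda>h. \<exists>g. cinf_c g \<and> h = osc g"])
  fix h :: "real^'a \<Rightarrow> complex" and x
  assume "\<exists>g. cinf_c g \<and> h = osc g"
  then show "h differentiable (at x)" using osc_has_derivative differentiableI by blast
next
  fix h :: "real^'a \<Rightarrow> complex" and i
  assume "\<exists>g. cinf_c g \<and> h = osc g"
  then show "\<exists>g. cinf_c g \<and> partial_deriv i h = osc g"
    using partial_deriv_osc cinf_c_coord_mult by blast
qed blast

definition laplace :: "(real^'n \<Rightarrow> 'b::real_normed_vector) \<Rightarrow> real^'n \<Rightarrow> 'b" where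
  "laplace f x = (\<Sum>i\<in>UNIV. partial_deriv i (partial_deriv i f) x)"

lemma cinf_c_sum:
  fixes f :: "'i \<Rightarrow> real^'n \<Rightarrow> 'b::real_normed_vector"
  assumes "finite I" "\<And>i. i \<in> I \<Longrightarrow> cinf_c (f i)"
  shows "cinf_c (\<lambda>x. \<Sum>i\<in>I. f i x)"
  using assms
proof (induction I rule: finite_induct)
  case empty
  then show ?case by (auto simp: cinf_c_def smooth_const)
qed (auto intro: cinf_c_add)

lemma cinf_c_laplace: "cinf_c f \<Longrightarrow> cinf_c (laplace f)"
  unfolding laplace_def[abs_def] by (intro cinf_c_sum cinf_c_partial_deriv) auto

lemma osc_laplace:
  assumes "cinf_c f"
  shows "osc (laplace f) x = - of_real (norm x ^ 2) * osc f x"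
proof -
  have "osc (laplace f) x = (\<Sum>i\<in>UNIV. osc (partial_deriv i (partial_deriv i f)) x)"
    unfolding osc_def laplace_def sum_distrib_left
    by (intro Bochner_Integration.integral_sum integrable_cis_mult cinf_c_integrable
        cinf_c_partial_deriv assms)
  also have "\<dots> = (\<Sum>i\<in>UNIV. - of_real (x $ i * x $ i) * osc f x)"
    by (simp add: osc_partial_deriv cinf_c_partial_deriv assms mult_ac)
  also have "\<dots> = - of_real (norm x ^ 2) * osc f x"
    by (simp add: power2_norm_eq_inner inner_vec_def sum_distrib_right sum_negf)
  finally show ?thesis .
qed

lemma osc_bounded:
  assumes "cinf_c f"
  shows "norm (osc f x) \<le> (\<integral>\<xi>. norm (f \<xi>) \<partial>lborel)"
  unfolding osc_def
  by (rule integral_norm_bound[THEN order_trans]) (simp add: norm_mult)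

text \<open>Each factor \<open>|x|\<^sup>2\<close> is absorbed by a Laplacian acting on \<open>f\<close>, which is again a test function.\<close>

lemma osc_decay:
  assumes "cinf_c f"
  shows "\<exists>B. \<forall>x. norm x ^ k * norm (osc f x) \<le> B"
proof -
  have even: "\<exists>B. \<forall>x. norm x ^ (2 * k) * norm (osc f x) \<le> B" for k
    using assms
  proof (induction k arbitrary: f)
    case 0
    then show ?case using osc_bounded by auto
  next
    case (Suc k)
    then obtain B where B: "\<And>x. norm x ^ (2 * k) * norm (osc (laplace f) x) \<le> B"
      using cinf_c_laplace by blast
    have "norm x ^ (2 * Suc k) * norm (osc f x) \<le> B" for x
      using B[of x] by (simp add: osc_laplace[OF Suc.prems] norm_mult power_add norm_power
          power2_eq_square mult_ac)
    then show ?case by blast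
  qed
  obtain A B where A: "\<And>x. norm (osc f x) \<le> A" and B: "\<And>x. norm x ^ (2 * k) * norm (osc f x) \<le> B"
    using osc_bounded[OF assms] even[of k] by blast
  \<comment> \<open>odd powers are interpolated between \<open>1\<close> and the even power \<open>2k\<close>\<close>
  have "norm x ^ k * norm (osc f x) \<le> A + B" for x
  proof -
    have "norm x ^ k \<le> 1 + norm x ^ (2 * k)"
      using power_increasing[of k "2 * k" "norm x"] power_le_one[of "norm x" k]
      by (cases "norm x \<le> 1") (auto intro: add_increasing add_increasing2)
    then have "norm x ^ k * norm (osc f x) \<le> (1 + norm x ^ (2 * k)) * norm (osc f x)"
      by (rule mult_right_mono) simp
    also have "\<dots> \<le> A + B" using A[of x] B[of x] by (simp add: algebra_simps)
    finally show ?thesis .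
  qed
  then show ?thesis by blast
qed

text \<open>This makes inverse transforms of test functions available in \<open>has_fourier\<close>.\<close>

lemma schwartz_inv_fourier:
  assumes "cinf_c f"
  shows "schwartz (inv_fourier f)"
proof -
  let ?c = "1 / of_real ((2 * pi) ^ CARD('a)) :: complex"
  have "cinf_c (\<lambda>x. ?c * f x)"
    by (rule cinf_c_linear[OF bounded_linear_mult_right assms])
  moreover have "inv_fourier f = osc (\<lambda>x. ?c * f x)"
    unfolding inv_fourier_osc osc_def
    by (rule ext, subst integral_divide_zero[symmetric]) simp
  ultimately obtain g where g: "cinf_c g" "inv_fourier f = osc g" by blast
  have "bounded (range (\<lambda>x. norm x ^ k *\<^sub>R foldr partial_deriv is (osc g) x))" for k "is"
  proof -
    obtain h where h: "cinf_c h" "foldr partial_deriv is (osc g) = osc h"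
      using iterated_partial_deriv_osc[OF g(1)] by blast
    then show ?thesis using osc_decay[OF h(1), of k] by (auto simp: bounded_iff)
  qed
  then show ?thesis using smooth_osc[OF g(1)] g(2) by (simp add: schwartz_def)
qed


section \<open>The kernel of the fractional Laplacian\<close>

definition kern :: "real \<Rightarrow> real^'n \<Rightarrow> real" where
  "kern \<alpha> y = norm y powr - (real CARD('n) + \<alpha>)"

lemma kern_nonneg [simp]: "0 \<le> kern \<alpha> y"
  by (simp add: kern_def)

lemma kern_measurable [measurable]: "kern \<alpha> \<in> borel_measurable borel"
  unfolding kern_def by measurable

lemma dyadic_scale:
  assumes "1 \<le> (t::real)"
  obtains j :: nat where "2 powr real j \<le> t" "t \<le> 2 powr (real j + 1)"
proof
  let ?j = "nat \<lfloor>log 2 t\<rfloor>"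
  have l: "0 \<le> log 2 t" using assms by simp
  then have j: "real ?j \<le> log 2 t" "log 2 t \<le> real ?j + 1" by linarith+
  have t: "2 powr log 2 t = t" using assms by simp
  show "2 powr real ?j \<le> t" using powr_mono[OF j(1), of 2] t by simp
  show "t \<le> 2 powr (real ?j + 1)" using powr_mono[OF j(2), of 2] t by simp
qed

text \<open>A criterion for integrability by dyadic decomposition: the ball of radius \<open>\<rho> j\<close> on which \<open>F\<close> may be as
large as \<open>c j\<close> contributes at most a constant times the \<open>j\<close>-th term of a convergent geometric series.\<close>

lemma nn_integral_dyadic:
  fixes F :: "real^'n \<Rightarrow> real" and \<rho> :: "nat \<Rightarrow> real"
  assumes le: "\<And>y. F y \<noteq> 0 \<Longrightarrow> \<exists>j. norm y \<le> \<rho> j \<and> F y \<le> c j"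
    and \<rho>: "\<And>j. 0 \<le> \<rho> j" and c: "\<And>j. 0 \<le> c j"
    and geo: "\<And>j. c j * \<rho> j ^ CARD('n) \<le> C * q ^ j" and q: "0 \<le> q" "q < 1"
  shows "(\<integral>\<^sup>+y. ennreal (F y) \<partial>lborel) < \<infinity>"
proof -
  define V where "V = unit_ball_vol (real CARD('n))"
  have V: "0 \<le> V" by (simp add: V_def)
  have C: "0 \<le> C * q ^ j" for j using geo[of j] c \<rho> by (meson mult_nonneg_nonneg order_trans zero_le_power)
  let ?u = "\<lambda>j y. ennreal (c j) * indicator (cball (0::real^'n) (\<rho> j)) y"
  have "(\<integral>\<^sup>+y. ennreal (F y) \<partial>lborel) \<le> (\<integral>\<^sup>+y. (\<Sum>j. ?u j y) \<partial>lborel)"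
  proof (rule nn_integral_mono)
    fix y :: "real^'n"
    show "ennreal (F y) \<le> (\<Sum>j. ?u j y)"
    proof (cases "F y = 0")
      case False
      then obtain j where j: "norm y \<le> \<rho> j" "F y \<le> c j" using le by blast
      have "ennreal (F y) \<le> sum (\<lambda>j. ?u j y) {j}"
        using j by (simp add: ennreal_leI)
      also have "\<dots> \<le> (\<Sum>j. ?u j y)" by (rule sum_le_suminf) auto
      finally show ?thesis .
    qed simp
  qed
  also have "\<dots> = (\<Sum>j. \<integral>\<^sup>+y. ?u j y \<partial>lborel)"
    by (intro nn_integral_suminf borel_measurable_times_ennreal borel_measurable_const
        borel_measurable_indicator) simp
  also have "\<dots> = (\<Sum>j. ennreal (c j * (V * \<rho> j ^ CARD('n))))"
    using c \<rho> by (subst nn_integral_cmult_indicator) (simp_all add: emeasure_cball V_def ennreal_mult'')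
  also have "\<dots> \<le> (\<Sum>j. ennreal (V * C * q ^ j))"
  proof (rule suminf_le)
    fix j
    show "ennreal (c j * (V * \<rho> j ^ CARD('n))) \<le> ennreal (V * C * q ^ j)"
      using mult_left_mono[OF geo[of j] V] by (intro ennreal_leI) (simp add: mult_ac)
  qed auto
  also have "\<dots> = ennreal (\<Sum>j. V * C * q ^ j)"
    using C V q by (intro suminf_ennreal2 summable_mult summable_geometric)
      (auto simp: mult.assoc intro!: mult_nonneg_nonneg)
  finally show ?thesis by (simp add: le_less_trans)
qed

text \<open>The kernel itself is not integrable at the origin; the factor \<open>|y|\<^sup>2\<close> there is what second
differences provide. Large \<open>y\<close> use \<open>\<alpha> > 0\<close> and small \<open>y\<close> use \<open>\<alpha> < 2\<close>.\<close>

lemma kern_integrable: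
  fixes \<alpha> :: real
  assumes \<alpha>: "0 < \<alpha>" "\<alpha> < 2"
  shows "(\<integral>\<^sup>+y. ennreal (min 1 (norm y ^ 2) * kern \<alpha> (y::real^'n)) \<partial>lborel) < \<infinity>"
proof -
  define d where "d = real CARD('n)"
  define F G where "F y = (if 1 \<le> norm y then kern \<alpha> y else 0)"
    and "G y = (if norm y \<le> 1 then norm y ^ 2 * kern \<alpha> y else 0)" for y :: "real^'n"
  have "(\<integral>\<^sup>+y. ennreal (F y) \<partial>lborel) < \<infinity>"
  proof (rule nn_integral_dyadic)
    fix y assume "F y \<noteq> 0"
    then have 1: "1 \<le> norm y" by (auto simp: F_def split: if_splits)
    then obtain j :: nat where j: "2 powr real j \<le> norm y" "norm y \<le> 2 powr (real j + 1)"
      using dyadic_scale by blast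
    have "F y = norm y powr - (d + \<alpha>)" using 1 by (simp add: F_def kern_def d_def)
    also have "\<dots> \<le> (2 powr real j) powr - (d + \<alpha>)"
      by (rule powr_mono2') (use j \<alpha> in \<open>auto simp: d_def\<close>)
    finally show "\<exists>j. norm y \<le> 2 powr (real j + 1) \<and> F y \<le> (2 powr real j) powr - (d + \<alpha>)"
      using j by blast
  next
    fix j
    show "(2 powr real j) powr - (d + \<alpha>) * (2 powr (real j + 1)) ^ CARD('n) \<le> 2 powr d * (2 powr - \<alpha>) ^ j"
      by (simp add: d_def powr_powr powr_add[symmetric] powr_realpow[symmetric] algebra_simps)
  qed (use \<alpha> powr_less_mono[of "-\<alpha>" 0 2] in auto)
  moreover have "(\<integral>\<^sup>+y. ennreal (G y) \<partial>lborel) < \<infinity>"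
  proof (rule nn_integral_dyadic)
    fix y assume "G y \<noteq> 0"
    then have y: "norm y \<le> 1" "y \<noteq> 0" by (auto simp: G_def split: if_splits)
    then have "1 \<le> 1 / norm y" by simp
    then obtain j :: nat where "2 powr real j \<le> 1 / norm y" "1 / norm y \<le> 2 powr (real j + 1)"
      using dyadic_scale by blast
    then have j: "norm y \<le> 2 powr - real j" "2 powr - (real j + 1) \<le> norm y"
      unfolding powr_minus_divide using y by (simp_all add: field_simps)
    have "G y = norm y ^ 2 * norm y powr - (d + \<alpha>)" using y by (simp add: G_def kern_def d_def)
    also have "\<dots> \<le> (2 powr - real j) ^ 2 * (2 powr - (real j + 1)) powr - (d + \<alpha>)"
      by (intro mult_mono power_mono powr_mono2') (use j \<alpha> in \<open>auto simp: d_def\<close>)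
    finally show "\<exists>j. norm y \<le> 2 powr - real j \<and>
        G y \<le> (2 powr - real j) ^ 2 * (2 powr - (real j + 1)) powr - (d + \<alpha>)"
      using j by blast
  next
    fix j
    have "(2 powr - real j) ^ 2 = 2 powr (- 2 * real j)"
      by (simp add: power2_eq_square powr_add[symmetric])
    then show "(2 powr - real j) ^ 2 * (2 powr - (real j + 1)) powr - (d + \<alpha>) * (2 powr - real j) ^ CARD('n)
        \<le> 2 powr (d + \<alpha>) * (2 powr (\<alpha> - 2)) ^ j"
      by (simp add: d_def powr_powr powr_add[symmetric] powr_realpow[symmetric] algebra_simps)
  qed (use \<alpha> powr_less_mono[of "\<alpha> - 2" 0 2] in auto)
  moreover have "(\<integral>\<^sup>+y. ennreal (min 1 (norm y ^ 2) * kern \<alpha> (y::real^'n)) \<partial>lborel)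
      \<le> (\<integral>\<^sup>+y. ennreal (F y) + ennreal (G y) \<partial>lborel)"
  proof (rule nn_integral_mono)
    fix y :: "real^'n"
    have nonneg: "0 \<le> F y" "0 \<le> G y" by (auto simp: F_def G_def)
    have "min 1 (norm y ^ 2) * kern \<alpha> y \<le> 1 * kern \<alpha> y"
      and "min 1 (norm y ^ 2) * kern \<alpha> y \<le> norm y ^ 2 * kern \<alpha> y"
      by (intro mult_right_mono; simp)+
    moreover have "F y = 1 * kern \<alpha> y \<or> G y = norm y ^ 2 * kern \<alpha> y"
      by (auto simp: F_def G_def)
    ultimately have "min 1 (norm y ^ 2) * kern \<alpha> y \<le> F y + G y"
      using nonneg by linarith
    with nonneg show "ennreal (min 1 (norm y ^ 2) * kern \<alpha> y) \<le> ennreal (F y) + ennreal (G y)"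
      by (simp add: ennreal_plus[symmetric] ennreal_leI del: ennreal_plus)
  qed
  moreover have "\<dots> = (\<integral>\<^sup>+y. ennreal (F y) \<partial>lborel) + (\<integral>\<^sup>+y. ennreal (G y) \<partial>lborel)"
    unfolding F_def G_def by (rule nn_integral_add) measurable
  ultimately show ?thesis by (simp add: le_less_trans)
qed

lemma one_minus_cos_le: "1 - cos t \<le> 2 * min 1 (t ^ 2)" for t :: real
proof -
  have "\<bar>sin (t / 2)\<bar> \<le> \<bar>t / 2\<bar>" by (rule abs_sin_x_le_abs_x)
  then have "sin (t / 2) ^ 2 \<le> (t / 2) ^ 2" by (rule abs_le_square_iff[THEN iffD1])
  moreover have "cos t = 1 - 2 * sin (t / 2) ^ 2" using cos_double_sin[of "t / 2"] by simp
  ultimately have "1 - cos t \<le> t ^ 2 / 2" by (simp add: power_divide)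
  then show ?thesis using cos_ge_minus_one[of t] zero_le_power2[of t]
    unfolding min_def by (smt (verit) field_sum_of_halves)
qed

text \<open>By rotation invariance and scaling, the integral depends on \<open>\<xi>\<close> only through the factor \<open>|\<xi>|\<^sup>\<alpha>\<close>; the
constant is its value at a unit vector.\<close>

lemma norm_powr_eq_integral:
  fixes \<alpha> :: real
  assumes \<alpha>: "0 < \<alpha>" "\<alpha> < 2"
  shows "\<exists>c\<ge>0. \<forall>\<xi>. (\<integral>\<^sup>+y. ennreal ((1 - cos (\<xi> \<bullet> y)) * kern \<alpha> y) \<partial>lborel) = ennreal (c * norm (\<xi>::real^'n) powr \<alpha>)"
proof -
  define J where "J \<xi> = (\<integral>\<^sup>+y. ennreal ((1 - cos (\<xi> \<bullet> y)) * kern \<alpha> y) \<partial>lborel)" for \<xi> :: "real^'n"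
  define e where "e = (axis undefined 1 :: real^'n)"
  have e: "norm e = 1" by (simp add: e_def norm_axis_1)
  have "J e \<le> (\<integral>\<^sup>+y. ennreal 2 * ennreal (min 1 (norm y ^ 2) * kern \<alpha> (y::real^'n)) \<partial>lborel)"
    unfolding J_def
  proof (rule nn_integral_mono)
    fix y
    have "(e \<bullet> y) ^ 2 \<le> norm y ^ 2"
      using Cauchy_Schwarz_ineq2[of e y] e by (simp add: abs_le_square_iff[symmetric])
    then have "1 - cos (e \<bullet> y) \<le> 2 * min 1 (norm y ^ 2)"
      using one_minus_cos_le[of "e \<bullet> y"] by linarith
    then have "(1 - cos (e \<bullet> y)) * kern \<alpha> y \<le> 2 * (min 1 (norm y ^ 2) * kern \<alpha> y)"
      using mult_right_mono[of _ _ "kern \<alpha> y"] by (fastforce simp: mult.assoc)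
    then show "ennreal ((1 - cos (e \<bullet> y)) * kern \<alpha> y) \<le> ennreal 2 * ennreal (min 1 (norm y ^ 2) * kern \<alpha> y)"
      by (subst ennreal_mult[symmetric]) (auto intro: ennreal_leI)
  qed
  also have "\<dots> < \<infinity>"
    using kern_integrable[OF \<alpha>, where 'n = 'n] by (simp add: nn_integral_cmult ennreal_mult_less_top)
  finally obtain c where c: "0 \<le> c" "J e = ennreal c"
    by (cases "J e") auto
  have "J \<xi> = ennreal (c * norm \<xi> powr \<alpha>)" for \<xi>
  proof (cases "\<xi> = 0")
    case False
    define r where "r = norm \<xi>"
    have r: "0 < r" using False by (simp add: r_def)
    obtain f where f: "orthogonal_transformation f" "f (r *\<^sub>R e) = \<xi>"
      using orthogonal_transformation_exists[of "r *\<^sub>R e" \<xi>] e r by (auto simp: r_def)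
    let ?g = "\<lambda>y. ennreal ((1 - cos (\<xi> \<bullet> y)) * kern \<alpha> y)"
    have "J \<xi> = (\<integral>\<^sup>+y. ?g (f y) \<partial>lborel)"
      unfolding J_def by (rule nn_integral_lborel_orthogonal[OF f(1), symmetric]) measurable
    also have "\<dots> = (\<integral>\<^sup>+y. ennreal ((1 - cos ((r *\<^sub>R e) \<bullet> y)) * kern \<alpha> y) \<partial>lborel)"
    proof (rule nn_integral_cong)
      fix y
      have "\<xi> \<bullet> f y = (r *\<^sub>R e) \<bullet> y"
        using f unfolding orthogonal_transformation_def by metis
      moreover have "norm (f y) = norm y" using f(1) by (simp add: orthogonal_transformation)
      ultimately show "?g (f y) = ennreal ((1 - cos ((r *\<^sub>R e) \<bullet> y)) * kern \<alpha> y)"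
        by (simp add: kern_def)
    qed
    also have "\<dots> = ennreal (\<bar>1 / r\<bar> ^ CARD('n)) *
        (\<integral>\<^sup>+y. ennreal ((1 - cos ((r *\<^sub>R e) \<bullet> (0 + (1 / r) *\<^sub>R y))) * kern \<alpha> (0 + (1 / r) *\<^sub>R y)) \<partial>lborel)"
      by (rule nn_integral_lborel_affine) (use r in simp_all)
    also have "(\<integral>\<^sup>+y. ennreal ((1 - cos ((r *\<^sub>R e) \<bullet> (0 + (1 / r) *\<^sub>R y))) * kern \<alpha> (0 + (1 / r) *\<^sub>R y)) \<partial>lborel)
        = (\<integral>\<^sup>+y. ennreal (r powr (real CARD('n) + \<alpha>)) * ennreal ((1 - cos (e \<bullet> y)) * kern \<alpha> y) \<partial>lborel)"
    proof (rule nn_integral_cong)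
      fix y :: "real^'n"
      have "kern \<alpha> ((1 / r) *\<^sub>R y) = r powr (real CARD('n) + \<alpha>) * kern \<alpha> y"
      proof -
        define p where "p = real CARD('n) + \<alpha>"
        have "kern \<alpha> ((1 / r) *\<^sub>R y) = (norm y / r) powr - p"
          using r by (simp add: kern_def p_def)
        also have "\<dots> = norm y powr - p / r powr - p"
          by (rule powr_divide)
        also have "\<dots> = r powr p * norm y powr - p" by (simp add: powr_minus_divide)
        finally show ?thesis by (simp add: kern_def p_def)
      qed
      then show "ennreal ((1 - cos ((r *\<^sub>R e) \<bullet> (0 + (1 / r) *\<^sub>R y))) * kern \<alpha> (0 + (1 / r) *\<^sub>R y))
          = ennreal (r powr (real CARD('n) + \<alpha>)) * ennreal ((1 - cos (e \<bullet> y)) * kern \<alpha> y)"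
        using r by (simp add: ennreal_mult'[symmetric] mult_ac)
    qed
    also have "\<dots> = ennreal (r powr (real CARD('n) + \<alpha>)) * J e"
      unfolding J_def by (rule nn_integral_cmult) measurable
    also have "ennreal (\<bar>1 / r\<bar> ^ CARD('n)) * (ennreal (r powr (real CARD('n) + \<alpha>)) * J e)
        = ennreal ((1 / r) ^ CARD('n) * r powr (real CARD('n) + \<alpha>) * c)"
      using r c by (simp add: ennreal_mult[symmetric] mult.assoc)
    also have "(1 / r) ^ CARD('n) * r powr (real CARD('n) + \<alpha>) * c = c * norm \<xi> powr \<alpha>"
      using r by (simp add: powr_add powr_realpow power_one_over r_def field_simps)
    finally show ?thesis .
  qed (simp add: J_def)
  then show ?thesis using c by (auto simp: J_def)
qed


section \<open>Fourier inversion\<close>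

lemma osc_measurable [measurable]: "cinf_c f \<Longrightarrow> osc f \<in> borel_measurable borel"
  by (rule smooth_measurable[OF smooth_osc])

text \<open>The decay \<open>|x|\<close> to the power \<open>-(n+1)\<close> is that of the kernel with \<open>\<alpha> = 1\<close>, whose integrability away
from the origin is known.\<close>

lemma osc_integrable:
  fixes f :: "real^'n \<Rightarrow> complex"
  assumes f: "cinf_c f"
  shows "integrable lborel (osc f)"
proof (rule integrableI_bounded)
  show "osc f \<in> borel_measurable lborel" using osc_measurable[OF f] by simp
  obtain A where A: "\<And>x. norm (osc f x) \<le> A" using osc_bounded[OF f] by blast
  obtain B where B: "\<And>x. norm x ^ (CARD('n) + 1) * norm (osc f x) \<le> B" using osc_decay[OF f] by blast
  have B0: "0 \<le> B" using B[of 0] by simp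
  let ?K = "\<lambda>y::real^'n. min 1 (norm y ^ 2) * kern 1 y"
  have "(\<integral>\<^sup>+x. ennreal (norm (osc f x)) \<partial>lborel)
      \<le> (\<integral>\<^sup>+x. ennreal A * indicator (cball 0 1) x + ennreal B * ennreal (?K x) \<partial>lborel)"
  proof (rule nn_integral_mono)
    fix x :: "real^'n"
    show "ennreal (norm (osc f x)) \<le> ennreal A * indicator (cball 0 1) x + ennreal B * ennreal (?K x)"
    proof (cases "norm x \<le> 1")
      case True
      have "ennreal (norm (osc f x)) \<le> ennreal A" using A by (rule ennreal_leI)
      then show ?thesis using True by (simp add: add_increasing2)
    next
      case False
      then have x: "1 < norm x" by simp
      define p where "p = real CARD('n) + 1"
      have "0 < norm x" using x by linarith
      from powr_realpow[OF this, of "CARD('n) + 1"]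
      have "norm x powr p = norm x ^ (CARD('n) + 1)" by (simp add: p_def add.commute)
      moreover have "kern 1 x = inverse (norm x powr p)"
        unfolding kern_def p_def[symmetric] by (rule powr_minus)
      ultimately have "kern 1 x = inverse (norm x ^ (CARD('n) + 1))" by simp
    moreover have "norm (osc f x) \<le> B * inverse (norm x ^ (CARD('n) + 1))"
        using B[of x] \<open>0 < norm x\<close>
        by (simp add: divide_inverse[symmetric] pos_le_divide_eq mult_ac)
      ultimately have "norm (osc f x) \<le> B * ?K x"
        using x by (simp add: min_def)
      then have "ennreal (norm (osc f x)) \<le> ennreal B * ennreal (?K x)"
        using B0 by (simp add: ennreal_mult'[symmetric] ennreal_leI)
      then show ?thesis by (simp add: add_increasing)
    qed
  qed
  also have "\<dots> = ennreal A * emeasure lborel (cball (0::real^'n) 1)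
      + ennreal B * (\<integral>\<^sup>+x. ennreal (?K x) \<partial>lborel)"
    by (subst nn_integral_add)
      (auto simp: nn_integral_cmult nn_integral_cmult_indicator
        intro!: borel_measurable_times_ennreal borel_measurable_indicator)
  also have "\<dots> < \<infinity>"
    using kern_integrable[of 1, where 'n = 'n] emeasure_lborel_cball_finite[of "0::real^'n" 1]
    by (simp add: ennreal_mult_less_top)
  finally show "(\<integral>\<^sup>+x. ennreal (norm (osc f x)) \<partial>lborel) < \<infinity>" .
qed

lemma lborel_prod_integral:
  fixes f :: "'a::euclidean_space \<Rightarrow> real \<Rightarrow> complex"
  assumes int: "\<And>b. b \<in> Basis \<Longrightarrow> integrable lborel (f b)"
  shows "integrable lborel (\<lambda>x. \<Prod>b\<in>Basis. f b (x \<bullet> b))"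
    and "(\<integral>x. (\<Prod>b\<in>Basis. f b (x \<bullet> b)) \<partial>lborel) = (\<Prod>b\<in>Basis. \<integral>t. f b t \<partial>lborel)"
proof -
  interpret product_sigma_finite "\<lambda>_::'a. lborel::real measure" ..
  have [measurable]: "f b \<in> borel_measurable borel" if "b \<in> Basis" for b
    using borel_measurable_integrable[OF int[OF that]] by simp
  have eq: "(\<Prod>b\<in>Basis. f b ((\<Sum>b'\<in>Basis. g b' *\<^sub>R b') \<bullet> b)) = (\<Prod>b\<in>Basis. f b (g b))" for g
    by (intro prod.cong refl) (simp add: inner_sum_left_Basis)
  have m1: "(\<lambda>g. \<Sum>b\<in>Basis. g b *\<^sub>R (b::'a)) \<in> measurable (\<Pi>\<^sub>M b\<in>Basis. lborel) borel" by measurable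
  have m2: "(\<lambda>x. \<Prod>b\<in>Basis. f b (x \<bullet> b)) \<in> borel_measurable borel" by measurable
  show "integrable lborel (\<lambda>x. \<Prod>b\<in>Basis. f b (x \<bullet> b))"
    by (subst lborel_eq, subst integrable_distr_eq[OF m1 m2])
      (simp only: eq, rule product_integrable_prod, use int in auto)
  show "(\<integral>x. (\<Prod>b\<in>Basis. f b (x \<bullet> b)) \<partial>lborel) = (\<Prod>b\<in>Basis. \<integral>t. f b t \<partial>lborel)"
    by (subst lborel_eq, subst integral_distr[OF m1 m2])
      (simp only: eq, rule product_integral_prod, use int in auto)
qed

definition gauss :: "real^'n \<Rightarrow> real" where
  "gauss x = exp (- (norm x ^ 2) / 2)"

lemma gauss_measurable [measurable]: "gauss \<in> borel_measurable borel"
  unfolding gauss_def by measurable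

text \<open>This is the characteristic function of the standard normal distribution.\<close>

lemma gauss_fourier_1d:
  shows "integrable lborel (\<lambda>t. cis (u * t) * of_real (exp (- (t ^ 2) / 2)))"
    and "(\<integral>t. cis (u * t) * of_real (exp (- (t ^ 2) / 2)) \<partial>lborel) = of_real (sqrt (2 * pi) * exp (- (u ^ 2) / 2))"
proof -
  have e: "exp (- (t ^ 2) / 2) = sqrt (2 * pi) * std_normal_density t" for t :: real
    by (simp add: std_normal_density_def)
  have "integrable lborel (\<lambda>t. exp (- (t ^ 2) / 2 :: real))"
    unfolding e using integrable_normal_density by (intro integrable_mult_right) auto
  then show "integrable lborel (\<lambda>t. cis (u * t) * of_real (exp (- (t ^ 2) / 2)))"
    by (rule Bochner_Integration.integrable_bound) (auto simp: norm_mult)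
  have "(\<integral>t. cis (u * t) * of_real (exp (- (t ^ 2) / 2)) \<partial>lborel)
      = (\<integral>t. of_real (sqrt (2 * pi)) * (std_normal_density t *\<^sub>R iexp (u * t)) \<partial>lborel)"
    unfolding e by (simp add: cis_conv_exp scaleR_conv_of_real mult_ac)
  also have "\<dots> = of_real (sqrt (2 * pi)) * char std_normal_distribution u"
    unfolding char_def integral_mult_right_zero
    by (subst integral_density) (simp_all add: normal_density_nonneg)
  finally show "(\<integral>t. cis (u * t) * of_real (exp (- (t ^ 2) / 2)) \<partial>lborel) = of_real (sqrt (2 * pi) * exp (- (u ^ 2) / 2))"
    by (simp add: char_std_normal_distribution)
qed

text \<open>Both the Gaussian and the character factor over the coordinates.\<close>

lemma gauss_fourier:
  fixes x :: "real^'n"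
  shows "integrable lborel (\<lambda>\<xi>. cis (x \<bullet> \<xi>) * of_real (gauss \<xi>))" (is ?A)
    and "osc (\<lambda>\<xi>. of_real (gauss \<xi>)) x = of_real (sqrt (2 * pi) ^ CARD('n) * gauss x)" (is ?B)
proof -
  let ?f = "\<lambda>b t. cis ((x \<bullet> b) * t) * of_real (exp (- (t ^ 2) / 2))"
  have sq: "norm y ^ 2 = (\<Sum>b\<in>Basis. (y \<bullet> b) ^ 2)" for y :: "real^'n"
    unfolding power2_norm_eq_inner by (subst euclidean_inner) (simp add: power2_eq_square)
  have g: "gauss y = (\<Prod>b\<in>Basis. exp (- ((y \<bullet> b) ^ 2) / 2))" for y :: "real^'n"
    by (simp add: gauss_def sq exp_sum[symmetric] sum_negf sum_divide_distrib)
  have c: "cis (x \<bullet> \<xi>) = (\<Prod>b\<in>Basis. cis ((x \<bullet> b) * (\<xi> \<bullet> b)))" for \<xi>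
    by (simp add: euclidean_inner[of x \<xi>] cis_conv_exp exp_sum[symmetric] sum_distrib_left)
  have eq: "cis (x \<bullet> \<xi>) * of_real (gauss \<xi>) = (\<Prod>b\<in>Basis. ?f b (\<xi> \<bullet> b))" for \<xi>
    by (simp add: g c prod.distrib)
  show ?A unfolding eq by (rule lborel_prod_integral) (rule gauss_fourier_1d)
  have "osc (\<lambda>\<xi>. of_real (gauss \<xi>)) x = (\<Prod>b\<in>Basis. of_real (sqrt (2 * pi) * exp (- ((x \<bullet> b) ^ 2) / 2)))"
    unfolding osc_def eq
    by (subst lborel_prod_integral(2)) (simp_all only: gauss_fourier_1d)
  then show ?B by (simp add: g prod.distrib)
qed

lemma gauss_integrable: "integrable lborel (gauss :: real^'n \<Rightarrow> real)"
  using integrable_Re[OF gauss_fourier(1)[of "0 :: real^'n"]] by simp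

lemma osc_gauss_scaled:
  fixes w :: "real^'n"
  assumes s: "0 < s"
  shows "(\<integral>\<xi>. cis (\<xi> \<bullet> w) * of_real (gauss (s *\<^sub>R \<xi>)) \<partial>lborel)
    = of_real (sqrt (2 * pi) ^ CARD('n) * (1 / s) ^ CARD('n) * gauss ((1 / s) *\<^sub>R w))"
proof -
  have "osc (\<lambda>\<xi>. of_real (gauss \<xi>)) ((1 / s) *\<^sub>R w) = \<bar>s\<bar> ^ CARD('n) *\<^sub>R
      (\<integral>\<xi>. cis (((1 / s) *\<^sub>R w) \<bullet> (0 + s *\<^sub>R \<xi>)) * of_real (gauss (0 + s *\<^sub>R \<xi>)) \<partial>lborel)"
    unfolding osc_def by (rule integral_lborel_affine) (use s in simp_all)
  also have "\<dots> = s ^ CARD('n) *\<^sub>R (\<integral>\<xi>. cis (\<xi> \<bullet> w) * of_real (gauss (s *\<^sub>R \<xi>)) \<partial>lborel)"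
    using s by (simp add: inner_commute)
  finally show ?thesis
    unfolding gauss_fourier using s by (simp add: scaleR_conv_of_real field_simps)
qed

text \<open>The factor \<open>gauss(s\<xi>)\<close> makes the double integral absolutely convergent. Integrating in \<open>\<xi>\<close> first
produces a rescaled Gaussian centred at \<open>x\<close>, and the substitution \<open>z = x + su\<close> removes all powers
of \<open>s\<close>.\<close>

lemma osc_gauss_regularised:
  fixes f :: "real^'n \<Rightarrow> complex"
  assumes f: "cinf_c f" and s: "0 < s"
  shows "(\<integral>\<xi>. cis (- (\<xi> \<bullet> x)) * osc f \<xi> * of_real (gauss (s *\<^sub>R \<xi>)) \<partial>lborel)
    = of_real (sqrt (2 * pi) ^ CARD('n)) * (\<integral>u. f (x + s *\<^sub>R u) * of_real (gauss u) \<partial>lborel)"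
proof -
  have [measurable]: "f \<in> borel_measurable borel" by (rule smooth_measurable[OF cinf_c_smooth[OF f]])
  have fi: "integrable lborel f" by (rule cinf_c_integrable[OF f])
  have gi: "integrable lborel (\<lambda>\<xi>. gauss (s *\<^sub>R (\<xi>::real^'n)))"
    using integrable_lborel_affine[OF gauss_integrable, of s 0] s by simp
  have g0: "0 \<le> gauss \<xi>" for \<xi> :: "real^'n" by (simp add: gauss_def)
  define F where "F \<xi> z = cis (\<xi> \<bullet> (z - x)) * (f z * of_real (gauss (s *\<^sub>R \<xi>)))" for \<xi> z
  have F_int: "integrable (lborel \<Otimes>\<^sub>M lborel) (case_prod F)"
  proof (rule lborel_pair.Fubini_integrable)
    show "case_prod F \<in> borel_measurable (lborel \<Otimes>\<^sub>M lborel)"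
      unfolding F_def by measurable
    have "integrable lborel (\<lambda>\<xi>. (\<integral>z. norm (f z) \<partial>lborel) * gauss (s *\<^sub>R (\<xi>::real^'n)))"
      using gi by simp
    then show "integrable lborel (\<lambda>\<xi>. \<integral>z. norm (case_prod F (\<xi>, z)) \<partial>lborel)"
      by (simp add: F_def norm_mult g0)
    show "AE \<xi> in lborel. integrable lborel (\<lambda>z. case_prod F (\<xi>, z))"
    proof (rule AE_I2)
      fix \<xi>
      show "integrable lborel (\<lambda>z. case_prod F (\<xi>, z))"
        by (rule Bochner_Integration.integrable_bound[OF integrable_mult_left[of "gauss (s *\<^sub>R \<xi>)", OF integrable_norm[OF fi]]])
          (auto simp: F_def norm_mult g0)
    qed
  qed
  have "cis (- (\<xi> \<bullet> x)) * osc f \<xi> * of_real (gauss (s *\<^sub>R \<xi>)) = (\<integral>z. F \<xi> z \<partial>lborel)" for \<xi>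
  proof -
    have "F \<xi> z = (cis (- (\<xi> \<bullet> x)) * of_real (gauss (s *\<^sub>R \<xi>))) * (cis (\<xi> \<bullet> z) * f z)" for z
      by (simp add: F_def inner_diff_right cis_mult mult_ac)
    then have "(\<integral>z. F \<xi> z \<partial>lborel) =
        (\<integral>z. (cis (- (\<xi> \<bullet> x)) * of_real (gauss (s *\<^sub>R \<xi>))) * (cis (\<xi> \<bullet> z) * f z) \<partial>lborel)"
      by (simp only:)
    also have "\<dots> = (cis (- (\<xi> \<bullet> x)) * of_real (gauss (s *\<^sub>R \<xi>))) * osc f \<xi>"
      unfolding integral_mult_right_zero osc_def ..
    finally show ?thesis by (simp only: mult_ac)
  qed
  then have "(\<integral>\<xi>. cis (- (\<xi> \<bullet> x)) * osc f \<xi> * of_real (gauss (s *\<^sub>R \<xi>)) \<partial>lborel)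
      = (\<integral>\<xi>. (\<integral>z. F \<xi> z \<partial>lborel) \<partial>lborel)" by simp
  also have "\<dots> = (\<integral>z. (\<integral>\<xi>. F \<xi> z \<partial>lborel) \<partial>lborel)"
    by (rule lborel_pair.Fubini_integral[OF F_int, symmetric])
  also have "\<dots> = (\<integral>z. f z * of_real (sqrt (2 * pi) ^ CARD('n) * (1 / s) ^ CARD('n) * gauss ((1 / s) *\<^sub>R (z - x))) \<partial>lborel)"
  proof (rule Bochner_Integration.integral_cong[OF refl])
    fix z
    have "(\<integral>\<xi>. F \<xi> z \<partial>lborel) = (\<integral>\<xi>. f z * (cis (\<xi> \<bullet> (z - x)) * of_real (gauss (s *\<^sub>R \<xi>))) \<partial>lborel)"
      by (simp add: F_def mult_ac)
    then show "(\<integral>\<xi>. F \<xi> z \<partial>lborel)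
        = f z * of_real (sqrt (2 * pi) ^ CARD('n) * (1 / s) ^ CARD('n) * gauss ((1 / s) *\<^sub>R (z - x)))"
      unfolding integral_mult_right_zero osc_gauss_scaled[OF s] .
  qed
  also have "\<dots> = \<bar>s\<bar> ^ CARD('n) *\<^sub>R (\<integral>u. f (x + s *\<^sub>R u) *
      of_real (sqrt (2 * pi) ^ CARD('n) * (1 / s) ^ CARD('n) * gauss ((1 / s) *\<^sub>R ((x + s *\<^sub>R u) - x))) \<partial>lborel)"
    by (rule integral_lborel_affine) (use s in simp_all)
  also have "\<dots> = \<bar>s\<bar> ^ CARD('n) *\<^sub>R (\<integral>u. of_real (sqrt (2 * pi) ^ CARD('n) * (1 / s) ^ CARD('n)) *
      (f (x + s *\<^sub>R u) * of_real (gauss u)) \<partial>lborel)"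
    using s by (simp add: mult_ac)
  also have "\<dots> = of_real (sqrt (2 * pi) ^ CARD('n)) * (\<integral>u. f (x + s *\<^sub>R u) * of_real (gauss u) \<partial>lborel)"
    unfolding integral_mult_right_zero using s by (simp add: scaleR_conv_of_real field_simps)
  finally show ?thesis .
qed

text \<open>Let the width parameter of the regularisation tend to \<open>0\<close>. On one side the Gaussian factor tends to
\<open>1\<close>, on the other \<open>f(x + su)\<close> tends to \<open>f(x)\<close>; the two factors \<open>sqrt(2\<pi>)\<close> to the power \<open>n\<close> multiply to the
normalising constant.\<close>

lemma fourier_inversion:
  fixes f :: "real^'n \<Rightarrow> complex"
  assumes f: "cinf_c f"
  shows "fourier (inv_fourier f) = f"
proof (rule ext)
  fix x
  define s where "s m = 1 / real (Suc m)" for m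
  have s: "0 < s m" for m by (simp add: s_def)
  have s0: "s \<longlonglongrightarrow> 0" unfolding s_def by (rule LIMSEQ_Suc[OF lim_1_over_n])
  have [measurable]: "f \<in> borel_measurable borel" by (rule smooth_measurable[OF cinf_c_smooth[OF f]])
  note [measurable] = osc_measurable[OF f]
  obtain B where B: "0 \<le> B" "\<And>x. norm (f x) \<le> B" using cinf_c_bounded[OF f] by blast
  have g: "0 \<le> gauss \<xi>" "gauss \<xi> \<le> 1" for \<xi> :: "real^'n" by (auto simp: gauss_def)
  have gc: "continuous_on UNIV (gauss :: real^'n \<Rightarrow> real)"
    unfolding gauss_def by (intro continuous_intros) auto
  have glim: "(\<lambda>m. gauss (s m *\<^sub>R \<xi>)) \<longlonglongrightarrow> 1" for \<xi> :: "real^'n"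
  proof -
    have "(\<lambda>m. gauss (s m *\<^sub>R \<xi>)) \<longlonglongrightarrow> gauss (0 *\<^sub>R \<xi>)"
      by (intro continuous_on_tendsto_compose[OF gc] tendsto_intros s0) auto
    then show ?thesis by (simp add: gauss_def)
  qed
  have flim: "(\<lambda>m. f (x + s m *\<^sub>R u)) \<longlonglongrightarrow> f x" for u
  proof -
    have "(\<lambda>m. f (x + s m *\<^sub>R u)) \<longlonglongrightarrow> f (x + 0 *\<^sub>R u)"
      by (intro continuous_on_tendsto_compose[OF smooth_continuous_on[OF cinf_c_smooth[OF f], of UNIV]]
          tendsto_intros s0) auto
    then show ?thesis by simp
  qed
  have "(\<lambda>m. \<integral>\<xi>. cis (- (\<xi> \<bullet> x)) * osc f \<xi> * of_real (gauss (s m *\<^sub>R \<xi>)) \<partial>lborel)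
      \<longlonglongrightarrow> (\<integral>\<xi>. cis (- (\<xi> \<bullet> x)) * osc f \<xi> \<partial>lborel)"
  proof (rule integral_dominated_convergence)
    show "integrable lborel (\<lambda>\<xi>. norm (osc f \<xi>))" by (rule integrable_norm[OF osc_integrable[OF f]])
    show "AE \<xi> in lborel. (\<lambda>m. cis (- (\<xi> \<bullet> x)) * osc f \<xi> * of_real (gauss (s m *\<^sub>R \<xi>)))
        \<longlonglongrightarrow> cis (- (\<xi> \<bullet> x)) * osc f \<xi>"
      by (rule AE_I2) (auto intro!: tendsto_eq_intros glim tendsto_of_real)
    show "AE \<xi> in lborel. norm (cis (- (\<xi> \<bullet> x)) * osc f \<xi> * of_real (gauss (s m *\<^sub>R \<xi>))) \<le> norm (osc f \<xi>)" for m
      by (rule AE_I2) (simp add: norm_mult g mult_left_le)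
  qed measurable
  moreover have "(\<lambda>m. \<integral>\<xi>. cis (- (\<xi> \<bullet> x)) * osc f \<xi> * of_real (gauss (s m *\<^sub>R \<xi>)) \<partial>lborel)
      \<longlonglongrightarrow> of_real (sqrt (2 * pi) ^ CARD('n)) * (\<integral>u. f x * of_real (gauss (u::real^'n)) \<partial>lborel)"
    unfolding osc_gauss_regularised[OF f s]
  proof (intro tendsto_intros integral_dominated_convergence)
    show "integrable lborel (\<lambda>u. B * gauss (u::real^'n))" by (intro integrable_mult_right gauss_integrable)
    show "AE u in lborel. (\<lambda>m. f (x + s m *\<^sub>R u) * of_real (gauss u)) \<longlonglongrightarrow> f x * of_real (gauss u)"
      by (rule AE_I2) (auto intro!: tendsto_intros flim)
    show "AE u in lborel. norm (f (x + s m *\<^sub>R u) * of_real (gauss u)) \<le> B * gauss u" for m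
      by (rule AE_I2) (auto simp: norm_mult g intro!: mult_right_mono B)
  qed measurable
  ultimately have "(\<integral>\<xi>. cis (- (\<xi> \<bullet> x)) * osc f \<xi> \<partial>lborel)
      = of_real (sqrt (2 * pi) ^ CARD('n)) * (\<integral>u. f x * of_real (gauss (u::real^'n)) \<partial>lborel)"
    by (rule LIMSEQ_unique)
  also have "(\<integral>u. f x * of_real (gauss (u::real^'n)) \<partial>lborel) = f x * of_real (sqrt (2 * pi) ^ CARD('n))"
    using gauss_fourier(2)[of "0::real^'n"] by (simp add: osc_def gauss_def)
  also have "of_real (sqrt (2 * pi) ^ CARD('n)) * (f x * of_real (sqrt (2 * pi) ^ CARD('n)))
      = f x * of_real (sqrt (2 * pi) ^ CARD('n) * sqrt (2 * pi) ^ CARD('n))"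
    by (simp only: of_real_mult mult_ac)
  also have "sqrt (2 * pi) ^ CARD('n) * sqrt (2 * pi) ^ CARD('n) = (2 * pi) ^ CARD('n)"
    unfolding power_mult_distrib[symmetric] real_sqrt_mult_self by simp
  finally show "fourier (inv_fourier f) x = f x"
    by (simp add: fourier_def inv_fourier_osc inner_commute)
qed


section \<open>The fractional Laplacian as a singular integral\<close>

definition second_diff :: "(real^'n \<Rightarrow> real) \<Rightarrow> real^'n \<Rightarrow> real^'n \<Rightarrow> real" where
  "second_diff f y x = f x - (f (x + y) + f (x - y)) / 2"

lemma cinf_c_shift: "cinf_c f \<Longrightarrow> cinf_c (\<lambda>x. f (x + a))"
  using cinf_c_affine[of f 1 a] by simp

lemma cinf_c_cmult: "cinf_c f \<Longrightarrow> cinf_c (\<lambda>x. c * f x)" for c :: "'b::real_normed_algebra"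
  by (rule cinf_c_linear[OF bounded_linear_mult_right])

lemma cinf_c_measurable: "cinf_c f \<Longrightarrow> f \<in> borel_measurable borel"
  by (rule smooth_measurable[OF cinf_c_smooth])

lemma second_diff_eq: "second_diff f y x = f x + (- 1 / 2) * f (x + y) + (- 1 / 2) * f (x + - y)"
  by (simp add: second_diff_def field_simps)

lemma cinf_c_second_diff: "cinf_c f \<Longrightarrow> cinf_c (second_diff f y)"
  unfolding second_diff_eq[abs_def] by (intro cinf_c_add cinf_c_cmult cinf_c_shift)

lemma cinf_c_of_real: "cinf_c f \<Longrightarrow> cinf_c (\<lambda>x. complex_of_real (f x))"
  by (rule cinf_c_linear[OF bounded_linear_of_real])

lemma osc_shift:
  assumes "cinf_c f"
  shows "osc (\<lambda>x. f (x + a)) \<xi> = cis (- (\<xi> \<bullet> a)) * osc f \<xi>"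
proof -
  have [measurable]: "f \<in> borel_measurable borel" using assms by (rule cinf_c_measurable)
  have "osc f \<xi> = (\<integral>x. cis (\<xi> \<bullet> (x + a)) * f (x + a) \<partial>lborel)"
    unfolding osc_def by (rule integral_lborel_shift[symmetric]) measurable
  also have "\<dots> = (\<integral>x. cis (\<xi> \<bullet> a) * (cis (\<xi> \<bullet> x) * f (x + a)) \<partial>lborel)"
    by (simp add: inner_add_right cis_mult[symmetric] mult_ac)
  also have "\<dots> = cis (\<xi> \<bullet> a) * osc (\<lambda>x. f (x + a)) \<xi>"
    by (simp add: osc_def)
  finally have "cis (- (\<xi> \<bullet> a)) * osc f \<xi> = (cis (- (\<xi> \<bullet> a)) * cis (\<xi> \<bullet> a)) * osc (\<lambda>x. f (x + a)) \<xi>"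
    by (simp add: mult.assoc)
  then show ?thesis by (simp add: cis_mult)
qed

lemma osc_add:
  assumes "cinf_c f" "cinf_c g"
  shows "osc (\<lambda>x. f x + g x) \<xi> = osc f \<xi> + osc g \<xi>"
  unfolding osc_def distrib_left
  by (intro Bochner_Integration.integral_add integrable_cis_mult cinf_c_integrable assms)

lemma osc_cmult: "osc (\<lambda>x. c * f x) \<xi> = c * osc f \<xi>"
  by (simp add: osc_def mult.left_commute[of _ c])

text \<open>Translations become characters, and the average of \<open>cis(\<xi> \<bullet> y)\<close> and \<open>cis(-\<xi> \<bullet> y)\<close> is \<open>cos(\<xi> \<bullet> y)\<close>.\<close>

lemma inv_fourier_second_diff:
  fixes \<psi> :: "real^'n \<Rightarrow> real"
  assumes "cinf_c \<psi>"
  shows "inv_fourier (\<lambda>x. complex_of_real (second_diff \<psi> y x)) \<xi>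
    = of_real (1 - cos (\<xi> \<bullet> y)) * inv_fourier (\<lambda>x. complex_of_real (\<psi> x)) \<xi>"
proof -
  let ?c = "\<lambda>x. complex_of_real (\<psi> x)"
  have c: "cinf_c ?c" by (rule cinf_c_of_real[OF assms])
  have "(\<lambda>x. complex_of_real (second_diff \<psi> y x))
      = (\<lambda>x. ?c x + (- 1 / 2) * ?c (x + y) + (- 1 / 2) * ?c (x + - y))"
    by (rule ext) (simp add: second_diff_eq)
  then have "osc (\<lambda>x. complex_of_real (second_diff \<psi> y x)) \<xi>
      = osc ?c \<xi> + (- 1 / 2) * (cis (- (\<xi> \<bullet> y)) * osc ?c \<xi>) + (- 1 / 2) * (cis (\<xi> \<bullet> y) * osc ?c \<xi>)"
    by (simp only: osc_add[OF cinf_c_add[OF c cinf_c_cmult[OF cinf_c_shift[OF c]]] cinf_c_cmult[OF cinf_c_shift[OF c]]]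
        osc_add[OF c cinf_c_cmult[OF cinf_c_shift[OF c]]] osc_cmult osc_shift[OF c] inner_minus_right minus_minus)
  also have "\<dots> = (1 - (cis (- (\<xi> \<bullet> y)) + cis (\<xi> \<bullet> y)) / 2) * osc ?c \<xi>"
    by (simp add: field_simps)
  also have "1 - (cis (- (\<xi> \<bullet> y)) + cis (\<xi> \<bullet> y)) / 2 = of_real (1 - cos (\<xi> \<bullet> y))"
    by (simp add: complex_eq_iff)
  finally show ?thesis by (simp add: inv_fourier_osc)
qed

lemma norm_powr_integral:
  fixes \<alpha> :: real
  assumes \<alpha>: "0 < \<alpha>" "\<alpha> < 2"
  obtains c where "0 \<le> c"
    "\<And>\<xi>::real^'n. integrable lborel (\<lambda>y. (1 - cos (\<xi> \<bullet> y)) * kern \<alpha> y)"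
    "\<And>\<xi>::real^'n. (\<integral>y. (1 - cos (\<xi> \<bullet> y)) * kern \<alpha> y \<partial>lborel) = c * norm \<xi> powr \<alpha>"
proof -
  obtain c where c: "0 \<le> c" "\<And>\<xi>::real^'n. (\<integral>\<^sup>+y. ennreal ((1 - cos (\<xi> \<bullet> y)) * kern \<alpha> y) \<partial>lborel) = ennreal (c * norm \<xi> powr \<alpha>)"
    using norm_powr_eq_integral[OF \<alpha>] by blast
  have "has_bochner_integral lborel (\<lambda>y. (1 - cos (\<xi> \<bullet> y)) * kern \<alpha> y) (c * norm \<xi> powr \<alpha>)" for \<xi> :: "real^'n"
    by (rule has_bochner_integral_nn_integral) (use c in auto)
  then show thesis using that c(1) by (simp add: has_bochner_integral_iff)
qed

text \<open>The product \<open>|\<xi>|\<^sup>\<alpha>\<close> times the transform of \<open>\<psi>\<close> need not be a Schwartz function at the origin, but it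
is dominated by \<open>1 + |\<xi>|\<^sup>2\<close> times that transform, which is the transform of \<open>\<psi> - \<Delta>\<psi>\<close>.\<close>

lemma frac_laplacian_integrable:
  fixes g :: "real^'n \<Rightarrow> complex" and \<psi> :: "real^'n \<Rightarrow> real"
  assumes \<alpha>: "0 < \<alpha>" "\<alpha> < 2" and g: "tempered g" and \<psi>: "cinf_c \<psi>"
  shows "integrable lborel (\<lambda>\<xi>. of_real (norm \<xi> powr \<alpha>) * (g \<xi> * inv_fourier (\<lambda>x. of_real (\<psi> x)) \<xi>))"
proof -
  let ?c = "\<lambda>x. complex_of_real (\<psi> x)"
  let ?d = "\<lambda>x. ?c x + (- 1) * laplace ?c x"
  have c: "cinf_c ?c" by (rule cinf_c_of_real[OF \<psi>])
  have d: "cinf_c ?d" by (intro cinf_c_add cinf_c_cmult cinf_c_laplace c)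
  have [measurable]: "g \<in> borel_measurable borel" using g by (simp add: tempered_def)
  have [measurable]: "inv_fourier ?c \<in> borel_measurable borel"
    using smooth_measurable schwartz_inv_fourier[OF c] schwartz_def by blast
  have "inv_fourier ?d \<xi> = of_real (1 + norm \<xi> ^ 2) * inv_fourier ?c \<xi>" for \<xi>
  proof -
    have "osc ?d \<xi> = osc ?c \<xi> + (- 1) * osc (laplace ?c) \<xi>"
      unfolding osc_add[OF c cinf_c_cmult[OF cinf_c_laplace[OF c]]] osc_cmult ..
    then have "osc ?d \<xi> = of_real (1 + norm \<xi> ^ 2) * osc ?c \<xi>"
      unfolding osc_laplace[OF c] by (simp add: algebra_simps)
    then show ?thesis unfolding inv_fourier_osc by simp
  qed
  moreover have "integrable lborel (\<lambda>\<xi>. g \<xi> * inv_fourier ?d \<xi>)"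
    using g schwartz_inv_fourier[OF d] by (simp add: tempered_def)
  ultimately have I: "integrable lborel (\<lambda>\<xi>. of_real (1 + norm \<xi> ^ 2) * (g \<xi> * inv_fourier ?c \<xi>))"
    by (simp add: mult_ac)
  show ?thesis
  proof (rule Bochner_Integration.integrable_bound[OF I], measurable, rule AE_I2)
    fix \<xi> :: "real^'n"
    have "norm \<xi> powr \<alpha> \<le> 1 + norm \<xi> ^ 2"
    proof (cases "norm \<xi> \<le> 1")
      case True
      then have "norm \<xi> powr \<alpha> \<le> 1" using \<alpha> by (simp add: powr_le1)
      then show ?thesis by (simp add: add_increasing2)
    next
      case False
      then have "norm \<xi> powr \<alpha> \<le> norm \<xi> powr 2" using \<alpha> by (intro powr_mono) auto
      also have "\<dots> = norm \<xi> ^ 2" using False powr_realpow[of "norm \<xi>" 2] by auto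
      finally show ?thesis by simp
    qed
    then show "norm (of_real (norm \<xi> powr \<alpha>) * (g \<xi> * inv_fourier ?c \<xi>))
        \<le> norm (of_real (1 + norm \<xi> ^ 2) * (g \<xi> * inv_fourier ?c \<xi>))"
      unfolding norm_mult[of "of_real _"] norm_of_real by (intro mult_right_mono) auto
  qed
qed

text \<open>Replace \<open>c |\<xi>|\<^sup>\<alpha>\<close> by its integral representation and exchange the integrations, which is justified
since the kernel is nonnegative and the previous lemma bounds the result. For fixed \<open>y\<close> the factor
\<open>1 - cos(\<xi> \<bullet> y)\<close> leads to the Schwartz function belonging to \<open>second_diff \<psi> y\<close>, so the definition of
\<open>has_fourier\<close> and Fourier inversion apply.\<close>

lemma frac_laplacian_singular_integral:
  fixes f \<psi> :: "real^'n \<Rightarrow> real"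
  assumes \<alpha>: "0 < \<alpha>" "\<alpha> < 2" and F: "\<exists>g. has_fourier (\<lambda>x. complex_of_real (f x)) g"
    and \<psi>: "cinf_c \<psi>"
    and c: "\<And>\<xi>::real^'n. integrable lborel (\<lambda>y. (1 - cos (\<xi> \<bullet> y)) * kern \<alpha> y)"
    "\<And>\<xi>::real^'n. (\<integral>y. (1 - cos (\<xi> \<bullet> y)) * kern \<alpha> y \<partial>lborel) = c * norm \<xi> powr \<alpha>"
  shows "integrable lborel (\<lambda>y. kern \<alpha> y * (\<integral>x. f x * second_diff \<psi> y x \<partial>lborel))"
    and "of_real c * frac_laplacian_distr \<alpha> f \<psi>
      = of_real (\<integral>y. kern \<alpha> y * (\<integral>x. f x * second_diff \<psi> y x \<partial>lborel) \<partial>lborel)"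
proof -
  let ?c = "\<lambda>x. complex_of_real (\<psi> x)"
  let ?P = "inv_fourier ?c"
  define g where "g = fourier_of f"
  have hf: "has_fourier (\<lambda>x. complex_of_real (f x)) g"
    unfolding g_def fourier_of_def using F by (rule someI_ex)
  then have g: "tempered g" by (simp add: has_fourier_def)
  have cc: "cinf_c ?c" by (rule cinf_c_of_real[OF \<psi>])
  have [measurable]: "g \<in> borel_measurable borel" using g by (simp add: tempered_def)
  have [measurable]: "?P \<in> borel_measurable borel"
    using smooth_measurable schwartz_inv_fourier[OF cc] schwartz_def by blast
  define H where "H \<xi> y = g \<xi> * ?P \<xi> * of_real ((1 - cos (\<xi> \<bullet> y)) * kern \<alpha> y)" for \<xi> y
  have nn: "0 \<le> (1 - cos (\<xi> \<bullet> y)) * kern \<alpha> y" for \<xi> y :: "real^'n" by simp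
  note I = frac_laplacian_integrable[OF \<alpha> g \<psi>]
  have Hint: "integrable (lborel \<Otimes>\<^sub>M lborel) (case_prod H)"
  proof (rule lborel_pair.Fubini_integrable)
    show "case_prod H \<in> borel_measurable (lborel \<Otimes>\<^sub>M lborel)"
      unfolding H_def by measurable
    have "integrable lborel (\<lambda>\<xi>. c * norm (of_real (norm \<xi> powr \<alpha>) * (g \<xi> * ?P \<xi>)))"
      by (intro integrable_mult_right integrable_norm I)
    moreover have "(\<integral>y. norm (case_prod H (\<xi>, y)) \<partial>lborel) = c * norm (of_real (norm \<xi> powr \<alpha>) * (g \<xi> * ?P \<xi>))" for \<xi>
    proof -
      have "(\<integral>y. norm (case_prod H (\<xi>, y)) \<partial>lborel) = (\<integral>y. norm (g \<xi> * ?P \<xi>) * ((1 - cos (\<xi> \<bullet> y)) * kern \<alpha> y) \<partial>lborel)"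
        unfolding H_def case_prod_conv norm_mult[of "g \<xi> * ?P \<xi>"] norm_of_real abs_of_nonneg[OF nn] ..
      also have "\<dots> = norm (g \<xi> * ?P \<xi>) * (c * norm \<xi> powr \<alpha>)"
        unfolding integral_mult_right_zero c(2) ..
      finally show ?thesis by (simp add: norm_mult)
    qed
    ultimately show "integrable lborel (\<lambda>\<xi>. \<integral>y. norm (case_prod H (\<xi>, y)) \<partial>lborel)"
      by (simp only:)
    show "AE \<xi> in lborel. integrable lborel (\<lambda>y. case_prod H (\<xi>, y))"
      unfolding H_def case_prod_conv
      by (intro AE_I2 integrable_mult_right integrable_of_real c)
  qed
  have HX: "(\<integral>y. H \<xi> y \<partial>lborel) = of_real c * (of_real (norm \<xi> powr \<alpha>) * (g \<xi> * ?P \<xi>))" for \<xi>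
    unfolding H_def integral_mult_right_zero integral_complex_of_real c(2) by simp
  have HY: "(\<integral>\<xi>. H \<xi> y \<partial>lborel) = of_real (kern \<alpha> y * (\<integral>x. f x * second_diff \<psi> y x \<partial>lborel))" for y
  proof -
    let ?d = "\<lambda>x. complex_of_real (second_diff \<psi> y x)"
    have d: "cinf_c ?d" by (intro cinf_c_of_real cinf_c_second_diff \<psi>)
    have "(\<integral>\<xi>. H \<xi> y \<partial>lborel) = (\<integral>\<xi>. of_real (kern \<alpha> y) * (g \<xi> * inv_fourier ?d \<xi>) \<partial>lborel)"
      by (simp add: H_def inv_fourier_second_diff[OF \<psi>] mult_ac)
    also have "\<dots> = of_real (kern \<alpha> y) * (\<integral>\<xi>. g \<xi> * inv_fourier ?d \<xi> \<partial>lborel)" by simp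
    also have "(\<integral>\<xi>. g \<xi> * inv_fourier ?d \<xi> \<partial>lborel) = (\<integral>x. of_real (f x) * fourier (inv_fourier ?d) x \<partial>lborel)"
      using hf schwartz_inv_fourier[OF d] by (simp add: has_fourier_def)
    also have "\<dots> = of_real (\<integral>x. f x * second_diff \<psi> y x \<partial>lborel)"
      unfolding fourier_inversion[OF d] of_real_mult[symmetric] integral_complex_of_real ..
    finally show ?thesis by simp
  qed
  have "integrable lborel (\<lambda>y. \<integral>\<xi>. H \<xi> y \<partial>lborel)"
    using lborel_pair.integrable_snd[OF Hint] by simp
  then show "integrable lborel (\<lambda>y. kern \<alpha> y * (\<integral>x. f x * second_diff \<psi> y x \<partial>lborel))"
    unfolding HY by (simp only: complex_of_real_integrable_eq)
  have "of_real c * frac_laplacian_distr \<alpha> f \<psi> = (\<integral>\<xi>. (\<integral>y. H \<xi> y \<partial>lborel) \<partial>lborel)"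
    unfolding HX integral_mult_right_zero frac_laplacian_distr_def g_def by (simp add: mult.assoc)
  also have "\<dots> = (\<integral>y. (\<integral>\<xi>. H \<xi> y \<partial>lborel) \<partial>lborel)"
    by (rule lborel_pair.Fubini_integral[OF Hint, symmetric])
  also have "\<dots> = of_real (\<integral>y. kern \<alpha> y * (\<integral>x. f x * second_diff \<psi> y x \<partial>lborel) \<partial>lborel)"
    unfolding HY integral_complex_of_real ..
  finally show "of_real c * frac_laplacian_distr \<alpha> f \<psi>
      = of_real (\<integral>y. kern \<alpha> y * (\<integral>x. f x * second_diff \<psi> y x \<partial>lborel) \<partial>lborel)" .
qed

lemma continuous_mult_cinf_c_integrable:
  fixes f g :: "real^'n \<Rightarrow> real"
  assumes "continuous_on UNIV f" "cinf_c g"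
  shows "integrable lborel (\<lambda>x. f x * g x)"
proof -
  obtain r where "\<And>x. r < norm x \<Longrightarrow> g x = 0" using assms by (auto simp: cinf_c_def)
  then show ?thesis
    by (intro compact_support_integrable[of _ r] continuous_intros assms
        smooth_continuous_on[OF cinf_c_smooth]) auto
qed

text \<open>Write \<open>a, b\<close> for \<open>\<theta>(x), \<theta>(x+y)\<close> and \<open>u, v\<close> for \<open>\<phi>(x), \<phi>(x+y)\<close>. Translation invariance brings the
left-hand side into the symmetric form \<open>(1/2) \<integral> (a - b) (a u - b v)\<close>, and
\<open>(a - b) (a u - b v) = (u + v) (a - b)\<^sup>2 / 2 + (u - v) (a\<^sup>2 - b\<^sup>2) / 2\<close>. In the last term, translation
invariance moves the difference back onto \<open>\<phi>\<close>. Every term carries a factor with compact support, so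
all integrals converge.\<close>

lemma localised_energy_identity:
  fixes \<theta> \<phi> :: "real^'n \<Rightarrow> real"
  assumes \<theta>: "continuous_on UNIV \<theta>" and \<phi>: "cinf_c \<phi>"
  shows "(\<integral>x. \<theta> x * second_diff (\<lambda>x. \<theta> x * \<phi> x) y x \<partial>lborel)
    = (\<integral>x. (\<phi> x + \<phi> (x + y)) * (\<theta> x - \<theta> (x + y)) ^ 2 \<partial>lborel) / 4
      + (\<integral>x. \<theta> x ^ 2 * second_diff \<phi> y x \<partial>lborel) / 2"
proof -
  have \<theta>s: "continuous_on UNIV (\<lambda>x. \<theta> (x + a))" for a
    by (rule continuous_on_compose2[OF \<theta>]) (auto intro!: continuous_intros)
  note I = continuous_mult_cinf_c_integrable
  have [measurable]: "\<theta> \<in> borel_measurable borel" "\<phi> \<in> borel_measurable borel"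
    using borel_measurable_continuous_onI[OF \<theta>] cinf_c_measurable[OF \<phi>] by auto
  define P where "P = (\<integral>x. \<theta> x ^ 2 * \<phi> x \<partial>lborel)"
  define Q where "Q = (\<integral>x. \<theta> x * \<theta> (x + y) * \<phi> (x + y) \<partial>lborel)"
  define S where "S = (\<integral>x. \<theta> x * \<theta> (x + y) * \<phi> x \<partial>lborel)"
  define T where "T = (\<integral>x. \<theta> x ^ 2 * \<phi> (x + y) \<partial>lborel)"
  define U where "U = (\<integral>x. \<theta> (x + y) ^ 2 * \<phi> x \<partial>lborel)"
  have PI: "integrable lborel (\<lambda>x. \<theta> x ^ 2 * \<phi> x)"
    by (intro I continuous_intros \<theta> \<phi>)
  have QI: "integrable lborel (\<lambda>x. \<theta> x * \<theta> (x + y) * \<phi> (x + y))"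
    by (intro I continuous_intros \<theta> \<theta>s cinf_c_shift \<phi>)
  have SI: "integrable lborel (\<lambda>x. \<theta> x * \<theta> (x + y) * \<phi> x)"
    by (intro I continuous_intros \<theta> \<theta>s \<phi>)
  have TI: "integrable lborel (\<lambda>x. \<theta> x ^ 2 * \<phi> (x + y))"
    by (intro I continuous_intros \<theta> cinf_c_shift \<phi>)
  have UI: "integrable lborel (\<lambda>x. \<theta> (x + y) ^ 2 * \<phi> x)"
    by (intro I continuous_intros \<theta>s \<phi>)
  have P'I: "integrable lborel (\<lambda>x. \<theta> (x + y) ^ 2 * \<phi> (x + y))"
    by (intro I continuous_intros \<theta>s cinf_c_shift \<phi>)
  have P': "(\<integral>x. \<theta> (x + y) ^ 2 * \<phi> (x + y) \<partial>lborel) = P"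
    unfolding P_def by (rule integral_lborel_shift[of "\<lambda>x. \<theta> x ^ 2 * \<phi> x"]) measurable
  have S'I: "integrable lborel (\<lambda>x. \<theta> x * \<theta> (x + - y) * \<phi> (x + - y))"
    by (intro I continuous_intros \<theta> \<theta>s cinf_c_shift \<phi>)
  have S': "(\<integral>x. \<theta> x * \<theta> (x + - y) * \<phi> (x + - y) \<partial>lborel) = S"
    unfolding S_def using integral_lborel_shift[of "\<lambda>x. \<theta> x * \<theta> (x + - y) * \<phi> (x + - y)" y]
    by (simp add: mult_ac)
  have U'I: "integrable lborel (\<lambda>x. \<theta> x ^ 2 * \<phi> (x + - y))"
    by (intro I continuous_intros \<theta> cinf_c_shift \<phi>)
  have U': "(\<integral>x. \<theta> x ^ 2 * \<phi> (x + - y) \<partial>lborel) = U"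
    unfolding U_def using integral_lborel_shift[of "\<lambda>x. \<theta> x ^ 2 * \<phi> (x + - y)" y]
    by simp
  have 1: "(\<integral>x. \<theta> x * second_diff (\<lambda>x. \<theta> x * \<phi> x) y x \<partial>lborel) = P + (- 1 / 2) * Q + (- 1 / 2) * S"
  proof -
    have "\<theta> x * second_diff (\<lambda>x. \<theta> x * \<phi> x) y x = \<theta> x ^ 2 * \<phi> x + (- 1 / 2) * (\<theta> x * \<theta> (x + y) * \<phi> (x + y))
        + (- 1 / 2) * (\<theta> x * \<theta> (x + - y) * \<phi> (x + - y))" for x
      by (simp add: second_diff_def field_simps power2_eq_square)
    then show ?thesis
      using PI QI S'I by (simp add: P_def[symmetric] Q_def[symmetric] S'[simplified])
  qed
  have 2: "(\<integral>x. (\<phi> x + \<phi> (x + y)) * (\<theta> x - \<theta> (x + y)) ^ 2 \<partial>lborel)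
      = P + U + (- 2) * S + T + P + (- 2) * Q"
  proof -
    have "(\<phi> x + \<phi> (x + y)) * (\<theta> x - \<theta> (x + y)) ^ 2 = \<theta> x ^ 2 * \<phi> x + \<theta> (x + y) ^ 2 * \<phi> x
       + (- 2) * (\<theta> x * \<theta> (x + y) * \<phi> x) + \<theta> x ^ 2 * \<phi> (x + y) + \<theta> (x + y) ^ 2 * \<phi> (x + y)
       + (- 2) * (\<theta> x * \<theta> (x + y) * \<phi> (x + y))" for x
      by (simp add: algebra_simps power2_eq_square)
    then show ?thesis
      using PI UI SI TI P'I QI
      by (simp add: P_def[symmetric] Q_def[symmetric] S_def[symmetric] T_def[symmetric] U_def[symmetric] P')
  qed
  have 3: "(\<integral>x. \<theta> x ^ 2 * second_diff \<phi> y x \<partial>lborel) = P + (- 1 / 2) * T + (- 1 / 2) * U"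
  proof -
    have "\<theta> x ^ 2 * second_diff \<phi> y x = \<theta> x ^ 2 * \<phi> x + (- 1 / 2) * (\<theta> x ^ 2 * \<phi> (x + y))
        + (- 1 / 2) * (\<theta> x ^ 2 * \<phi> (x + - y))" for x
      by (simp add: second_diff_def field_simps)
    then show ?thesis
      using PI TI U'I by (simp add: P_def[symmetric] T_def[symmetric] U'[simplified])
  qed
  show ?thesis unfolding 1 2 3 by (simp add: field_simps)
qed


section \<open>Errors produced by the cutoff\<close>

lemma ex_ennreal_real: "x < \<infinity> \<Longrightarrow> \<exists>K\<ge>0. x = ennreal K"
  by (cases x) auto

text \<open>The power of \<open>R\<close> in the substitution \<open>y \<mapsto> R y\<close>; it is the only source of decay in the cutoff error.\<close>

lemma kern_scaled:
  assumes \<alpha>: "0 < \<alpha>" "\<alpha> < 2"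
  obtains K where "0 \<le> K"
    "\<And>R. 0 < R \<Longrightarrow> (\<integral>\<^sup>+y. ennreal (kern \<alpha> y * min 1 ((norm (y::real^'n) / R) ^ 2)) \<partial>lborel) = ennreal (R powr - \<alpha> * K)"
proof -
  obtain K where K: "0 \<le> K" "(\<integral>\<^sup>+y. ennreal (min 1 (norm y ^ 2) * kern \<alpha> (y::real^'n)) \<partial>lborel) = ennreal K"
    using ex_ennreal_real[OF kern_integrable[OF \<alpha>, where 'n = 'n]] by blast
  have "(\<integral>\<^sup>+y. ennreal (kern \<alpha> y * min 1 ((norm (y::real^'n) / R) ^ 2)) \<partial>lborel) = ennreal (R powr - \<alpha> * K)"
    if R: "0 < R" for R
  proof -
    have "(\<integral>\<^sup>+y. ennreal (kern \<alpha> y * min 1 ((norm (y::real^'n) / R) ^ 2)) \<partial>lborel)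
        = ennreal (\<bar>R\<bar> ^ CARD('n)) * (\<integral>\<^sup>+y. ennreal (kern \<alpha> (0 + R *\<^sub>R y) * min 1 ((norm (0 + R *\<^sub>R (y::real^'n)) / R) ^ 2)) \<partial>lborel)"
      by (rule nn_integral_lborel_affine) (use R in simp_all)
    also have "(\<integral>\<^sup>+y. ennreal (kern \<alpha> (0 + R *\<^sub>R y) * min 1 ((norm (0 + R *\<^sub>R (y::real^'n)) / R) ^ 2)) \<partial>lborel)
        = (\<integral>\<^sup>+y. ennreal (R powr - (real CARD('n) + \<alpha>)) * ennreal (min 1 (norm y ^ 2) * kern \<alpha> (y::real^'n)) \<partial>lborel)"
      using R by (intro nn_integral_cong) (simp add: kern_def powr_mult ennreal_mult'[symmetric] mult_ac)
    also have "\<dots> = ennreal (R powr - (real CARD('n) + \<alpha>)) * ennreal K"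
      unfolding K(2)[symmetric] by (rule nn_integral_cmult) measurable
    also have "ennreal (\<bar>R\<bar> ^ CARD('n)) * (ennreal (R powr - (real CARD('n) + \<alpha>)) * ennreal K)
        = ennreal (R ^ CARD('n) * R powr - (real CARD('n) + \<alpha>) * K)"
      using R K(1) by (simp add: ennreal_mult[symmetric] mult.assoc)
    also have "R ^ CARD('n) * R powr - (real CARD('n) + \<alpha>) = R powr - \<alpha>"
      unfolding powr_realpow[OF R, symmetric] powr_add[symmetric] by simp
    finally show ?thesis .
  qed
  with K(1) that show thesis by blast
qed

lemma abs_second_diff: "\<bar>a - (b + c) / 2\<bar> \<le> \<bar>a\<bar> + (1 / 2) * \<bar>b\<bar> + (1 / 2) * \<bar>c\<bar>" for a b c :: real
  using abs_triangle_ineq4[of a "(b + c) / 2"] abs_triangle_ineq[of b c] by simp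

lemma second_diff_pointwise:
  fixes \<phi> :: "real^'n \<Rightarrow> real"
  assumes \<phi>: "cinf_c \<phi>"
  obtains C where "0 \<le> C" "\<And>x y. \<bar>second_diff \<phi> y x\<bar> \<le> C * min 1 (norm y ^ 2)"
proof -
  obtain B where B: "0 \<le> B" "\<And>x. norm (\<phi> x) \<le> B" using cinf_c_bounded[OF \<phi>] by blast
  obtain C where C: "0 \<le> C" "\<And>x y. \<bar>\<phi> x - (\<phi> (x + y) + \<phi> (x - y)) / 2\<bar> \<le> C * norm y ^ 2"
    using cinf_c_second_difference[OF \<phi>] by blast
  have "\<bar>second_diff \<phi> y x\<bar> \<le> (2 * B + C) * min 1 (norm y ^ 2)" for x y
  proof -
    have 1: "\<bar>second_diff \<phi> y x\<bar> \<le> (2 * B) * 1"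
      using B(2)[of x] B(2)[of "x + y"] B(2)[of "x - y"]
        abs_second_diff[of "\<phi> x" "\<phi> (x + y)" "\<phi> (x - y)"]
      unfolding second_diff_def real_norm_def by linarith
    have 2: "\<bar>second_diff \<phi> y x\<bar> \<le> C * norm y ^ 2" using C(2)[of x y] by (simp add: second_diff_def)
    have 3: "0 \<le> 2 * B * norm y ^ 2" using B by simp
    show ?thesis
    proof (cases "norm y ^ 2 \<le> 1")
      case True
      then have "(2 * B + C) * min 1 (norm y ^ 2) = 2 * B * norm y ^ 2 + C * norm y ^ 2"
        by (simp add: algebra_simps)
      then show ?thesis using 2 3 by linarith
    next
      case False
      then show ?thesis using 1 C(1) by (simp add: min_def)
    qed
  qed
  moreover have "0 \<le> 2 * B + C" using B C by simp
  ultimately show thesis using that by blast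
qed

text \<open>For \<open>|y| \<le> 1\<close> the second difference is of size \<open>|y|\<^sup>2\<close> on a fixed ball; for larger \<open>y\<close> the triangle
inequality suffices.\<close>

lemma second_diff_L1:
  fixes \<phi> :: "real^'n \<Rightarrow> real"
  assumes \<phi>: "cinf_c \<phi>"
  obtains C where "0 \<le> C"
    "\<And>y. (\<integral>\<^sup>+x. ennreal \<bar>second_diff \<phi> y x\<bar> \<partial>lborel) \<le> ennreal (C * min 1 (norm y ^ 2))"
proof -
  obtain C where C: "0 \<le> C" "\<And>x y. \<bar>second_diff \<phi> y x\<bar> \<le> C * min 1 (norm y ^ 2)"
    using second_diff_pointwise[OF \<phi>] by blast
  obtain r where r: "\<And>x. r < norm x \<Longrightarrow> \<phi> x = 0" using \<phi> by (auto simp: cinf_c_def)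
  \<comment> \<open>for \<open>|y| \<le> 1\<close> the second difference is supported in the ball of radius \<open>S\<close>\<close>
  define S where "S = max 0 r + 1"
  define V where "V = unit_ball_vol (real CARD('n)) * S ^ CARD('n)"
  define N where "N = (\<integral>x. \<bar>\<phi> x\<bar> \<partial>lborel)"
  have V: "emeasure lborel (cball (0::real^'n) S) = ennreal V" "0 \<le> V"
    by (simp_all add: V_def S_def emeasure_cball)
  have N: "0 \<le> N" by (simp add: N_def)
  have Ii: "integrable lborel (\<lambda>x. \<bar>\<phi> x\<bar>)" using cinf_c_integrable[OF \<phi>] by simp
  have Is: "integrable lborel (\<lambda>x. \<bar>\<phi> (x + a)\<bar>)" "(\<integral>x. \<bar>\<phi> (x + a)\<bar> \<partial>lborel) = N" for a
    using integrable_lborel_shift[OF Ii, of a] integral_lborel_shift[of "\<lambda>x. \<bar>\<phi> x\<bar>" a] cinf_c_measurable[OF \<phi>]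
    by (simp_all add: N_def)
  have "(\<integral>\<^sup>+x. ennreal \<bar>second_diff \<phi> y x\<bar> \<partial>lborel) \<le> ennreal ((C * V + 2 * N) * min 1 (norm y ^ 2))" for y
  proof (cases "norm y \<le> 1")
    case True
    then have m: "min 1 (norm y ^ 2) = norm y ^ 2" by (simp add: power_le_one)
    have "(\<integral>\<^sup>+x. ennreal \<bar>second_diff \<phi> y x\<bar> \<partial>lborel)
        \<le> (\<integral>\<^sup>+x. ennreal (C * norm y ^ 2) * indicator (cball (0::real^'n) S) x \<partial>lborel)"
    proof (rule nn_integral_mono)
      fix x
      show "ennreal \<bar>second_diff \<phi> y x\<bar> \<le> ennreal (C * norm y ^ 2) * indicator (cball 0 S) x"
      proof (cases "norm x \<le> S")
        case True
        then show ?thesis using C(2)[of y x] m by (simp add: ennreal_leI)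
      next
        case False
        have "norm x - norm y \<le> norm (x + y)" "norm x - norm y \<le> norm (x - y)"
          using norm_triangle_ineq4[of "x + y" y] norm_triangle_ineq[of "x - y" y] by auto
        then have "\<phi> x = 0" "\<phi> (x + y) = 0" "\<phi> (x - y) = 0"
          using False \<open>norm y \<le> 1\<close> by (auto intro!: r simp: S_def)
        then show ?thesis by (simp add: second_diff_def)
      qed
    qed
    also have "\<dots> = ennreal (C * norm y ^ 2 * V)"
      using C V by (subst nn_integral_cmult_indicator) (auto simp: ennreal_mult[symmetric])
    also have "\<dots> \<le> ennreal ((C * V + 2 * N) * min 1 (norm y ^ 2))"
      unfolding m using N by (intro ennreal_leI) (simp add: algebra_simps)
    finally show ?thesis .
  next
    case False
    then have m: "min 1 (norm y ^ 2) = 1" by (simp add: one_le_power)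
    let ?b = "\<lambda>x. \<bar>\<phi> x\<bar> + (1 / 2) * \<bar>\<phi> (x + y)\<bar> + (1 / 2) * \<bar>\<phi> (x + - y)\<bar>"
    have bi: "integrable lborel ?b"
      by (intro Bochner_Integration.integrable_add integrable_mult_right Is Ii)
    have "(\<integral>\<^sup>+x. ennreal \<bar>second_diff \<phi> y x\<bar> \<partial>lborel) \<le> (\<integral>\<^sup>+x. ennreal (?b x) \<partial>lborel)"
      unfolding second_diff_def add_uminus_conv_diff
      by (intro nn_integral_mono ennreal_leI abs_second_diff)
    also have "\<dots> = ennreal (\<integral>x. ?b x \<partial>lborel)"
      by (rule nn_integral_eq_integral[OF bi]) simp
    also have "(\<integral>x. ?b x \<partial>lborel) = N + (1 / 2) * N + (1 / 2) * N"
      by (subst Bochner_Integration.integral_add Bochner_Integration.integral_add,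
        (intro Bochner_Integration.integrable_add integrable_mult_right Is Ii)+)+
        (simp only: integral_mult_right_zero Is(2) N_def)
    also have "ennreal (N + (1 / 2) * N + (1 / 2) * N) \<le> ennreal ((C * V + 2 * N) * min 1 (norm y ^ 2))"
      unfolding m using C V by (intro ennreal_leI) simp
    finally show ?thesis .
  qed
  moreover have "0 \<le> C * V + 2 * N" using C V N by simp
  ultimately show thesis using that by blast
qed

definition dilate :: "(real^'n \<Rightarrow> real) \<Rightarrow> real \<Rightarrow> real^'n \<Rightarrow> real" where
  "dilate \<phi> R x = \<phi> ((1 / R) *\<^sub>R x)"

lemma cinf_c_dilate: "cinf_c \<phi> \<Longrightarrow> 0 < R \<Longrightarrow> cinf_c (dilate \<phi> R)"
  unfolding dilate_def[abs_def] using cinf_c_affine[of \<phi> "1 / R" 0] by simp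

lemma second_diff_dilate:
  "second_diff (dilate \<phi> R) y x = second_diff \<phi> ((1 / R) *\<^sub>R y) ((1 / R) *\<^sub>R x)"
  by (simp add: second_diff_def dilate_def scaleR_add_right scaleR_diff_right)

text \<open>Interpolation between \<open>L\<^sup>\<infinity>\<close> and \<open>L\<^sup>p\<close> at the level \<open>\<mu>\<close>: the first term bounds small values of \<open>t\<close>, the second
one large values. The free parameter \<open>\<mu>\<close> takes the place of Hoelder's inequality below.\<close>

lemma powr_interpolate:
  assumes "0 \<le> (t::real)" "0 < \<mu>" "0 \<le> a" "a \<le> p"
  shows "t powr a \<le> \<mu> powr a + \<mu> powr (a - p) * t powr p"
proof (cases "t \<le> \<mu>")
  case True
  then have "t powr a \<le> \<mu> powr a" using assms by (intro powr_mono2) auto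
  then show ?thesis by (simp add: add_increasing2)
next
  case False
  then have t: "0 < t" using assms by simp
  have "t powr (a - p) \<le> \<mu> powr (a - p)" using False assms by (intro powr_mono2') auto
  then have "t powr (a - p) * t powr p \<le> \<mu> powr (a - p) * t powr p" by (rule mult_right_mono) simp
  moreover have "t powr (a - p) * t powr p = t powr a" by (simp add: powr_add[symmetric])
  ultimately show ?thesis by (simp add: add_increasing)
qed

text \<open>The error term of the localised energy identity, integrated against the kernel.\<close>

definition cutoff_error :: "real \<Rightarrow> (real^'n \<Rightarrow> real) \<Rightarrow> (real^'n \<Rightarrow> real) \<Rightarrow> ennreal" where
  "cutoff_error \<alpha> \<theta> \<phi> = (\<integral>\<^sup>+y. (\<integral>\<^sup>+x. ennreal (kern \<alpha> y * (\<theta> x ^ 2 * \<bar>second_diff \<phi> y x\<bar>)) \<partial>lborel) \<partial>lborel)"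

text \<open>At the level \<open>\<mu>\<close>, the square \<open>\<theta>\<^sup>2\<close> is at most \<open>\<mu>\<^sup>2\<close> plus a multiple of \<open>|\<theta>|\<^sup>p\<close>. The constant part meets the \<open>L\<^sup>1\<close> bound of the second
differences, which costs the volume \<open>R\<^sup>n\<close>; the other part meets their pointwise bound.\<close>

lemma cutoff_error_bound:
  fixes \<theta> \<phi> :: "real^'n \<Rightarrow> real"
  assumes \<alpha>: "0 < \<alpha>" "\<alpha> < 2" and \<phi>: "cinf_c \<phi>" and p: "2 < p" and \<theta>: "Lp p \<theta>"
  obtains C where "0 \<le> C"
    "\<And>R \<mu>. 0 < R \<Longrightarrow> 0 < \<mu> \<Longrightarrow> cutoff_error \<alpha> \<theta> (dilate \<phi> R)
      \<le> ennreal (C * (\<mu> powr 2 * R powr (real CARD('n) - \<alpha>) + \<mu> powr (2 - p) * R powr - \<alpha>))"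
proof -
  obtain K where K: "0 \<le> K"
    "\<And>R. 0 < R \<Longrightarrow> (\<integral>\<^sup>+y. ennreal (kern \<alpha> y * min 1 ((norm (y::real^'n) / R) ^ 2)) \<partial>lborel) = ennreal (R powr - \<alpha> * K)"
    using kern_scaled[OF \<alpha>] by blast
  obtain C1 where C1: "0 \<le> C1" "\<And>x y. \<bar>second_diff \<phi> y x\<bar> \<le> C1 * min 1 (norm y ^ 2)"
    using second_diff_pointwise[OF \<phi>] by blast
  obtain C2 where C2: "0 \<le> C2"
    "\<And>y. (\<integral>\<^sup>+x. ennreal \<bar>second_diff \<phi> y x\<bar> \<partial>lborel) \<le> ennreal (C2 * min 1 (norm y ^ 2))"
    using second_diff_L1[OF \<phi>] by blast
  have [measurable]: "\<theta> \<in> borel_measurable borel" "\<phi> \<in> borel_measurable borel"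
    using \<theta> cinf_c_measurable[OF \<phi>] by (auto simp: Lp_def)
  define M where "M = (\<integral>x. \<bar>\<theta> x\<bar> powr p \<partial>lborel)"
  have M: "0 \<le> M" "(\<integral>\<^sup>+x. ennreal (\<bar>\<theta> x\<bar> powr p) \<partial>lborel) = ennreal M"
    using \<theta> nn_integral_eq_integral[of lborel "\<lambda>x. \<bar>\<theta> x\<bar> powr p"] by (auto simp: M_def Lp_def)
  define C where "C = C2 * K + C1 * K * M"
  have "cutoff_error \<alpha> \<theta> (dilate \<phi> R)
      \<le> ennreal (C * (\<mu> powr 2 * R powr (real CARD('n) - \<alpha>) + \<mu> powr (2 - p) * R powr - \<alpha>))"
    if R: "0 < R" and \<mu>: "0 < \<mu>" for R \<mu>
  proof -
    let ?m = "\<lambda>y::real^'n. min 1 ((norm y / R) ^ 2)"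
    let ?sd = "\<lambda>y x. \<bar>second_diff (dilate \<phi> R) y x\<bar>"
    have n: "norm ((1 / R) *\<^sub>R y) = norm y / R" for y :: "real^'n" using R by simp
    have [measurable]: "second_diff (dilate \<phi> R) y \<in> borel_measurable borel" for y
      by (intro cinf_c_measurable cinf_c_second_diff cinf_c_dilate \<phi> R)
    have pw: "?sd y x \<le> C1 * ?m y" for x y
      using C1(2)[of "(1 / R) *\<^sub>R y"] unfolding second_diff_dilate n .
    have l1: "(\<integral>\<^sup>+x. ennreal (?sd y x) \<partial>lborel) \<le> ennreal (R ^ CARD('n) * C2 * ?m y)" for y
    proof -
      have "(\<integral>\<^sup>+x. ennreal (?sd y x) \<partial>lborel)
          = ennreal (\<bar>R\<bar> ^ CARD('n)) * (\<integral>\<^sup>+x. ennreal (?sd y (0 + R *\<^sub>R x)) \<partial>lborel)"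
        by (rule nn_integral_lborel_affine) (use R in simp_all)
      also have "(\<integral>\<^sup>+x. ennreal (?sd y (0 + R *\<^sub>R x)) \<partial>lborel) \<le> ennreal (C2 * ?m y)"
        using C2(2)[of "(1 / R) *\<^sub>R y"] R unfolding second_diff_dilate n by simp
      finally show ?thesis
        using R C2(1) by (simp add: ennreal_mult'[symmetric] mult_left_mono mult.assoc)
    qed
    have "cutoff_error \<alpha> \<theta> (dilate \<phi> R) \<le>
        (\<integral>\<^sup>+y. ennreal (\<mu> powr 2 * R ^ CARD('n) * C2 + \<mu> powr (2 - p) * C1 * M) * ennreal (kern \<alpha> y * ?m y) \<partial>lborel)"
      unfolding cutoff_error_def
    proof (rule nn_integral_mono)
      fix y
      have "(\<integral>\<^sup>+x. ennreal (kern \<alpha> y * (\<theta> x ^ 2 * ?sd y x)) \<partial>lborel)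
          \<le> (\<integral>\<^sup>+x. ennreal (kern \<alpha> y * \<mu> powr 2) * ennreal (?sd y x)
              + ennreal (kern \<alpha> y * \<mu> powr (2 - p) * C1 * ?m y) * ennreal (\<bar>\<theta> x\<bar> powr p) \<partial>lborel)"
      proof (rule nn_integral_mono)
        fix x
        have "\<theta> x ^ 2 = \<bar>\<theta> x\<bar> powr 2" by (cases "\<theta> x = 0") (auto simp: powr_realpow[of _ 2, simplified])
        also have "\<dots> \<le> \<mu> powr 2 + \<mu> powr (2 - p) * \<bar>\<theta> x\<bar> powr p"
          using \<mu> p by (intro powr_interpolate) auto
        finally have "\<theta> x ^ 2 * ?sd y x \<le> \<mu> powr 2 * ?sd y x + \<mu> powr (2 - p) * \<bar>\<theta> x\<bar> powr p * ?sd y x"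
          by (simp add: mult_right_mono distrib_right[symmetric])
        also have "\<mu> powr (2 - p) * \<bar>\<theta> x\<bar> powr p * ?sd y x \<le> \<mu> powr (2 - p) * \<bar>\<theta> x\<bar> powr p * (C1 * ?m y)"
          by (intro mult_left_mono pw) simp
        finally have "kern \<alpha> y * (\<theta> x ^ 2 * ?sd y x)
            \<le> kern \<alpha> y * (\<mu> powr 2 * ?sd y x + \<mu> powr (2 - p) * \<bar>\<theta> x\<bar> powr p * (C1 * ?m y))"
          by (intro mult_left_mono) auto
        also have "\<dots> = kern \<alpha> y * \<mu> powr 2 * ?sd y x + kern \<alpha> y * \<mu> powr (2 - p) * C1 * ?m y * \<bar>\<theta> x\<bar> powr p"
          by (simp only: algebra_simps)
        finally show "ennreal (kern \<alpha> y * (\<theta> x ^ 2 * ?sd y x)) \<le> ennreal (kern \<alpha> y * \<mu> powr 2) * ennreal (?sd y x)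
              + ennreal (kern \<alpha> y * \<mu> powr (2 - p) * C1 * ?m y) * ennreal (\<bar>\<theta> x\<bar> powr p)"
          using C1(1) by (simp add: ennreal_mult[symmetric] ennreal_plus[symmetric] ennreal_leI del: ennreal_plus)
      qed
      also have "\<dots> = ennreal (kern \<alpha> y * \<mu> powr 2) * (\<integral>\<^sup>+x. ennreal (?sd y x) \<partial>lborel)
            + ennreal (kern \<alpha> y * \<mu> powr (2 - p) * C1 * ?m y) * ennreal M"
        unfolding M(2)[symmetric] by (simp add: nn_integral_add nn_integral_cmult)
      also have "\<dots> \<le> ennreal (kern \<alpha> y * \<mu> powr 2) * ennreal (R ^ CARD('n) * C2 * ?m y)
            + ennreal (kern \<alpha> y * \<mu> powr (2 - p) * C1 * ?m y) * ennreal M"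
        by (intro add_right_mono mult_left_mono l1) simp
      also have "\<dots> = ennreal (kern \<alpha> y * \<mu> powr 2 * (R ^ CARD('n) * C2 * ?m y) + kern \<alpha> y * \<mu> powr (2 - p) * C1 * ?m y * M)"
        using R C1(1) C2(1) M(1) by (subst ennreal_plus) (simp_all add: ennreal_mult[symmetric])
      also have "kern \<alpha> y * \<mu> powr 2 * (R ^ CARD('n) * C2 * ?m y) + kern \<alpha> y * \<mu> powr (2 - p) * C1 * ?m y * M
          = (\<mu> powr 2 * R ^ CARD('n) * C2 + \<mu> powr (2 - p) * C1 * M) * (kern \<alpha> y * ?m y)"
        by (simp only: algebra_simps)
      finally show "(\<integral>\<^sup>+x. ennreal (kern \<alpha> y * (\<theta> x ^ 2 * ?sd y x)) \<partial>lborel)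
          \<le> ennreal (\<mu> powr 2 * R ^ CARD('n) * C2 + \<mu> powr (2 - p) * C1 * M) * ennreal (kern \<alpha> y * ?m y)"
        using R C1(1) C2(1) M(1) by (simp add: ennreal_mult[symmetric] del: ennreal_plus)
    qed
    also have "\<dots> = ennreal (\<mu> powr 2 * R ^ CARD('n) * C2 + \<mu> powr (2 - p) * C1 * M) * ennreal (R powr - \<alpha> * K)"
      unfolding K(2)[OF R, symmetric] by (rule nn_integral_cmult) measurable
    also have "\<dots> = ennreal ((\<mu> powr 2 * R ^ CARD('n) * C2 + \<mu> powr (2 - p) * C1 * M) * (R powr - \<alpha> * K))"
      using R C1(1) C2(1) M(1) K(1) by (simp add: ennreal_mult[symmetric] del: ennreal_plus)
    also have "\<dots> \<le> ennreal (C * (\<mu> powr 2 * R powr (real CARD('n) - \<alpha>) + \<mu> powr (2 - p) * R powr - \<alpha>))"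
    proof (rule ennreal_leI)
      have e: "R powr (real CARD('n) - \<alpha>) = R ^ CARD('n) * R powr - \<alpha>"
        using R by (simp add: powr_realpow[symmetric] powr_add[symmetric])
      have "0 \<le> C1 * K * M * (\<mu> powr 2 * (R ^ CARD('n) * R powr - \<alpha>))"
        "0 \<le> C2 * K * (\<mu> powr (2 - p) * R powr - \<alpha>)"
        using R C1(1) C2(1) M(1) K(1) by simp_all
      then show "(\<mu> powr 2 * R ^ CARD('n) * C2 + \<mu> powr (2 - p) * C1 * M) * (R powr - \<alpha> * K)
          \<le> C * (\<mu> powr 2 * R powr (real CARD('n) - \<alpha>) + \<mu> powr (2 - p) * R powr - \<alpha>)"
        unfolding e C_def by (simp add: algebra_simps)
    qed
    finally show ?thesis .
  qed
  moreover have "0 \<le> C" using C1(1) C2(1) M(1) K(1) by (simp add: C_def)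
  ultimately show thesis using that by blast
qed

lemma powr_neg_tendsto_0: "a < 0 \<Longrightarrow> (\<lambda>m. real (Suc m) powr a) \<longlonglongrightarrow> 0"
  using tendsto_neg_powr[of a real sequentially] filterlim_real_sequentially by (intro LIMSEQ_Suc) auto

text \<open>Taking \<open>\<mu> = R\<close> to the power \<open>-b\<close> makes both terms decay when \<open>(n - \<alpha>)/2 < b < \<alpha>/(p - 2)\<close>. Such \<open>b\<close> exists
exactly when \<open>p < 2n/(n - \<alpha>)\<close>, that is, below the critical Sobolev exponent.\<close>

lemma cutoff_error_tendsto:
  fixes \<theta> \<phi> :: "real^'n \<Rightarrow> real"
  assumes \<alpha>: "0 < \<alpha>" "\<alpha> < 2" "\<alpha> < real CARD('n)" and \<phi>: "cinf_c \<phi>"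
    and p: "2 < p" "(real CARD('n) - \<alpha>) * (p - 2) < 2 * \<alpha>" and \<theta>: "Lp p \<theta>"
  obtains e where "e \<longlonglongrightarrow> 0" "\<And>m. 0 \<le> e m"
    "\<And>m. cutoff_error \<alpha> \<theta> (dilate \<phi> (real (Suc m))) \<le> ennreal (e m)"
proof -
  obtain C where C: "0 \<le> C"
    "\<And>R \<mu>. 0 < R \<Longrightarrow> 0 < \<mu> \<Longrightarrow> cutoff_error \<alpha> \<theta> (dilate \<phi> R)
      \<le> ennreal (C * (\<mu> powr 2 * R powr (real CARD('n) - \<alpha>) + \<mu> powr (2 - p) * R powr - \<alpha>))"
    using cutoff_error_bound[OF \<alpha>(1,2) \<phi> p(1) \<theta>] by blast
  have "(real CARD('n) - \<alpha>) / 2 < \<alpha> / (p - 2)" using p by (simp add: field_simps)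
  then obtain b where b: "(real CARD('n) - \<alpha>) / 2 < b" "b < \<alpha> / (p - 2)" using dense by blast
  define e where "e m = C * (real (Suc m) powr (- (2 * b) + (real CARD('n) - \<alpha>)) + real (Suc m) powr (b * (p - 2) - \<alpha>))" for m
  have "b * (p - 2) - \<alpha> < 0" using b(2) p(1) by (simp add: field_simps)
  moreover have "- (2 * b) + (real CARD('n) - \<alpha>) < 0" using b(1) by simp
  ultimately have "e \<longlonglongrightarrow> C * (0 + 0)"
    unfolding e_def by (intro tendsto_intros powr_neg_tendsto_0)
  moreover have "0 \<le> e m" for m unfolding e_def using C(1) by simp
  moreover have "cutoff_error \<alpha> \<theta> (dilate \<phi> (real (Suc m))) \<le> ennreal (e m)" for m
  proof -
    have "e m = C * ((real (Suc m) powr - b) powr 2 * real (Suc m) powr (real CARD('n) - \<alpha>)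
        + (real (Suc m) powr - b) powr (2 - p) * real (Suc m) powr - \<alpha>)"
      unfolding e_def powr_powr powr_add[symmetric] by (simp add: algebra_simps)
    then show ?thesis using C(2)[of "real (Suc m)" "real (Suc m) powr - b"] by simp
  qed
  ultimately show thesis using that by simp
qed

definition shell :: "real \<Rightarrow> (real^'n) set" where
  "shell R = {x. R \<le> norm x \<and> norm x \<le> 2 * R}"

lemma shell_measurable [measurable]: "shell R \<in> sets borel"
  unfolding shell_def by measurable

text \<open>Interpolation at the level \<open>\<mu> R\<close> to the power \<open>-(n-1)/3\<close>, chosen so that the volume of the shell
cancels against \<open>1/R\<close>. The remaining power of \<open>R\<close> is nonpositive precisely when \<open>p \<le> 3n/(n-1)\<close>.\<close>

lemma shell_cube_bound:
  fixes h :: "real^'n \<Rightarrow> 'b::{second_countable_topology, real_normed_vector}"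
  assumes h: "Lp p h" and p: "3 \<le> p" "(real CARD('n) - 1) * (p - 3) \<le> 3"
    and R: "1 \<le> R" and \<mu>: "0 < \<mu>"
  shows "integrable lborel (\<lambda>x. indicator (shell R) x * norm (h x) ^ 3)"
    and "(\<integral>x. indicator (shell R) x * norm (h x) ^ 3 \<partial>lborel) / R
      \<le> \<mu> ^ 3 * (unit_ball_vol (real CARD('n)) * 2 ^ CARD('n))
        + \<mu> powr (3 - p) * (\<integral>x. indicator {x. R \<le> norm x} x * norm (h x) powr p \<partial>lborel)"
proof -
  have [measurable]: "h \<in> borel_measurable borel" and hi: "integrable lborel (\<lambda>x. norm (h x) powr p)"
    using h by (auto simp: Lp_def)
  define n where "n = real CARD('n)"
  define V where "V = unit_ball_vol n * 2 ^ CARD('n)"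
  define t where "t = \<mu> * R powr (- (n - 1) / 3)"
  have t: "0 < t" using R \<mu> by (simp add: t_def)
  let ?T = "\<lambda>x. indicator {x. R \<le> norm x} x * norm (h x) powr p"
  have Ti: "integrable lborel ?T"
    by (rule Bochner_Integration.integrable_bound[OF hi]) (auto simp: indicator_def)
  have ball: "emeasure lborel (cball (0::real^'n) (2 * R)) = ennreal (V * R ^ CARD('n))"
    using R by (simp add: emeasure_cball V_def n_def power_mult_distrib mult_ac)
  have V: "0 \<le> V * R ^ CARD('n)" using R by (simp add: V_def n_def)
  have Bi: "integrable lborel (indicat_real (cball (0::real^'n) (2 * R)))"
    by (rule integrable_real_indicator) (simp_all add: ball)
  have Bv: "(\<integral>x. indicat_real (cball (0::real^'n) (2 * R)) x \<partial>lborel) = V * R ^ CARD('n)"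
    using V by (simp add: measure_def ball)
  have bi: "integrable lborel (\<lambda>x. t powr 3 * indicat_real (cball 0 (2 * R)) x + t powr (3 - p) * ?T x)"
    by (intro Bochner_Integration.integrable_add integrable_mult_right Ti Bi)
  have le: "indicator (shell R) x * norm (h x) ^ 3 \<le> t powr 3 * indicat_real (cball 0 (2 * R)) x + t powr (3 - p) * ?T x" for x
  proof (cases "x \<in> shell R")
    case True
    have "norm (h x) ^ 3 = norm (h x) powr 3"
      by (cases "h x = 0") (auto simp: powr_realpow[of _ 3, simplified])
    also have "\<dots> \<le> t powr 3 + t powr (3 - p) * norm (h x) powr p"
      using t p by (intro powr_interpolate) auto
    finally show ?thesis using True by (simp add: shell_def)
  qed simp
  show int: "integrable lborel (\<lambda>x. indicator (shell R) x * norm (h x) ^ 3)"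
    by (rule Bochner_Integration.integrable_bound[OF bi], measurable)
      (use le in \<open>auto intro!: AE_I2 order_trans[OF le]\<close>)
  have "(\<integral>x. indicator (shell R) x * norm (h x) ^ 3 \<partial>lborel)
      \<le> (\<integral>x. t powr 3 * indicat_real (cball 0 (2 * R)) x + t powr (3 - p) * ?T x \<partial>lborel)"
    by (intro integral_mono int bi le)
  also have "\<dots> = t powr 3 * (V * R ^ CARD('n)) + t powr (3 - p) * (\<integral>x. ?T x \<partial>lborel)"
    by (subst Bochner_Integration.integral_add)
      (auto intro!: Ti Bi simp: Bv simp del: Bochner_Integration.integral_indicator)
  finally have "(\<integral>x. indicator (shell R) x * norm (h x) ^ 3 \<partial>lborel) / R
      \<le> (t powr 3 * (V * R ^ CARD('n)) + t powr (3 - p) * (\<integral>x. ?T x \<partial>lborel)) / R"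
    using R by (intro divide_right_mono) auto
  also have "\<dots> = \<mu> ^ 3 * V + \<mu> powr (3 - p) * R powr ((n - 1) * (p - 3) / 3 - 1) * (\<integral>x. ?T x \<partial>lborel)"
  proof -
    have R0: "0 < R" using R by simp
    have inv: "R powr - 1 = inverse R" using powr_neg_one[OF R0] by (simp add: inverse_eq_divide)
    have t3: "t powr a = \<mu> powr a * R powr (- (n - 1) / 3 * a)" for a
      using R0 \<mu> unfolding t_def by (simp only: powr_mult powr_powr)
    have Rn: "R ^ CARD('n) = R powr n" using powr_realpow[OF R0, of "CARD('n)"] by (simp add: n_def)
    have "t powr 3 * R ^ CARD('n) / R = \<mu> powr 3 * (R powr (- (n - 1)) * R powr n * R powr - 1)"
    proof -
      have "- (n - 1) / 3 * 3 = - (n - 1)" by simp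
      then show ?thesis unfolding t3 Rn inv divide_inverse[of _ R] by (simp only: mult.assoc)
    qed
    also have "\<dots> = \<mu> ^ 3"
    proof -
      have "R powr (- (n - 1)) * R powr n * R powr - 1 = R powr 0"
        unfolding powr_add[symmetric] by simp
      moreover have "\<mu> powr 3 = \<mu> ^ 3" using powr_realpow[OF \<mu>, of 3] by simp
      ultimately show ?thesis using R by simp
    qed
    finally have 1: "t powr 3 * R ^ CARD('n) / R = \<mu> ^ 3" .
    have "t powr (3 - p) / R = \<mu> powr (3 - p) * (R powr (- (n - 1) / 3 * (3 - p)) * R powr - 1)"
      unfolding t3 inv divide_inverse[of _ R] by (simp only: mult.assoc)
    also have "\<dots> = \<mu> powr (3 - p) * R powr ((n - 1) * (p - 3) / 3 - 1)"
      unfolding powr_add[symmetric] by (simp add: field_simps)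
    finally have 2: "t powr (3 - p) / R = \<mu> powr (3 - p) * R powr ((n - 1) * (p - 3) / 3 - 1)" .
    show ?thesis unfolding 1[symmetric] 2[symmetric] by (simp add: add_divide_distrib mult_ac)
  qed
  also have "\<dots> \<le> \<mu> ^ 3 * V + \<mu> powr (3 - p) * 1 * (\<integral>x. ?T x \<partial>lborel)"
  proof (intro add_left_mono mult_right_mono mult_left_mono)
    have "R powr ((n - 1) * (p - 3) / 3 - 1) \<le> R powr 0"
      using R p by (intro powr_mono) (auto simp: n_def)
    then show "R powr ((n - 1) * (p - 3) / 3 - 1) \<le> 1" using R by simp
  qed auto
  finally show "(\<integral>x. indicator (shell R) x * norm (h x) ^ 3 \<partial>lborel) / R
      \<le> \<mu> ^ 3 * (unit_ball_vol (real CARD('n)) * 2 ^ CARD('n))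
        + \<mu> powr (3 - p) * (\<integral>x. ?T x \<partial>lborel)"
    by (simp add: V_def n_def)
qed

text \<open>At the end point \<open>p = 3n/(n-1)\<close> there is no power of \<open>R\<close> to spare. Smallness comes from \<open>\<mu>\<close> in the
first term and, once \<open>\<mu>\<close> is fixed, from the tail of a convergent integral in the second.\<close>

lemma shell_cube_tendsto:
  fixes h :: "real^'n \<Rightarrow> 'b::{second_countable_topology, real_normed_vector}"
  assumes h: "Lp p h" and p: "3 \<le> p" "(real CARD('n) - 1) * (p - 3) \<le> 3"
  shows "(\<lambda>m. (\<integral>x. indicator (shell (real (Suc m))) x * norm (h x) ^ 3 \<partial>lborel) / real (Suc m)) \<longlonglongrightarrow> 0"
    (is "?a \<longlonglongrightarrow> 0")
proof -
  have [measurable]: "h \<in> borel_measurable borel" and hi: "integrable lborel (\<lambda>x. norm (h x) powr p)"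
    using h by (auto simp: Lp_def)
  define W where "W = unit_ball_vol (real CARD('n)) * 2 ^ CARD('n)"
  have W: "0 \<le> W" by (simp add: W_def)
  define T where "T m = (\<integral>x. indicator {x. real (Suc m) \<le> norm x} x * norm (h x) powr p \<partial>lborel)" for m
  have "T \<longlonglongrightarrow> (\<integral>x. 0 \<partial>(lborel :: (real^'n) measure))"
    unfolding T_def
  proof (rule integral_dominated_convergence[where w = "\<lambda>x. norm (h x) powr p"])
    show "AE x in lborel. (\<lambda>m. indicator {x. real (Suc m) \<le> norm x} x * norm (h x) powr p) \<longlonglongrightarrow> 0"
    proof (rule AE_I2)
      fix x :: "real^'n"
      obtain N where N: "norm x < real N" using reals_Archimedean2 by blast
      have "\<forall>\<^sub>F m in sequentially. indicator {x. real (Suc m) \<le> norm x} x * norm (h x) powr p = 0"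
        by (rule eventually_sequentiallyI[of N]) (use N in \<open>auto simp: indicator_def\<close>)
      then show "(\<lambda>m. indicator {x. real (Suc m) \<le> norm x} x * norm (h x) powr p) \<longlonglongrightarrow> 0"
        by (rule tendsto_eventually)
    qed
  qed (auto simp: hi indicator_def)
  then have T: "T \<longlonglongrightarrow> 0" by simp
  show ?thesis
  proof (rule LIMSEQ_I)
    fix r :: real assume r: "0 < r"
    have "((\<lambda>\<mu>. \<mu> ^ 3 * W) \<longlongrightarrow> 0 ^ 3 * W) (at_right 0)" by (intro tendsto_intros)
    then have "\<forall>\<^sub>F \<mu> in at_right 0. \<mu> ^ 3 * W < r / 2"
      by (rule order_tendstoD(2)) (use r in simp)
    then obtain \<mu> where \<mu>: "0 < \<mu>" "\<mu> ^ 3 * W < r / 2"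
      using eventually_happens[OF eventually_conj[OF _ eventually_at_right_less[of "0::real"]]]
      by (metis trivial_limit_at_right_real)
    have "(\<lambda>m. \<mu> powr (3 - p) * T m) \<longlonglongrightarrow> \<mu> powr (3 - p) * 0" by (intro tendsto_intros T)
    then have "\<forall>\<^sub>F m in sequentially. \<mu> powr (3 - p) * T m < r / 2"
      by (rule order_tendstoD(2)) (use r in simp)
    then obtain N where N: "\<And>m. N \<le> m \<Longrightarrow> \<mu> powr (3 - p) * T m < r / 2"
      by (auto simp: eventually_sequentially)
    have "norm (?a m - 0) < r" if "N \<le> m" for m
    proof -
      have "?a m \<le> \<mu> ^ 3 * W + \<mu> powr (3 - p) * T m"
        unfolding W_def T_def by (rule shell_cube_bound(2)[OF h p _ \<mu>(1)]) simp
      moreover have "0 \<le> ?a m" by simp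
      ultimately show ?thesis using N[OF that] \<mu>(2) by simp
    qed
    then show "\<exists>no. \<forall>m\<ge>no. norm (?a m - 0) < r" by blast
  qed
qed


section \<open>Testing the equation with the localised solution\<close>

lemma smooth_grad_continuous: "smooth f \<Longrightarrow> continuous_on UNIV (grad f)"
  unfolding grad_def[abs_def]
  by (intro continuous_on_vec_lambda smooth_continuous_on smooth_partial_deriv)

lemma grad_mult:
  assumes "smooth f" "smooth g"
  shows "grad (\<lambda>x. f x * g x) x = f x *\<^sub>R grad g x + g x *\<^sub>R grad f x"
  by (simp add: grad_def vec_eq_iff partial_deriv_mult[OF assms] mult.commute)

lemma cinf_c_grad_zero:
  assumes "cinf_c f"
  shows "\<exists>r. \<forall>x. r < norm x \<longrightarrow> grad f x = 0"
proof -
  have "\<exists>r. \<forall>x. r < norm x \<longrightarrow> partial_deriv i f x = 0" for i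
    using cinf_c_partial_deriv[OF assms, of i] by (simp add: cinf_c_def)
  then obtain r where r: "\<And>i x. r i < norm x \<Longrightarrow> partial_deriv i f x = 0" by metis
  have "grad f x = 0" if "Max (range r) < norm x" for x
    using that by (simp add: grad_def vec_eq_iff r)
  then show ?thesis by blast
qed

text \<open>Functions in \<open>L\<^sup>p\<close> with \<open>p \<ge> 1\<close> are locally integrable, since \<open>t \<le> 1 + t\<^sup>p\<close>.\<close>

lemma Lp_pairing_integrable:
  fixes F G :: "real^'n \<Rightarrow> real^'n"
  assumes F: "Lp p F" "1 \<le> p" and G: "continuous_on UNIV G" "\<And>x. r < norm x \<Longrightarrow> G x = 0"
  shows "integrable lborel (\<lambda>x. F x \<bullet> G x)"
proof -
  have [measurable]: "F \<in> borel_measurable borel" and Fi: "integrable lborel (\<lambda>x. norm (F x) powr p)"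
    using F by (auto simp: Lp_def)
  have [measurable]: "G \<in> borel_measurable borel" by (rule borel_measurable_continuous_onI[OF G(1)])
  have "compact (G ` cball 0 r)"
    by (intro compact_continuous_image continuous_on_subset[OF G(1)]) auto
  then obtain B where B: "0 < B" "\<And>y. y \<in> G ` cball 0 r \<Longrightarrow> norm y \<le> B"
    using compact_imp_bounded[of "G ` cball 0 r"] unfolding bounded_pos by auto
  have GB: "norm (G x) \<le> B" for x
    using B G(2)[of x] by (cases "r < norm x") auto
  have Gi: "integrable lborel (\<lambda>x. norm (G x))"
    by (rule compact_support_integrable[of _ r]) (auto intro!: continuous_intros G)
  have "integrable lborel (\<lambda>x. norm (G x) + B * norm (F x) powr p)"
    using Fi Gi by simp
  then show ?thesis
  proof (rule Bochner_Integration.integrable_bound, measurable, intro AE_I2)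
    fix x
    have "norm (F x) = norm (F x) powr 1" by (cases "F x = 0") auto
    also have "\<dots> \<le> 1 powr 1 + 1 powr (1 - p) * norm (F x) powr p"
      using F by (intro powr_interpolate) auto
    finally have "norm (F x) * norm (G x) \<le> (1 + norm (F x) powr p) * norm (G x)"
      by (intro mult_right_mono) auto
    also have "\<dots> \<le> norm (G x) + B * norm (F x) powr p"
      using mult_left_mono[OF GB, of "norm (F x) powr p" x] by (simp add: algebra_simps)
    finally have "\<bar>F x \<bullet> G x\<bar> \<le> norm (G x) + B * norm (F x) powr p"
      using Cauchy_Schwarz_ineq2[of "F x" "G x"] by linarith
    then show "norm (F x \<bullet> G x) \<le> norm (norm (G x) + B * norm (F x) powr p)"
      by (metis abs_ge_self order_trans real_norm_def)
  qed
qed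

text \<open>With \<open>\<psi> = \<theta>\<phi>\<close> one has \<open>\<nabla>(\<theta>\<psi>) = 2\<theta>\<nabla>\<psi> - \<theta>\<^sup>2\<nabla>\<phi>\<close>. Testing \<open>div A = 0\<close> with \<open>\<theta>\<psi>\<close> thus expresses the
transport term \<open>\<integral> \<theta> A \<bullet> \<nabla>\<psi>\<close> by an integral without derivatives of \<open>\<theta>\<close>.\<close>

lemma weak_solution_tested:
  fixes \<theta> \<phi> :: "real^'n \<Rightarrow> real" and A :: "'n \<Rightarrow> (real^'n \<Rightarrow> real) \<Rightarrow> real^'n \<Rightarrow> real"
  assumes sol: "weak_solution \<alpha> A \<theta>" and adm: "admissible A" and \<theta>: "smooth \<theta>" "Lp p \<theta>" "1 < p"
    and \<phi>: "cinf_c \<phi>"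
  shows "frac_laplacian_distr \<alpha> \<theta> (\<lambda>x. \<theta> x * \<phi> x)
    = of_real ((\<integral>x. \<theta> x ^ 2 * (field_of A \<theta> x \<bullet> grad \<phi> x) \<partial>lborel) / 2)"
proof -
  let ?A = "field_of A \<theta>"
  let ?\<psi> = "\<lambda>x. \<theta> x * \<phi> x"
  have A: "Lp p ?A" using adm \<theta>(2,3) by (auto simp: admissible_def)
  have \<psi>: "cinf_c ?\<psi>" by (rule cinf_c_mult[OF \<theta>(1) \<phi>])
  have \<theta>\<psi>: "cinf_c (\<lambda>x. \<theta> x * ?\<psi> x)" by (rule cinf_c_mult[OF \<theta>(1) \<psi>])
  note c = smooth_continuous_on[OF \<theta>(1), of UNIV]
  obtain r where r: "\<And>x. r < norm x \<Longrightarrow> grad \<phi> x = 0" using cinf_c_grad_zero[OF \<phi>] by blast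
  obtain s where s: "\<And>x. s < norm x \<Longrightarrow> grad ?\<psi> x = 0" using cinf_c_grad_zero[OF \<psi>] by blast
  have I1: "integrable lborel (\<lambda>x. ?A x \<bullet> (\<theta> x *\<^sub>R grad ?\<psi> x))"
    by (rule Lp_pairing_integrable[OF A, of _ s])
      (use \<theta>(3) s in \<open>auto intro!: continuous_intros c smooth_grad_continuous cinf_c_smooth[OF \<psi>]\<close>)
  have I2: "integrable lborel (\<lambda>x. ?A x \<bullet> (\<theta> x ^ 2 *\<^sub>R grad \<phi> x))"
    by (rule Lp_pairing_integrable[OF A, of _ r])
      (use \<theta>(3) r in \<open>auto intro!: continuous_intros c smooth_grad_continuous cinf_c_smooth[OF \<phi>]\<close>)
  have "0 = div_distr ?A (\<lambda>x. \<theta> x * ?\<psi> x)"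
    using adm \<theta>(2,3) \<theta>\<psi> unfolding admissible_def test_function_iff by metis
  also have "\<dots> = - (\<integral>x. 2 * (?A x \<bullet> (\<theta> x *\<^sub>R grad ?\<psi> x)) - ?A x \<bullet> (\<theta> x ^ 2 *\<^sub>R grad \<phi> x) \<partial>lborel)"
  proof -
    have "?A x \<bullet> grad (\<lambda>x. \<theta> x * ?\<psi> x) x
        = 2 * (?A x \<bullet> (\<theta> x *\<^sub>R grad ?\<psi> x)) - ?A x \<bullet> (\<theta> x ^ 2 *\<^sub>R grad \<phi> x)" for x
      unfolding grad_mult[OF \<theta>(1) cinf_c_smooth[OF \<psi>]] grad_mult[OF \<theta>(1) cinf_c_smooth[OF \<phi>]]
      by (simp only: inner_add_right inner_scaleR_right) (simp add: algebra_simps power2_eq_square)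
    then show ?thesis unfolding div_distr_def by simp
  qed
  also have "\<dots> = - (2 * (\<integral>x. ?A x \<bullet> (\<theta> x *\<^sub>R grad ?\<psi> x) \<partial>lborel) - (\<integral>x. ?A x \<bullet> (\<theta> x ^ 2 *\<^sub>R grad \<phi> x) \<partial>lborel))"
    using I1 I2 by (subst Bochner_Integration.integral_diff) auto
  finally have eq: "(\<integral>x. ?A x \<bullet> (\<theta> x *\<^sub>R grad ?\<psi> x) \<partial>lborel) = (\<integral>x. ?A x \<bullet> (\<theta> x ^ 2 *\<^sub>R grad \<phi> x) \<partial>lborel) / 2"
    by simp
  have "frac_laplacian_distr \<alpha> \<theta> ?\<psi> = - of_real (div_distr (\<lambda>x. \<theta> x *\<^sub>R ?A x) ?\<psi>)"
    using sol \<psi> unfolding weak_solution_def test_function_iff by (simp add: eq_neg_iff_add_eq_0)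
  also have "div_distr (\<lambda>x. \<theta> x *\<^sub>R ?A x) ?\<psi> = - (\<integral>x. ?A x \<bullet> (\<theta> x *\<^sub>R grad ?\<psi> x) \<partial>lborel)"
    by (simp add: div_distr_def)
  finally show ?thesis unfolding eq by simp
qed

lemma grad_dilate:
  assumes "smooth \<phi>"
  shows "grad (dilate \<phi> R) x = (1 / R) *\<^sub>R grad \<phi> ((1 / R) *\<^sub>R x)"
  using partial_deriv_affine[OF assms, of _ "1 / R" 0]
  by (simp add: grad_def dilate_def[abs_def] vec_eq_iff)

text \<open>The gradient of the dilated cutoff is bounded by a constant over \<open>R\<close> and supported in a shell, where
\<open>\<theta>\<^sup>2 |F| \<le> |\<theta>|\<^sup>3 + |F|\<^sup>3\<close>.\<close>

lemma flux_tendsto: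
  fixes \<theta> \<phi> :: "real^'n \<Rightarrow> real" and F :: "real^'n \<Rightarrow> real^'n"
  assumes \<theta>: "Lp p \<theta>" and F: "Lp p F" and p: "3 \<le> p" "(real CARD('n) - 1) * (p - 3) \<le> 3"
    and \<phi>: "cinf_c \<phi>" "\<And>x. norm x \<le> 1 \<Longrightarrow> \<phi> x = 1" "\<And>x. 2 < norm x \<Longrightarrow> \<phi> x = 0"
  shows "(\<lambda>m. \<integral>x. \<theta> x ^ 2 * (F x \<bullet> grad (dilate \<phi> (real (Suc m))) x) \<partial>lborel) \<longlonglongrightarrow> 0"
proof -
  have [measurable]: "\<theta> \<in> borel_measurable borel" "F \<in> borel_measurable borel"
    using \<theta> F by (auto simp: Lp_def)
  have "\<exists>B\<ge>0. \<forall>x. norm (partial_deriv i \<phi> x) \<le> B" for i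
    using cinf_c_bounded[OF cinf_c_partial_deriv[OF \<phi>(1)]] by metis
  then obtain b where b: "\<And>i. 0 \<le> b i" "\<And>i x. norm (partial_deriv i \<phi> x) \<le> b i" by metis
  define B where "B = (\<Sum>i\<in>UNIV. b i)"
  have B: "0 \<le> B" unfolding B_def by (intro sum_nonneg b)
  have gB: "norm (grad \<phi> x) \<le> B" for x
    using order_trans[OF norm_le_l1_cart[of "grad \<phi> x"] sum_mono[of UNIV _ b]] b(2)
    by (simp add: grad_def B_def)
  have g0: "grad \<phi> x = 0" if "norm x < 1 \<or> 2 < norm x" for x
  proof -
    have "(\<phi> has_derivative (\<lambda>v. 0)) (at x)"
    proof (cases "norm x < 1")
      case True
      show ?thesis
      proof (rule has_derivative_transform_within_open[OF has_derivative_const open_ball])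
        show "x \<in> ball 0 1" using True by simp
        show "1 = \<phi> y" if "y \<in> ball 0 1" for y using \<phi>(2)[of y] that by simp
      qed
    next
      case False
      have "open {x::real^'n. 2 < norm x}" by (intro open_Collect_less continuous_intros)
      show ?thesis
      proof (rule has_derivative_transform_within_open[OF has_derivative_const \<open>open _\<close>])
        show "x \<in> {x. 2 < norm x}" using False that by simp
        show "0 = \<phi> y" if "y \<in> {x. 2 < norm x}" for y using \<phi>(3)[of y] that by simp
      qed
    qed
    from partial_deriv_eq[OF this] show ?thesis by (simp add: grad_def vec_eq_iff)
  qed
  let ?R = "\<lambda>m. real (Suc m)"
  let ?s = "\<lambda>m x. indicat_real (shell (?R m)) x"
  let ?a = "\<lambda>m. B * ((\<integral>x. ?s m x * norm (\<theta> x) ^ 3 \<partial>lborel) / ?R m + (\<integral>x. ?s m x * norm (F x) ^ 3 \<partial>lborel) / ?R m)"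
  have bound: "norm (\<integral>x. \<theta> x ^ 2 * (F x \<bullet> grad (dilate \<phi> (?R m)) x) \<partial>lborel) \<le> ?a m" for m
  proof -
    have i1: "integrable lborel (\<lambda>x. ?s m x * norm (\<theta> x) ^ 3)"
      by (rule shell_cube_bound(1)[OF \<theta> p, of _ 1]) auto
    have i2: "integrable lborel (\<lambda>x. ?s m x * norm (F x) ^ 3)"
      by (rule shell_cube_bound(1)[OF F p, of _ 1]) auto
    have [measurable]: "grad (dilate \<phi> (?R m)) \<in> borel_measurable borel"
      by (intro borel_measurable_continuous_onI smooth_grad_continuous cinf_c_smooth cinf_c_dilate \<phi>) simp
    let ?b = "\<lambda>x. B / ?R m * (?s m x * norm (\<theta> x) ^ 3 + ?s m x * norm (F x) ^ 3)"
    have le: "norm (\<theta> x ^ 2 * (F x \<bullet> grad (dilate \<phi> (?R m)) x)) \<le> ?b x" for x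
    proof (cases "x \<in> shell (?R m)")
      case False
      then have "grad \<phi> ((1 / ?R m) *\<^sub>R x) = 0"
        by (intro g0) (auto simp: shell_def field_simps)
      then show ?thesis using False by (simp add: grad_dilate[OF cinf_c_smooth[OF \<phi>(1)]])
    next
      case True
      have cube: "a ^ 2 * c \<le> a ^ 3 + c ^ 3" if "0 \<le> a" "0 \<le> c" for a c :: real
      proof (cases "a \<le> c")
        case True
        then have "a ^ 2 * c \<le> c ^ 2 * c" using that by (intro mult_right_mono power_mono) auto
        then show ?thesis using that by (simp add: power2_eq_square power3_eq_cube add_increasing)
      next
        case False
        then have "a ^ 2 * c \<le> a ^ 2 * a" using that by (intro mult_left_mono) auto
        then show ?thesis using that by (simp add: power2_eq_square power3_eq_cube add_increasing2)
      qed
      have "norm (grad (dilate \<phi> (?R m)) x) \<le> B / ?R m"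
        using gB[of "(1 / ?R m) *\<^sub>R x"] by (simp add: grad_dilate[OF cinf_c_smooth[OF \<phi>(1)]] divide_right_mono)
      then have "\<bar>F x \<bullet> grad (dilate \<phi> (?R m)) x\<bar> \<le> norm (F x) * (B / ?R m)"
        using Cauchy_Schwarz_ineq2[of "F x" "grad (dilate \<phi> (?R m)) x"]
        by (meson mult_left_mono norm_ge_zero order_trans)
      then have "norm (\<theta> x ^ 2 * (F x \<bullet> grad (dilate \<phi> (?R m)) x)) \<le> norm (\<theta> x) ^ 2 * (norm (F x) * (B / ?R m))"
        unfolding real_norm_def abs_mult power_abs by (intro mult_left_mono) auto
      also have "\<dots> = B / ?R m * (norm (\<theta> x) ^ 2 * norm (F x))" by (simp only: mult_ac)
      also have "\<dots> \<le> B / ?R m * (norm (\<theta> x) ^ 3 + norm (F x) ^ 3)"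
        using B by (intro mult_left_mono cube) auto
      finally show ?thesis using True by simp
    qed
    have bi: "integrable lborel ?b" using i1 i2 by simp
    have "norm (\<integral>x. \<theta> x ^ 2 * (F x \<bullet> grad (dilate \<phi> (?R m)) x) \<partial>lborel) \<le> (\<integral>x. ?b x \<partial>lborel)"
      by (rule integral_norm_bound[THEN order_trans], rule integral_mono_AE'[OF bi])
        (intro AE_I2 le order_trans[OF norm_ge_zero le])+
    also have "\<dots> = ?a m"
      unfolding integral_mult_right_zero Bochner_Integration.integral_add[OF i1 i2]
      by (simp add: add_divide_distrib[symmetric])
    finally show ?thesis .
  qed
  have "?a \<longlonglongrightarrow> B * (0 + 0)"
    by (intro tendsto_intros shell_cube_tendsto[OF \<theta> p] shell_cube_tendsto[OF F p])
  then have "?a \<longlonglongrightarrow> 0" by simp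
  then show ?thesis
    by (rule Lim_null_comparison[rotated]) (intro always_eventually allI bound)
qed

text \<open>Up to constant factors, the localised energy is the difference of the fractional Laplacian, tested
with \<open>\<theta>\<phi>\<close>, and the cutoff error; each of the two is integrable in \<open>y\<close>, so the energy is finite and bounded by their sizes.\<close>

lemma energy_bound:
  fixes \<theta> \<phi> :: "real^'n \<Rightarrow> real"
  assumes \<alpha>: "0 < \<alpha>" "\<alpha> < 2" and F: "\<exists>g. has_fourier (\<lambda>x. complex_of_real (\<theta> x)) g"
    and c: "0 \<le> c" "\<And>\<xi>::real^'n. integrable lborel (\<lambda>y. (1 - cos (\<xi> \<bullet> y)) * kern \<alpha> y)"
    "\<And>\<xi>::real^'n. (\<integral>y. (1 - cos (\<xi> \<bullet> y)) * kern \<alpha> y \<partial>lborel) = c * norm \<xi> powr \<alpha>"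
    and \<theta>: "smooth \<theta>" and \<phi>: "cinf_c \<phi>" "\<And>x. 0 \<le> \<phi> x"
    and I: "frac_laplacian_distr \<alpha> \<theta> (\<lambda>x. \<theta> x * \<phi> x) = of_real I"
    and e: "cutoff_error \<alpha> \<theta> \<phi> \<le> ennreal e" "0 \<le> e"
  shows "(\<integral>\<^sup>+y. ennreal (kern \<alpha> y * (\<integral>x. (\<phi> x + \<phi> (x + y)) * (\<theta> x - \<theta> (x + y)) ^ 2 \<partial>lborel)) \<partial>lborel)
    \<le> ennreal (4 * c * \<bar>I\<bar> + 2 * e)"
proof -
  have [measurable]: "\<theta> \<in> borel_measurable borel" "\<phi> \<in> borel_measurable borel"
    using smooth_measurable[OF \<theta>] cinf_c_measurable[OF \<phi>(1)] by auto
  have \<psi>: "cinf_c (\<lambda>x. \<theta> x * \<phi> x)" by (rule cinf_c_mult[OF \<theta> \<phi>(1)])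
  define L where "L y = (\<integral>x. \<theta> x * second_diff (\<lambda>x. \<theta> x * \<phi> x) y x \<partial>lborel)" for y
  define M where "M y = (\<integral>x. \<theta> x ^ 2 * second_diff \<phi> y x \<partial>lborel)" for y
  define N where "N y = (\<integral>x. (\<phi> x + \<phi> (x + y)) * (\<theta> x - \<theta> (x + y)) ^ 2 \<partial>lborel)" for y
  have LMN: "kern \<alpha> y * N y = 4 * (kern \<alpha> y * L y) - 2 * (kern \<alpha> y * M y)" for y
    using localised_energy_identity[OF smooth_continuous_on[OF \<theta>] \<phi>(1), of y]
    by (simp add: L_def M_def N_def field_simps)
  have Li: "integrable lborel (\<lambda>y. kern \<alpha> y * L y)"
    unfolding L_def by (rule frac_laplacian_singular_integral(1)[OF \<alpha> F \<psi> c(2,3)])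
  have "complex_of_real (c * I) = of_real (\<integral>y. kern \<alpha> y * L y \<partial>lborel)"
    unfolding L_def using frac_laplacian_singular_integral(2)[OF \<alpha> F \<psi> c(2,3)] I by simp
  then have LI: "(\<integral>y. kern \<alpha> y * L y \<partial>lborel) = c * I" by (simp only: of_real_eq_iff)
  have [measurable]: "M \<in> borel_measurable borel"
    unfolding M_def second_diff_def by measurable
  have Mn: "(\<integral>\<^sup>+y. ennreal (norm (kern \<alpha> y * M y)) \<partial>lborel) \<le> ennreal e"
  proof (rule order_trans[OF _ e(1)], unfold cutoff_error_def, rule nn_integral_mono)
    fix y
    have "integrable lborel (\<lambda>x. kern \<alpha> y * (\<theta> x ^ 2 * second_diff \<phi> y x))"
      by (intro integrable_mult_right continuous_mult_cinf_c_integrable cinf_c_second_diff \<phi>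
          continuous_intros smooth_continuous_on \<theta>)
    from integral_norm_bound_ennreal[OF this]
    show "ennreal (norm (kern \<alpha> y * M y)) \<le> (\<integral>\<^sup>+x. ennreal (kern \<alpha> y * (\<theta> x ^ 2 * \<bar>second_diff \<phi> y x\<bar>)) \<partial>lborel)"
      by (simp add: M_def abs_mult)
  qed
  have Mi: "integrable lborel (\<lambda>y. kern \<alpha> y * M y)"
    by (rule integrableI_bounded) (use Mn in \<open>auto simp: le_less_trans\<close>)
  have Mb: "\<bar>\<integral>y. kern \<alpha> y * M y \<partial>lborel\<bar> \<le> e"
    using order_trans[OF integral_norm_bound_ennreal[OF Mi] Mn] e(2) by simp
  have Ni: "integrable lborel (\<lambda>y. kern \<alpha> y * N y)"
    unfolding LMN using Li Mi by simp
  have N0: "0 \<le> kern \<alpha> y * N y" for y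
    unfolding N_def using \<phi>(2) by (intro mult_nonneg_nonneg integral_nonneg_AE AE_I2) auto
  have "(\<integral>\<^sup>+y. ennreal (kern \<alpha> y * N y) \<partial>lborel) = ennreal (\<integral>y. kern \<alpha> y * N y \<partial>lborel)"
    by (rule nn_integral_eq_integral[OF Ni]) (simp add: N0)
  also have "(\<integral>y. kern \<alpha> y * N y \<partial>lborel) = 4 * (c * I) - 2 * (\<integral>y. kern \<alpha> y * M y \<partial>lborel)"
    unfolding LMN using Li Mi LI by simp
  also have "ennreal \<dots> \<le> ennreal (4 * c * \<bar>I\<bar> + 2 * e)"
  proof (rule ennreal_leI)
    have "c * I \<le> c * \<bar>I\<bar>" using c(1) by (intro mult_left_mono) auto
    then show "4 * (c * I) - 2 * (\<integral>y. kern \<alpha> y * M y \<partial>lborel) \<le> 4 * c * \<bar>I\<bar> + 2 * e"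
      using Mb by linarith
  qed
  finally show ?thesis unfolding N_def .
qed

text \<open>A null set has no interior point.\<close>

lemma AE_closed_imp_all:
  fixes P :: "real^'n \<Rightarrow> bool"
  assumes "AE x in lborel. P x" "closed {x. P x}"
  shows "P x"
proof -
  have o: "open {x. \<not> P x}" using assms(2) by (simp add: closed_def Compl_eq)
  then have m: "{x. \<not> P x} \<in> sets lborel" by simp
  then have "{x. \<not> P x} \<in> null_sets lborel"
    using assms(1) by (subst (asm) AE_iff_null) auto
  then have "negligible {x. \<not> P x}"
    by (simp add: negligible_iff_null_sets null_sets_completionI)
  then show ?thesis using open_not_negligible[OF o] by blast
qed

text \<open>For almost every \<open>y\<close> the inner integral vanishes, so by continuity \<open>\<theta>(x) = \<theta>(x+y)\<close> for all \<open>x\<close> in the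
open unit ball, in particular for \<open>x = 0\<close>. The set of \<open>y\<close> with \<open>\<theta>(y) = \<theta>(0)\<close> is closed, hence everything.\<close>

lemma vanishing_energy_imp_const:
  fixes \<theta> :: "real^'n \<Rightarrow> real"
  assumes \<theta>: "continuous_on UNIV \<theta>"
    and zero: "(\<integral>\<^sup>+y. ennreal (kern \<alpha> y * (\<integral>x. indicator (cball 0 1) x * (\<theta> x - \<theta> (x + y)) ^ 2 \<partial>lborel)) \<partial>lborel) = 0"
  shows "\<theta> z = \<theta> 0"
proof -
  have [measurable]: "\<theta> \<in> borel_measurable borel" by (rule borel_measurable_continuous_onI[OF \<theta>])
  have [measurable]: "cball (0::real^'n) 1 \<in> sets borel" by simp
  have \<theta>s: "continuous_on S (\<lambda>x. \<theta> (x + a))" for a S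
    by (rule continuous_on_compose2[OF \<theta>]) (auto intro!: continuous_intros)
  define D where "D y = (\<integral>x. indicator (cball 0 1) x * (\<theta> x - \<theta> (x + y)) ^ 2 \<partial>lborel)" for y
  have [measurable]: "D \<in> borel_measurable borel" unfolding D_def by measurable
  have D0: "0 \<le> D y" for y unfolding D_def by (intro integral_nonneg_AE AE_I2) simp
  have "AE y in lborel. ennreal (kern \<alpha> y * D y) = 0"
    using zero by (subst (asm) nn_integral_0_iff_AE) (simp_all add: D_def[symmetric])
  moreover have "AE y in lborel. y \<noteq> (0::real^'n)" by (rule AE_lborel_singleton)
  ultimately have "AE y in lborel. \<theta> y = \<theta> 0"
  proof eventually_elim
    fix y assume k: "ennreal (kern \<alpha> y * D y) = 0" and "y \<noteq> 0"
    then have "0 < kern \<alpha> y" by (simp add: kern_def)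
    then have D: "D y = 0" using k D0[of y] by (simp add: ennreal_eq_0_iff mult_le_0_iff)
    have "integrable lborel (\<lambda>x. indicator (cball 0 1) x *\<^sub>R (\<theta> x - \<theta> (x + y)) ^ 2)"
      by (rule borel_integrable_compact)
        (auto intro!: continuous_intros \<theta>s continuous_on_subset[OF \<theta>])
    then have "AE x in lborel. indicator (cball 0 1) x * (\<theta> x - \<theta> (x + y)) ^ 2 = 0"
      using D unfolding D_def by (subst (asm) integral_nonneg_eq_0_iff_AE) auto
    then have "AE x in lborel. 1 \<le> norm x \<or> \<theta> x - \<theta> (x + y) = 0"
      by eventually_elim (auto simp: indicator_def split: if_splits)
    moreover have "closed {x. 1 \<le> norm x \<or> \<theta> x - \<theta> (x + y) = 0}"
      by (intro closed_Collect_disj closed_Collect_le closed_Collect_eq continuous_intros \<theta> \<theta>s)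
    ultimately have "1 \<le> norm (0::real^'n) \<or> \<theta> 0 - \<theta> (0 + y) = 0"
      by (rule AE_closed_imp_all)
    then show "\<theta> y = \<theta> 0" by simp
  qed
  moreover have "closed {y. \<theta> y = \<theta> 0}"
    by (intro closed_Collect_eq continuous_intros \<theta>)
  ultimately show ?thesis by (rule AE_closed_imp_all)
qed


section \<open>The Liouville theorem\<close>

lemma Lp_interpolate:
  assumes "Lp a f" "Lp b f" "a \<le> p" "p \<le> b"
  shows "Lp p f"
proof -
  have [measurable]: "f \<in> borel_measurable borel" using assms by (simp add: Lp_def)
  have "integrable lborel (\<lambda>x. norm (f x) powr a + norm (f x) powr b)"
    using assms by (simp add: Lp_def)
  then have "integrable lborel (\<lambda>x. norm (f x) powr p)"
  proof (rule Bochner_Integration.integrable_bound, measurable, intro AE_I2)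
    fix x
    have "norm (f x) powr p \<le> norm (f x) powr a + norm (f x) powr b"
    proof (cases "norm (f x) \<le> 1")
      case True
      then have "norm (f x) powr p \<le> norm (f x) powr a"
        using assms by (cases "f x = 0") (auto intro: powr_mono')
      then show ?thesis by (simp add: add_increasing2)
    next
      case False
      then have "norm (f x) powr p \<le> norm (f x) powr b"
        using assms by (intro powr_mono) auto
      then show ?thesis by (simp add: add_increasing)
    qed
    then show "norm (norm (f x) powr p) \<le> norm (norm (f x) powr a + norm (f x) powr b)" by simp
  qed
  then show ?thesis by (simp add: Lp_def)
qed

lemma Lp_const_imp_zero:
  fixes f :: "real^'n \<Rightarrow> real"
  assumes "Lp p f" "\<And>x. f x = k"
  shows "k = 0"
proof (rule ccontr)
  assume k: "k \<noteq> 0"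
  have "f = (\<lambda>x. k)" using assms(2) by auto
  then have "integrable lborel (\<lambda>x::real^'n. \<bar>k\<bar> powr p)" using assms(1) by (simp add: Lp_def)
  then have "(\<integral>\<^sup>+x. ennreal (\<bar>k\<bar> powr p) \<partial>(lborel :: (real^'n) measure)) < \<infinity>"
    by (simp add: integrable_iff_bounded)
  then show False using k by (simp add: ennreal_mult_less_top)
qed

text \<open>The general form of the result: an exponent \<open>q\<close> strictly between \<open>2\<close> and \<open>2n/(n-\<alpha>)\<close> controls the
cutoff error, and an exponent \<open>p\<close> between \<open>3\<close> and \<open>3n/(n-1)\<close> controls the transport term.\<close>

lemma stationary_liouville:
  fixes \<theta> :: "real^'n \<Rightarrow> real" and A :: "'n \<Rightarrow> (real^'n \<Rightarrow> real) \<Rightarrow> real^'n \<Rightarrow> real"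
  assumes \<alpha>: "0 < \<alpha>" "\<alpha> < 2" "\<alpha> < real CARD('n)"
    and adm: "admissible A" and F: "\<exists>g. has_fourier (\<lambda>x. complex_of_real (\<theta> x)) g"
    and sol: "weak_solution \<alpha> A \<theta>" and \<theta>: "smooth \<theta>"
    and q: "Lp q \<theta>" "2 < q" "(real CARD('n) - \<alpha>) * (q - 2) < 2 * \<alpha>"
    and p: "Lp p \<theta>" "3 \<le> p" "(real CARD('n) - 1) * (p - 3) \<le> 3"
  shows "\<theta> x = 0"
proof -
  let ?A = "field_of A \<theta>"
  have "1 < p" using p(2) by simp
  then have A: "Lp p ?A" using adm p(1) unfolding admissible_def by blast
  obtain \<phi> :: "real^'n \<Rightarrow> real" where \<phi>: "smooth \<phi>" "\<And>x. 0 \<le> \<phi> x"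
    "\<And>x. norm x \<le> 1 \<Longrightarrow> \<phi> x = 1" "\<And>x. 2 < norm x \<Longrightarrow> \<phi> x = 0"
    using smooth_cutoff by blast
  have c\<phi>: "cinf_c \<phi>" using \<phi>(1,4) by (auto simp: cinf_c_def)
  obtain c where c: "0 \<le> c" "\<And>\<xi>::real^'n. integrable lborel (\<lambda>y. (1 - cos (\<xi> \<bullet> y)) * kern \<alpha> y)"
    "\<And>\<xi>::real^'n. (\<integral>y. (1 - cos (\<xi> \<bullet> y)) * kern \<alpha> y \<partial>lborel) = c * norm \<xi> powr \<alpha>"
    using norm_powr_integral[OF \<alpha>(1,2)] by blast
  obtain e where e: "e \<longlonglongrightarrow> 0" "\<And>m. 0 \<le> e m"
    "\<And>m. cutoff_error \<alpha> \<theta> (dilate \<phi> (real (Suc m))) \<le> ennreal (e m)"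
    using cutoff_error_tendsto[OF \<alpha> c\<phi> q(2,3,1)] by blast
  define I where "I m = (\<integral>x. \<theta> x ^ 2 * (?A x \<bullet> grad (dilate \<phi> (real (Suc m))) x) \<partial>lborel) / 2" for m
  have "I \<longlonglongrightarrow> 0 / 2"
    unfolding I_def by (intro tendsto_intros flux_tendsto[OF p(1) A p(2,3) c\<phi> \<phi>(3,4)]) auto
  then have "(\<lambda>m. 4 * c * \<bar>I m\<bar> + 2 * e m) \<longlonglongrightarrow> 4 * c * \<bar>0 / 2\<bar> + 2 * 0"
    by (intro tendsto_intros e(1))
  then have lim: "(\<lambda>m. 4 * c * \<bar>I m\<bar> + 2 * e m) \<longlonglongrightarrow> 0" by simp
  have \<theta>c: "continuous_on UNIV (\<lambda>x. \<theta> (x + a))" for a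
    by (rule continuous_on_compose2[OF smooth_continuous_on[OF \<theta>, of UNIV]])
      (auto intro!: continuous_intros)
  let ?D = "\<lambda>y. \<integral>x. indicator (cball 0 1) x * (\<theta> x - \<theta> (x + y)) ^ 2 \<partial>lborel"
  let ?J = "\<integral>\<^sup>+y. ennreal (kern \<alpha> y * ?D y) \<partial>lborel"
  have J: "?J \<le> ennreal (4 * c * \<bar>I m\<bar> + 2 * e m)" for m
  proof -
    let ?\<phi> = "dilate \<phi> (real (Suc m))"
    have c\<phi>': "cinf_c ?\<phi>" by (rule cinf_c_dilate[OF c\<phi>]) simp
    have nonneg: "0 \<le> ?\<phi> x" for x by (simp add: dilate_def \<phi>(2))
    have one: "?\<phi> x = 1" if "norm x \<le> 1" for x
      unfolding dilate_def by (rule \<phi>(3)) (use that in \<open>simp add: divide_le_eq\<close>)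
    have "?J \<le> (\<integral>\<^sup>+y. ennreal (kern \<alpha> y * (\<integral>x. (?\<phi> x + ?\<phi> (x + y)) * (\<theta> x - \<theta> (x + y)) ^ 2 \<partial>lborel)) \<partial>lborel)"
    proof (rule nn_integral_mono, rule ennreal_leI, rule mult_left_mono[OF _ kern_nonneg])
      fix y
      let ?d = "\<lambda>x. (\<theta> x - \<theta> (x + y)) ^ 2"
      have cd: "continuous_on UNIV ?d"
        by (intro continuous_intros \<theta>c smooth_continuous_on[OF \<theta>])
      have "integrable lborel (\<lambda>x. ?d x * (?\<phi> x + ?\<phi> (x + y)))"
        by (intro continuous_mult_cinf_c_integrable cd cinf_c_add cinf_c_shift c\<phi>')
      then have i: "integrable lborel (\<lambda>x. (?\<phi> x + ?\<phi> (x + y)) * ?d x)" by (simp add: mult.commute)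
      show "?D y \<le> (\<integral>x. (?\<phi> x + ?\<phi> (x + y)) * ?d x \<partial>lborel)"
      proof (rule integral_mono_AE'[OF i])
        show "AE x in lborel. indicator (cball 0 1) x * ?d x \<le> (?\<phi> x + ?\<phi> (x + y)) * ?d x"
        proof (rule AE_I2, rule mult_right_mono)
          fix x
          show "indicator (cball 0 1) x \<le> ?\<phi> x + ?\<phi> (x + y)"
            using one[of x] nonneg[of x] nonneg[of "x + y"] by (auto simp: indicator_def)
        qed simp
      qed (intro AE_I2 mult_nonneg_nonneg add_nonneg_nonneg nonneg zero_le_power2)
    qed
    also have "\<dots> \<le> ennreal (4 * c * \<bar>I m\<bar> + 2 * e m)"
      by (rule energy_bound[OF \<alpha>(1,2) F c \<theta> c\<phi>' nonneg _ e(3,2)])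
        (unfold I_def, rule weak_solution_tested[OF sol adm \<theta> p(1) \<open>1 < p\<close> c\<phi>'])
    finally show ?thesis .
  qed
  have "?J \<le> ennreal 0"
    by (rule LIMSEQ_le_const[OF tendsto_ennrealI[OF lim]]) (use J in auto)
  then have "?J = 0" by simp
  then have const: "\<theta> z = \<theta> 0" for z
    by (rule vanishing_energy_imp_const[OF smooth_continuous_on[OF \<theta>]])
  then have "\<theta> 0 = 0" by (rule Lp_const_imp_zero[OF p(1)])
  then show ?thesis using const by simp
qed

text \<open>The choice \<open>\<epsilon>0 = 2\<alpha>\<close> keeps the exponent \<open>(2n-\<epsilon>)/(n-\<alpha>)\<close> strictly between \<open>2\<close> and the critical exponent
\<open>2n/(n-\<alpha>)\<close>. For \<open>\<alpha> < n/3\<close> the critical exponent is below \<open>3\<close> and the one given by \<open>\<nu>\<close> is above, so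
\<open>\<theta>\<close> lies in \<open>L\<^sup>3\<close>; for intermediate \<open>\<alpha>\<close> the critical exponent itself serves in the transport term.\<close>

theorem theorem2:
  fixes n :: nat and \<alpha> :: real
  assumes "CARD('n::finite) = n" and "n \<in> {2, 3, 4}" and "0 < \<alpha>" and "\<alpha> < 2"
  shows "\<exists>\<epsilon>0>0. \<forall>(A :: 'n \<Rightarrow> (real^'n \<Rightarrow> real) \<Rightarrow> real^'n \<Rightarrow> real) (\<theta> :: real^'n \<Rightarrow> real) \<epsilon>.
    admissible A \<longrightarrow>
    Hdot (\<alpha> / 2) \<theta> \<longrightarrow>
    weak_solution \<alpha> A \<theta> \<longrightarrow>
    smooth \<theta> \<longrightarrow>
    0 < \<epsilon> \<longrightarrow> \<epsilon> < \<epsilon>0 \<longrightarrow> Lp ((2 * real n - \<epsilon>) / (real n - \<alpha>)) \<theta> \<longrightarrow>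
    (\<alpha> < real n / 3 \<longrightarrow>
      (\<exists>\<nu>. real n - 3 * \<alpha> < \<nu> \<and> \<nu> < 1 + (real n - 3 * \<alpha>) \<and>
           Lp ((2 * real n + \<nu>) / (real n - \<alpha>)) \<theta>)) \<longrightarrow>
    ((real n + 2) / 3 \<le> \<alpha> \<longrightarrow> Lp (3 * real n / (real n - 1)) \<theta>) \<longrightarrow>
    (\<forall>x. \<theta> x = 0)"
proof (intro exI[of _ "2 * \<alpha>"] conjI allI impI)
  show "0 < 2 * \<alpha>" using assms by simp
next
  fix A :: "'n \<Rightarrow> (real^'n \<Rightarrow> real) \<Rightarrow> real^'n \<Rightarrow> real" and \<theta> :: "real^'n \<Rightarrow> real" and \<epsilon> x
  assume adm: "admissible A" and H: "Hdot (\<alpha> / 2) \<theta>" and sol: "weak_solution \<alpha> A \<theta>"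
    and \<theta>: "smooth \<theta>" and \<epsilon>: "0 < \<epsilon>" "\<epsilon> < 2 * \<alpha>"
    and q: "Lp ((2 * real n - \<epsilon>) / (real n - \<alpha>)) \<theta>"
    and small: "\<alpha> < real n / 3 \<longrightarrow>
      (\<exists>\<nu>. real n - 3 * \<alpha> < \<nu> \<and> \<nu> < 1 + (real n - 3 * \<alpha>) \<and>
           Lp ((2 * real n + \<nu>) / (real n - \<alpha>)) \<theta>)"
    and large: "(real n + 2) / 3 \<le> \<alpha> \<longrightarrow> Lp (3 * real n / (real n - 1)) \<theta>"
  have n: "2 \<le> real n" "real CARD('n) = real n" using assms by auto
  have \<alpha>n: "\<alpha> < real n" using n assms(4) by linarith
  have F: "\<exists>g. has_fourier (\<lambda>x. complex_of_real (\<theta> x)) g"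
    using H by (auto simp: Hdot_def is_frac_laplacian_def)
  have crit: "Lp (2 * real n / (real n - \<alpha>)) \<theta>"
    using H by (simp add: Hdot_def n(2))
  have "\<exists>p\<ge>3. (real n - 1) * (p - 3) \<le> 3 \<and> Lp p \<theta>"
  proof -
    consider "\<alpha> < real n / 3" | "real n / 3 \<le> \<alpha>" "\<alpha> < (real n + 2) / 3" | "(real n + 2) / 3 \<le> \<alpha>"
      by linarith
    then show ?thesis
    proof cases
      case 1
      then obtain \<nu> where \<nu>: "real n - 3 * \<alpha> < \<nu>" "Lp ((2 * real n + \<nu>) / (real n - \<alpha>)) \<theta>"
        using small by blast
      have "Lp 3 \<theta>"
        by (rule Lp_interpolate[OF crit \<nu>(2)]) (use 1 \<nu>(1) \<alpha>n in \<open>simp_all add: field_simps\<close>)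
      then show ?thesis by (intro exI[of _ 3]) simp
    next
      case 2
      have "(real n - 1) * (2 * real n / (real n - \<alpha>) - 3) = (real n - 1) * (3 * \<alpha> - real n) / (real n - \<alpha>)"
        using \<alpha>n by (simp add: field_simps)
      also have "\<dots> \<le> 3"
      proof -
        have "real n * (3 * \<alpha>) \<le> real n * (real n + 2)"
          using 2 n by (intro mult_left_mono) auto
        then have "(real n - 1) * (3 * \<alpha> - real n) \<le> 3 * (real n - \<alpha>)"
          by (simp add: algebra_simps)
        then show ?thesis using \<alpha>n by (simp add: divide_le_eq)
      qed
      finally show ?thesis
        using 2 crit \<alpha>n by (intro exI[of _ "2 * real n / (real n - \<alpha>)"]) (simp add: field_simps)
    next
      case 3
      then have "Lp (3 * real n / (real n - 1)) \<theta>" using large by blast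
      moreover have "(real n - 1) * (3 * real n / (real n - 1) - 3) = 3"
        using n by (simp add: field_simps)
      moreover have "3 \<le> 3 * real n / (real n - 1)" using n by (simp add: field_simps)
      ultimately show ?thesis by (intro exI[of _ "3 * real n / (real n - 1)"]) simp
    qed
  qed
  then obtain p where p: "Lp p \<theta>" "3 \<le> p" "(real CARD('n) - 1) * (p - 3) \<le> 3"
    using n by auto
  have q2: "2 < (2 * real n - \<epsilon>) / (real n - \<alpha>)" using \<alpha>n \<epsilon> by (simp add: field_simps)
  have q3: "(real CARD('n) - \<alpha>) * ((2 * real n - \<epsilon>) / (real n - \<alpha>) - 2) < 2 * \<alpha>"
    using \<alpha>n \<epsilon> n by (simp add: field_simps)
  show "\<theta> x = 0"
    by (rule stationary_liouville[OF assms(3,4) _ adm F sol \<theta> q q2 q3 p]) (use \<alpha>n n in simp)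
qed

end
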